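(* Let $\mathbf{x}_1,\dots,\mathbf{x}_n\in\mathbb{R}^d$ be labelled samples from $l\le d$ classes, $\lambda\ge0$, $\mathbf{S}_B,\mathbf{S}_w$ the between- and within-class scatter matrices, and assume $\mathbf{S}_w+\lambda\mathbf{I}_d$ is symmetric positive definite. Let $\mathbf{N}=\mathrm{diag}(\mu_1,\dots,\mu_p)$ with $\mu_1>\dots>\mu_p>0$, and consider minimizing $f_{FDA}(\mathbf{W})=-\tfrac12\mathrm{Tr}(\mathbf{W}^T\mathbf{S}_B\mathbf{W}\mathbf{N})$ over $\mathrm{St}_{\mathbf{S}_w+\lambda\mathbf{I}_d}(p,d)$ endowed with the Riemannian metric $g_{\mathbf{W}}(\xi,\eta)=\mathrm{Tr}(\xi^T\mathbf{M}\eta)$ for a given symmetric positive definite $\mathbf{M}\in\mathbb{R}^{d\times d}$. Assume $\rho_1>\rho_2>\dots>\rho_{p+1}\ge0$, and let $\mathbf{W}^\star$ be the global minimizer. Then $$\kappa(\mathrm{Hess} f_{FDA}(\mathbf{W}^\star))\le\kappa^\star_{FDA}\cdot\kappa(\mathbf{S}_w+\lambda\mathbf{I}_d,\mathbf{M}),\qquad \kappa^\star_{FDA}:=\frac{\mu_1(\rho_1-\rho_d)}{\min\{\mu_p(\rho_p-\rho_{p+1}),\ \min_{1\le j<p}\tfrac12(\mu_j-\mu_{j+1})(\rho_j-\rho_{j+1})\}}.$$ If $\mathbf{M}=\mathbf{S}_w+\lambda\mathbf{I}_d$ then $\kappa(\mathrm{Hess} f_{FDA}(\mathbf{W}^\s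tar))=\kappa^\star_{FDA}$.
   Context: $\mathbf{S}_B=\sum_{k=1}^l n_k(\mathbf{m}_k-\mathbf{m})(\mathbf{m}_k-\mathbf{m})^T$, $\mathbf{S}_w=\sum_{i=1}^n(\mathbf{x}_i-\mathbf{m}_{y_i})(\mathbf{x}_i-\mathbf{m}_{y_i})^T$, where $y_i$ is the label of $\mathbf{x}_i$, $n_k$ the size and $\mathbf{m}_k$ the mean of class $k$, $\mathbf{m}$ the overall mean. $\rho_1\ge\dots\ge\rho_d\ge0$ are the generalized eigenvalues of the pencil $(\mathbf{S}_B,\mathbf{S}_w+\lambda\mathbf{I}_d)$. $\mathrm{St}_{\mathbf{B}}(p,d)=\{\mathbf{W}\in\mathbb{R}^{d\times p}:\mathbf{W}^T\mathbf{B}\mathbf{W}=\mathbf{I}_p\}$; with metric $g$ it is a Riemannian submanifold of $\mathbb{R}^{d\times p}$ with inner product $\mathrm{Tr}(\xi^T\mathbf{M}\eta)$, and $\mathrm{Hess}$ denotes the Riemannian (Levi-Civita) Hessian, a $g$-self-adjoint operator on the tangent space; $\kappa$ of it is the ratio of largest to smallest eigenvalue in absolute value. For SPD $\mathbf{A},\mathbf{B}$, $\kappa(\mathbf{A},\mathbf{B})=\kappa(\mathbf{B}^{-1/2}\mathbf{A}\mathbf{B}^{-1/2})$. *)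

theory Defs
  imports "Jordan_Normal_Form.Determinant" "Jordan_Normal_Form.Char_Poly"
begin

definition sym_pos_def_mat :: "nat \<Rightarrow> real mat \<Rightarrow> bool" where
  "sym_pos_def_mat d A \<longleftrightarrow> A \<in> carrier_mat d d \<and> A\<^sup>T = A \<and>
     (\<forall>v \<in> carrier_vec d. v \<noteq> 0\<^sub>v d \<longrightarrow> v \<bullet> (A *\<^sub>v v) > 0)"

definition kappa_mat :: "real mat \<Rightarrow> real" where
  "kappa_mat A = Max {\<bar>r\<bar> | r. eigenvalue A r} / Min {\<bar>r\<bar> | r. eigenvalue A r}"

definition inv_sqrt_mat :: "nat \<Rightarrow> real mat \<Rightarrow> real mat" where
  "inv_sqrt_mat d B = (THE C. sym_pos_def_mat d C \<and> C * C * B = 1\<^sub>m d)"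

definition kappa_pencil :: "nat \<Rightarrow> real mat \<Rightarrow> real mat \<Rightarrow> real" where
  "kappa_pencil d A B = kappa_mat (inv_sqrt_mat d B * A * inv_sqrt_mat d B)"

definition class_size :: "(nat \<Rightarrow> nat) \<Rightarrow> nat \<Rightarrow> nat \<Rightarrow> nat" where
  "class_size y n k = card {i. i < n \<and> y i = k}"

definition class_mean :: "(nat \<Rightarrow> real vec) \<Rightarrow> (nat \<Rightarrow> nat) \<Rightarrow> nat \<Rightarrow> nat \<Rightarrow> nat \<Rightarrow> real" where
  "class_mean x y n k a = (\<Sum>i \<in> {i. i < n \<and> y i = k}. x i $ a) / real (class_size y n k)"

definition total_mean :: "(nat \<Rightarrow> real vec) \<Rightarrow> nat \<Rightarrow> nat \<Rightarrow> real" where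
  "total_mean x n a = (\<Sum>i<n. x i $ a) / real n"

definition scatter_B :: "nat \<Rightarrow> nat \<Rightarrow> (nat \<Rightarrow> real vec) \<Rightarrow> (nat \<Rightarrow> nat) \<Rightarrow> nat \<Rightarrow> real mat" where
  "scatter_B d l x y n = mat d d (\<lambda>(a, b). \<Sum>k<l. real (class_size y n k) *
       (class_mean x y n k a - total_mean x n a) * (class_mean x y n k b - total_mean x n b))"

definition scatter_w :: "nat \<Rightarrow> (nat \<Rightarrow> real vec) \<Rightarrow> (nat \<Rightarrow> nat) \<Rightarrow> nat \<Rightarrow> real mat" where
  "scatter_w d x y n = mat d d (\<lambda>(a, b). \<Sum>i<n.
       (x i $ a - class_mean x y n (y i) a) * (x i $ b - class_mean x y n (y i) b))"

definition gen_stiefel :: "nat \<Rightarrow> nat \<Rightarrow> real mat \<Rightarrow> real mat set" where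
  "gen_stiefel p d B = {W \<in> carrier_mat d p. W\<^sup>T * B * W = 1\<^sub>m p}"

definition mat_trace :: "real mat \<Rightarrow> real" where
  "mat_trace A = (\<Sum>i < dim_row A. A $$ (i, i))"

definition metric_g :: "real mat \<Rightarrow> real mat \<Rightarrow> real mat \<Rightarrow> real" where
  "metric_g M \<xi> \<eta> = mat_trace (\<xi>\<^sup>T * M * \<eta>)"

text \<open>Tangent space at Y (the formula makes sense, and is used, for every Y in R^(d x p);
  on the manifold it is the tangent space of St_B(p,d)).\<close>
definition tangent_space :: "nat \<Rightarrow> nat \<Rightarrow> real mat \<Rightarrow> real mat \<Rightarrow> real mat set" where
  "tangent_space p d B Y = {\<xi> \<in> carrier_mat d p. \<xi>\<^sup>T * B * Y + Y\<^sup>T * B * \<xi> = 0\<^sub>m p p}"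

definition tangent_proj :: "nat \<Rightarrow> nat \<Rightarrow> real mat \<Rightarrow> real mat \<Rightarrow> real mat \<Rightarrow> real mat \<Rightarrow> real mat" where
  "tangent_proj p d B M Y Z = (THE \<xi>. \<xi> \<in> tangent_space p d B Y \<and>
      (\<forall>\<eta> \<in> tangent_space p d B Y. metric_g M (Z - \<xi>) \<eta> = 0))"

definition deriv0 :: "(real \<Rightarrow> real) \<Rightarrow> real" where
  "deriv0 g = (THE D. (g has_real_derivative D) (at 0))"

definition dir_deriv_mat :: "nat \<Rightarrow> nat \<Rightarrow> (real mat \<Rightarrow> real mat) \<Rightarrow> real mat \<Rightarrow> real mat \<Rightarrow> real mat" where
  "dir_deriv_mat r c G W \<xi> = mat r c (\<lambda>(i, j). deriv0 (\<lambda>t. G (W + t \<cdot>\<^sub>m \<xi>) $$ (i, j)))"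

definition euclid_grad :: "nat \<Rightarrow> nat \<Rightarrow> real mat \<Rightarrow> (real mat \<Rightarrow> real) \<Rightarrow> real mat \<Rightarrow> real mat" where
  "euclid_grad p d M f Y = (THE G. G \<in> carrier_mat d p \<and>
      (\<forall>\<eta> \<in> carrier_mat d p. deriv0 (\<lambda>t. f (Y + t \<cdot>\<^sub>m \<eta>)) = metric_g M G \<eta>))"

text \<open>Riemannian gradient (smoothly extended to a neighbourhood of the manifold by the
  same projection formula).\<close>
definition riem_grad :: "nat \<Rightarrow> nat \<Rightarrow> real mat \<Rightarrow> real mat \<Rightarrow> (real mat \<Rightarrow> real) \<Rightarrow> real mat \<Rightarrow> real mat" where
  "riem_grad p d B M f Y = tangent_proj p d B M Y (euclid_grad p d M f Y)"

text \<open>Riemannian (Levi-Civita) Hessian of a Riemannian submanifold of a Euclidean space: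
  Hess f(W)[xi] = P_W (D grad f(W)[xi]).\<close>
definition riem_hess :: "nat \<Rightarrow> nat \<Rightarrow> real mat \<Rightarrow> real mat \<Rightarrow> (real mat \<Rightarrow> real) \<Rightarrow> real mat \<Rightarrow> real mat \<Rightarrow> real mat" where
  "riem_hess p d B M f W \<xi> =
     tangent_proj p d B M W (dir_deriv_mat d p (riem_grad p d B M f) W \<xi>)"

definition hess_eigenvalues :: "nat \<Rightarrow> nat \<Rightarrow> real mat \<Rightarrow> real mat \<Rightarrow> (real mat \<Rightarrow> real) \<Rightarrow> real mat \<Rightarrow> real set" where
  "hess_eigenvalues p d B M f W = {r. \<exists>\<xi> \<in> tangent_space p d B W. \<xi> \<noteq> 0\<^sub>m d p \<and>
      riem_hess p d B M f W \<xi> = r \<cdot>\<^sub>m \<xi>}"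

definition kappa_hess :: "nat \<Rightarrow> nat \<Rightarrow> real mat \<Rightarrow> real mat \<Rightarrow> (real mat \<Rightarrow> real) \<Rightarrow> real mat \<Rightarrow> real" where
  "kappa_hess p d B M f W =
     Max ((\<lambda>r. \<bar>r\<bar>) ` hess_eigenvalues p d B M f W) / Min ((\<lambda>r. \<bar>r\<bar>) ` hess_eigenvalues p d B M f W)"

definition diag_N :: "nat \<Rightarrow> (nat \<Rightarrow> real) \<Rightarrow> real mat" where
  "diag_N p \<mu> = mat p p (\<lambda>(i, j). if i = j then \<mu> (i + 1) else 0)"

definition f_FDA :: "real mat \<Rightarrow> real mat \<Rightarrow> real mat \<Rightarrow> real" where
  "f_FDA SB N W = - (1/2) * mat_trace (W\<^sup>T * SB * W * N)"

definition kappa_star_FDA :: "nat \<Rightarrow> nat \<Rightarrow> (nat \<Rightarrow> real) \<Rightarrow> (nat \<Rightarrow> real) \<Rightarrow> real" where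
  "kappa_star_FDA p d \<mu> \<rho> = \<mu> 1 * (\<rho> 1 - \<rho> d) /
     Min ({\<mu> p * (\<rho> p - \<rho> (p + 1))} \<union>
          {(1/2) * (\<mu> j - \<mu> (j + 1)) * (\<rho> j - \<rho> (j + 1)) | j. 1 \<le> j \<and> j < p})"

end

theory Submission
  imports Defs
begin

text \<open>
  Write \<open>B = S\<^sub>w + \<lambda> I\<close>. The linear program dual to the assignment problem shows that the columns
  of the minimizer are, up to sign, the leading \<open>B\<close>-orthonormal eigenvectors of the pencil
  \<open>(S\<^sub>B, B)\<close>. In such an eigenframe the Hessian form is diagonal on the tangent space, with
  entries \<open>\<mu>\<^sub>j (\<rho>\<^sub>j - \<rho>\<^sub>a)\<close> for \<open>j \<le> p < a\<close> and \<open>(\<mu>\<^sub>j - \<mu>\<^sub>a) (\<rho>\<^sub>j - \<rho>\<^sub>a) / 2\<close> for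
  \<open>j < a \<le> p\<close>, relative to the metric of \<open>B\<close>. At a critical point this form does not depend on the
  metric, so passing from \<open>B\<close> to \<open>M\<close> changes the Rayleigh quotients only by values of the quotient
  of the two metrics, which lie between the extreme eigenvalues of the pencil \<open>(B, M)\<close>.
\<close>

section \<open>Real symmetric matrices\<close>

text \<open>The Hessian differentiates a gradient that is extended off the manifold by an orthogonal
  projection, and this projection contains the solution of a Lyapunov equation that depends on the
  base point. The obstacle is to control that solution near the minimizer. For W on the manifold and
  tangent \<xi>, the point Y = W + t \<xi> satisfies Y^T B Y = I + t^2 \<xi>^T B \<xi>, which
  dominates I for every t. Hence the Lyapunov operators are coercive with one constant along the
  whole line, which yields both existence of the projections off the manifold and their continuity
  at t = 0. The factor 1/2 in the denominator comes from skewness: within the top p by p block of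
  the frame coordinates, mirrored entries are negatives of each other and their two weights get
  averaged. Condition numbers are quotients of \<open>Max\<close> and \<open>Min\<close>, so the
  spectra must be shown finite and nonempty. For a general M no eigenvector is explicit; the
  spectrum is therefore identified with that of a finite symmetric pencil in a basis of the tangent
  space.\<close>

lemma mat_mult_assoc:
  fixes A :: "'a::semiring_0 mat"
  shows "dim_col A = dim_row B \<Longrightarrow> dim_col B = dim_row C \<Longrightarrow> A * B * C = A * (B * C)"
  by (rule assoc_mult_mat[of A "dim_row A" "dim_row B" B "dim_row C" C "dim_col C"]) auto

lemma mat_transpose_mult:
  fixes A :: "'a::comm_semiring_0 mat"
  shows "dim_col A = dim_row B \<Longrightarrow> (A * B)\<^sup>T = B\<^sup>T * A\<^sup>T"
  by (rule transpose_mult[of A "dim_row A" "dim_row B" B "dim_col B"]) auto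

lemma mat_vec_assoc:
  fixes A :: "'a::semiring_0 mat"
  shows "dim_col A = dim_row B \<Longrightarrow> dim_col B = dim_vec v \<Longrightarrow> A * B *\<^sub>v v = A *\<^sub>v (B *\<^sub>v v)"
  by (rule assoc_mult_mat_vec[of A "dim_row A" "dim_row B" B "dim_vec v" v]) (auto intro: carrier_vecI)

lemma mat_mult_cancel_left:
  fixes A :: "'a::semiring_1 mat"
  shows "A * B = 1\<^sub>m n \<Longrightarrow> dim_col A = dim_row B \<Longrightarrow> dim_col B = dim_row C \<Longrightarrow> dim_row C = n \<Longrightarrow> A * (B * C) = C"
  by (metis mat_mult_assoc left_mult_one_mat carrier_matI)

lemma scalar_prod_self_pos:
  fixes v :: "real vec"
  assumes "v \<in> carrier_vec n" "v \<noteq> 0\<^sub>v n"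
  shows "v \<bullet> v > 0"
proof -
  obtain i where "i < n" "v $ i \<noteq> 0" using assms by (metis carrier_vecD eq_vecI index_zero_vec)
  hence "0 < (\<Sum>i = 0..<n. v $ i * v $ i)"
    by (intro sum_pos2[of _ i]) (auto simp: zero_less_mult_iff linorder_neq_iff)
  thus ?thesis using assms by (simp add: scalar_prod_def)
qed

text \<open>Multiplying A v = k v on the left by the conjugate transpose of v gives the form
  \<open>S\<close> = k |v|^2. Symmetry of the real matrix makes \<open>S\<close> its own conjugate,
  and |v|^2 is not 0.\<close>

lemma sym_complex_eigenvalue_real:
  fixes A :: "real mat"
  assumes A: "A \<in> carrier_mat n n" and sym: "A\<^sup>T = A"
    and ev: "eigenvalue (map_mat complex_of_real A) k"
  shows "Im k = 0"
proof -
  let ?A = "map_mat complex_of_real A"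
  obtain v where v: "v \<in> carrier_vec n" "v \<noteq> 0\<^sub>v n" and Av: "?A *\<^sub>v v = k \<cdot>\<^sub>v v"
    using ev A unfolding eigenvalue_def eigenvector_def by auto
  have aij: "A $$ (i,j) = A $$ (j,i)" if "i < n" "j < n" for i j
    using sym A that by (metis carrier_matD index_transpose_mat(1))
  have Avi: "(\<Sum>j<n. complex_of_real (A $$ (i,j)) * v $ j) = k * v $ i" if "i < n" for i
  proof -
    have "(?A *\<^sub>v v) $ i = (\<Sum>j<n. complex_of_real (A $$ (i,j)) * v $ j)"
      using A v that by (auto simp: scalar_prod_def lessThan_atLeast0 intro!: sum.cong)
    thus ?thesis using Av v that by auto
  qed
  define s where "s = (\<Sum>i<n. (cmod (v $ i))\<^sup>2)"
  define S where "S = (\<Sum>i<n. \<Sum>j<n. cnj (v $ i) * complex_of_real (A $$ (i,j)) * v $ j)"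
  have S: "S = k * complex_of_real s"
  proof -
    have "S = (\<Sum>i<n. cnj (v $ i) * (\<Sum>j<n. complex_of_real (A $$ (i,j)) * v $ j))"
      by (simp add: S_def sum_distrib_left mult.assoc)
    also have "\<dots> = (\<Sum>i<n. k * complex_of_real ((cmod (v $ i))\<^sup>2))"
      using Avi by (intro sum.cong refl) (simp add: complex_norm_square mult_ac del: of_real_power)
    finally show ?thesis by (simp add: s_def sum_distrib_left)
  qed
  have "cnj S = (\<Sum>i<n. \<Sum>j<n. v $ i * complex_of_real (A $$ (i,j)) * cnj (v $ j))"
    by (simp add: S_def)
  also have "\<dots> = (\<Sum>j<n. \<Sum>i<n. v $ i * complex_of_real (A $$ (i,j)) * cnj (v $ j))"
    by (rule sum.swap)
  also have "\<dots> = S"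
    unfolding S_def by (intro sum.cong refl) (simp add: aij mult_ac)
  finally have "cnj S = S" .
  hence "Im S = 0" by (metis Reals_cnj_iff complex_is_Real_iff)
  hence "Im k * s = 0" using S by simp
  moreover have "s \<noteq> 0"
  proof
    assume "s = 0"
    hence "\<forall>i<n. v $ i = 0" unfolding s_def by (subst (asm) sum_nonneg_eq_0_iff) auto
    hence "v = 0\<^sub>v n" using v by (intro eq_vecI) auto
    thus False using v by simp
  qed
  ultimately show ?thesis by simp
qed

text \<open>Over the complex numbers the polynomial splits, and every root is an eigenvalue, hence
  real. Taking real parts of the roots therefore changes nothing, and injectivity of the embedding
  pulls the factorization back.\<close>

lemma sym_char_poly_splits:
  fixes A :: "real mat"
  assumes A: "A \<in> carrier_mat n n" and sym: "A\<^sup>T = A"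
  shows "\<exists>es. char_poly A = (\<Prod>e\<leftarrow>es. [:-e, 1:]) \<and> length es = n"
proof -
  interpret mp: map_poly_inj_comm_ring_hom complex_of_real ..
  let ?A = "map_mat complex_of_real A"
  have A': "?A \<in> carrier_mat n n" using A by simp
  obtain as where as: "char_poly ?A = (\<Prod>a\<leftarrow>as. [:-a, 1:])" "length as = n"
    using char_poly_factorized[OF A'] by blast
  have re: "complex_of_real (Re a) = a" if "a \<in> set as" for a
  proof -
    have "poly (char_poly ?A) a = 0"
      unfolding as poly_prod_list using that by (auto simp: prod_list_zero_iff)
    hence "eigenvalue ?A a" using eigenvalue_root_char_poly[OF A'] by simp
    thus ?thesis using sym_complex_eigenvalue_real[OF A sym] by (simp add: complex_eq_iff)
  qed
  have "map_poly complex_of_real (\<Prod>e\<leftarrow>map Re as. [:-e, 1:]) = (\<Prod>a\<leftarrow>as. [:-a, 1:])"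
    using re by (induction as) (auto simp: hom_distribs)
  also have "\<dots> = map_poly complex_of_real (char_poly A)"
    by (rule trans[OF as(1)[symmetric] of_real_hom.char_poly_hom[OF A]])
  finally have "(\<Prod>e\<leftarrow>map Re as. [:-e, 1:]) = char_poly A" by simp
  thus ?thesis using as by (intro exI[of _ "map Re as"]) auto
qed

text \<open>The reflection in the hyperplane orthogonal to v - e_0 exchanges e_0 and the unit vector
  v. It serves as an orthogonal matrix with prescribed first column \<open>v\<close>; the case v =
  e_0, where the reflection vector vanishes, is settled by the identity.\<close>

lemma householder:
  fixes v :: "real vec"
  assumes v: "v \<in> carrier_vec n" and n: "n > 0" and unit: "v \<bullet> v = 1"
  shows "\<exists>W\<in>carrier_mat n n. W\<^sup>T = W \<and> W * W = 1\<^sub>m n \<and> W *\<^sub>v unit_vec n 0 = v"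
proof (cases "v = unit_vec n 0")
  case True
  thus ?thesis by (intro bexI[of _ "1\<^sub>m n"]) auto
next
  case False
  define w where "w = v - unit_vec n 0"
  define s where "s = w \<bullet> w"
  have w: "w \<in> carrier_vec n" using v by (simp add: w_def)
  have v0: "unit_vec n 0 \<bullet> v = v $ 0" "v \<bullet> unit_vec n 0 = v $ 0"
    using v n by (auto simp: scalar_prod_left_unit scalar_prod_right_unit)
  have "s = v \<bullet> v - v $ 0 - (v $ 0 - 1)"
    using v n by (simp add: s_def w_def minus_scalar_prod_distrib[of _ n] scalar_prod_minus_distrib[of _ n]
        v0)
  hence s: "s = 2 * (1 - v $ 0)" using unit by simp
  have s0: "s \<noteq> 0"
  proof
    assume "s = 0"
    hence "\<forall>i<n. w $ i = 0"
      using w unfolding s_def scalar_prod_def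
      by (auto simp: sum_nonneg_eq_0_iff)
    hence "v = unit_vec n 0" using v by (intro eq_vecI) (auto simp: w_def)
    thus False using False by simp
  qed
  define c where "c = 2 / s"
  define W where "W = mat n n (\<lambda>(i,j). (if i = j then 1 else 0) - c * w $ i * w $ j)"
  have W: "W \<in> carrier_mat n n" by (simp add: W_def)
  have "W\<^sup>T = W" by (rule eq_matI) (auto simp: W_def)
  moreover have "W * W = 1\<^sub>m n"
  proof (rule eq_matI)
    fix i j assume "i < dim_row (1\<^sub>m n :: real mat)" "j < dim_col (1\<^sub>m n :: real mat)"
    hence ij: "i < n" "j < n" by auto
    have ww: "(\<Sum>k<n. w $ k * w $ k) = s" using w by (simp add: s_def scalar_prod_def lessThan_atLeast0)
    have "(W * W) $$ (i,j) = (\<Sum>k<n. ((if i = k then 1 else 0) - c * w $ i * w $ k) * ((if k = j then 1 else 0) - c * w $ k * w $ j))"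
      using ij W by (auto simp: scalar_prod_def W_def lessThan_atLeast0 intro!: sum.cong)
    also have "\<dots> = (\<Sum>k<n. (if i = k then (if k = j then 1 else 0) else 0) - (if i = k then c * w $ k * w $ j else 0)
        - (if k = j then c * w $ i * w $ k else 0) + c * c * w $ i * w $ j * (w $ k * w $ k))"
      by (intro sum.cong refl) (auto simp: algebra_simps)
    also have "\<dots> = (if i = j then 1 else 0) - c * w $ i * w $ j - c * w $ i * w $ j + c * c * w $ i * w $ j * s"
      using ij by (simp add: sum.distrib sum_subtractf sum.delta' sum.delta ww sum_distrib_left[symmetric])
    also have "\<dots> = (if i = j then 1 else 0)" using s0 by (simp add: c_def)
    finally show "(W * W) $$ (i,j) = 1\<^sub>m n $$ (i,j)" using ij by simp
  qed (auto simp: W_def)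
  moreover have "W *\<^sub>v unit_vec n 0 = v"
  proof (rule eq_vecI)
    fix i assume "i < dim_vec v"
    hence i: "i < n" using v by simp
    \<comment> \<open>With s = 2 (1 - v_0) the factor c (v_0 - 1) is -1, so column 0 of the
      reflection is e_0 + w = v.\<close>
    have cw: "c * (v $ 0 - 1) = - 1" using s s0 by (simp add: c_def field_simps)
    have "(W *\<^sub>v unit_vec n 0) $ i = W $$ (i, 0)"
      using i n W by simp
    also have "\<dots> = (if i = 0 then 1 else 0) - (c * (v $ 0 - 1)) * w $ i"
      using i n v by (auto simp: W_def w_def)
    also have "\<dots> = v $ i" using i n v by (auto simp: cw w_def)
    finally show "(W *\<^sub>v unit_vec n 0) $ i = v $ i" .
  qed (use v W in auto)
  ultimately show ?thesis using W by blast
qed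

text \<open>Deflation: conjugating by a reflection that sends e_0 to a unit eigenvector clears the
  first column, and by symmetry the first row, off the diagonal; induction handles the remaining
  block. The list \<open>es\<close> is an input so that the diagonal appears in a prescribed
  order.\<close>

lemma spectral_theorem:
  fixes A :: "real mat"
  assumes "A \<in> carrier_mat n n" and "A\<^sup>T = A" and "char_poly A = (\<Prod>e\<leftarrow>es. [:-e, 1:])"
  shows "\<exists>U\<in>carrier_mat n n. U\<^sup>T * U = 1\<^sub>m n \<and> U\<^sup>T * A * U = mat_diag n (\<lambda>i. es ! i)"
  using assms
proof (induction es arbitrary: n A)
  case Nil
  with degree_monic_char_poly[of A n] have "n = 0" by auto
  thus ?case using Nil by (intro bexI[of _ "1\<^sub>m 0"]) (auto intro!: eq_matI simp: mat_diag_def)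
next
  case (Cons e es)
  note A = Cons.prems(1) and sym = Cons.prems(2) and cp = Cons.prems(3)
  have deg: "degree (\<Prod>e\<leftarrow>es. [:-e, 1:]) = length es" for es :: "real list"
  proof (induction es)
    case (Cons a es)
    have "(\<Prod>e\<leftarrow>es. [:-e, 1:]) \<noteq> 0" by (auto simp: prod_list_zero_iff)
    thus ?case using Cons by (simp add: degree_mult_eq del: mult_pCons_left)
  qed simp
  have n: "n = Suc (length es)"
    using degree_monic_char_poly[OF A] deg[of "e # es"] cp by simp
  define m where "m = length es"
  have nm: "n = Suc m" using n by (simp add: m_def)
  have "poly (char_poly A) e = 0" by (simp add: cp)
  hence "eigenvalue A e" using eigenvalue_root_char_poly[OF A] by simp
  then obtain u where u: "u \<in> carrier_vec n" "u \<noteq> 0\<^sub>v n" "A *\<^sub>v u = e \<cdot>\<^sub>v u"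
    using A unfolding eigenvalue_def eigenvector_def by auto
  have uu: "u \<bullet> u > 0" by (rule scalar_prod_self_pos[OF u(1,2)])
  define v where "v = (1 / sqrt (u \<bullet> u)) \<cdot>\<^sub>v u"
  have v: "v \<in> carrier_vec n" using u by (simp add: v_def)
  have vv: "v \<bullet> v = 1" using u uu by (simp add: v_def real_sqrt_mult_self field_simps)
  have Av: "A *\<^sub>v v = e \<cdot>\<^sub>v v"
    using u A by (simp add: v_def mult_mat_vec[of _ n n] smult_smult_assoc mult.commute)
  obtain W where W: "W \<in> carrier_mat n n" "W\<^sup>T = W" "W * W = 1\<^sub>m n" "W *\<^sub>v unit_vec n 0 = v"
    using householder[OF v _ vv] nm by auto
  define A' where "A' = W * A * W"
  have A': "A' \<in> carrier_mat n n" using W A by (simp add: A'_def)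
  have d[simp]: "dim_row A = n" "dim_col A = n" "dim_row W = n" "dim_col W = n" using A W by auto
  have symA': "A'\<^sup>T = A'" using sym W by (simp add: A'_def mat_transpose_mult mat_mult_assoc)
  have col0: "A' *\<^sub>v unit_vec n 0 = e \<cdot>\<^sub>v unit_vec n 0"
  proof -
    have "A' *\<^sub>v unit_vec n 0 = W *\<^sub>v (A *\<^sub>v v)"
      using W v by (simp add: A'_def mat_vec_assoc)
    also have "\<dots> = e \<cdot>\<^sub>v (W *\<^sub>v v)" using v Av W by (simp add: mult_mat_vec[of _ n n])
    also have "W *\<^sub>v v = unit_vec n 0"
    proof -
      have "W *\<^sub>v (W *\<^sub>v unit_vec n 0) = W * W *\<^sub>v unit_vec n 0" by (simp add: mat_vec_assoc)
      thus ?thesis by (simp add: W(3) W(4)[symmetric])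
    qed
    finally show ?thesis .
  qed
  have c0: "A' $$ (i, 0) = (if i = 0 then e else 0)" if "i < n" for i
  proof -
    have "A' $$ (i, 0) = (A' *\<^sub>v unit_vec n 0) $ i" using A' that nm by simp
    also have "\<dots> = (if i = 0 then e else 0)" unfolding col0 using that by (auto simp: unit_vec_def)
    finally show ?thesis .
  qed
  have r0: "A' $$ (0, i) = (if i = 0 then e else 0)" if "i < n" for i
    using c0[OF that] symA' A' that nm by (metis carrier_matD index_transpose_mat(1) zero_less_Suc)
  define A3 where "A3 = mat m m (\<lambda>(i,j). A' $$ (Suc i, Suc j))"
  define E where "E = mat 1 1 (\<lambda>_. e)"
  have A3: "A3 \<in> carrier_mat m m" and E: "E \<in> carrier_mat 1 1" by (auto simp: A3_def E_def)
  have blk: "A' = four_block_mat E (0\<^sub>m 1 m) (0\<^sub>m m 1) A3"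
    by (rule eq_matI) (use A' nm in \<open>auto simp: E_def A3_def c0 r0\<close>)
  have sym3: "A3\<^sup>T = A3"
  proof (rule eq_matI)
    fix i j assume "i < dim_row A3" "j < dim_col A3"
    hence "i < m" "j < m" using A3 by auto
    moreover from this have "A' $$ (Suc j, Suc i) = A' $$ (Suc i, Suc j)"
      using symA' A' nm by (metis Suc_less_eq carrier_matD index_transpose_mat(1))
    ultimately show "A3\<^sup>T $$ (i,j) = A3 $$ (i,j)" by (simp add: A3_def)
  qed (use A3 in auto)
  have "similar_mat A' A"
    by (rule similar_matI[of A' A W W n]) (use W A A' in \<open>auto simp: A'_def\<close>)
  hence "char_poly A' = char_poly A" by (rule char_poly_similar)
  moreover have "char_poly A' = char_poly E * char_poly A3"
    unfolding blk by (rule char_poly_four_block_zeros_col[OF E _ A3]) simp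
  moreover have "char_poly E = [:-e, 1:]"
    by (simp add: char_poly_defs E_def det_single)
  ultimately have "[:-e, 1:] * char_poly A3 = [:-e, 1:] * (\<Prod>e\<leftarrow>es. [:-e, 1:])" by (simp add: cp)
  hence "char_poly A3 = (\<Prod>e\<leftarrow>es. [:-e, 1:])" by (metis mult_cancel_left one_neq_zero pCons_eq_0_iff)
  from Cons.IH[OF A3 sym3 this] obtain U3 where U3: "U3 \<in> carrier_mat m m" "U3\<^sup>T * U3 = 1\<^sub>m m"
      "U3\<^sup>T * A3 * U3 = mat_diag m (\<lambda>i. es ! i)" by blast
  define P where "P = four_block_mat (1\<^sub>m 1) (0\<^sub>m 1 m) (0\<^sub>m m 1) U3"
  have P: "P \<in> carrier_mat n n" using U3 nm by (intro carrier_matI) (auto simp: P_def)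
  have PT: "P\<^sup>T = four_block_mat (1\<^sub>m 1) (0\<^sub>m 1 m) (0\<^sub>m m 1) (U3\<^sup>T)"
    unfolding P_def using U3 by (subst transpose_four_block_mat[of _ 1 1 _ m _ m]) auto
  have PTP: "P\<^sup>T * P = 1\<^sub>m n"
    unfolding PT unfolding P_def
    using U3 nm by (subst mult_four_block_mat[of _ 1 1 _ m _ m _ _ 1 _ m]) auto
  have d2[simp]: "dim_row P = n" "dim_col P = n" using P by auto
  have "P\<^sup>T * A' * P = four_block_mat E (0\<^sub>m 1 m) (0\<^sub>m m 1) (U3\<^sup>T * A3 * U3)"
    unfolding PT blk unfolding P_def using U3 A3 E
    by (simp add: mult_four_block_mat[of _ 1 1 _ m _ m _ _ 1 _ m])
  also have "\<dots> = mat_diag n (\<lambda>i. (e # es) ! i)"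
    unfolding U3(3) by (rule eq_matI) (use nm in \<open>auto simp: E_def mat_diag_def less_Suc_eq_0_disj split: if_splits\<close>)
  finally have PAP: "P\<^sup>T * A' * P = mat_diag n (\<lambda>i. (e # es) ! i)" .
  show ?case
  proof (intro bexI[of _ "W * P"] conjI)
    show "W * P \<in> carrier_mat n n" using W P by simp
    show "(W * P)\<^sup>T * (W * P) = 1\<^sub>m n"
      using PTP by (simp add: mat_transpose_mult mat_mult_assoc W(2) mat_mult_cancel_left[OF W(3)])
    show "(W * P)\<^sup>T * A * (W * P) = mat_diag n (\<lambda>i. (e # es) ! i)"
      unfolding PAP[symmetric] A'_def by (simp add: mat_transpose_mult mat_mult_assoc W(2))
  qed
qed

section \<open>Symmetric positive definite pencils\<close>

lemma spdD:
  assumes "sym_pos_def_mat n A"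
  shows "A \<in> carrier_mat n n" "A\<^sup>T = A" "dim_row A = n" "dim_col A = n"
    "\<And>v. v \<in> carrier_vec n \<Longrightarrow> v \<noteq> 0\<^sub>v n \<Longrightarrow> v \<bullet> (A *\<^sub>v v) > 0"
    "\<And>v. v \<in> carrier_vec n \<Longrightarrow> v \<bullet> (A *\<^sub>v v) \<ge> 0"
proof -
  show 1: "A \<in> carrier_mat n n" "A\<^sup>T = A" 
    and 2: "\<And>v. v \<in> carrier_vec n \<Longrightarrow> v \<noteq> 0\<^sub>v n \<Longrightarrow> v \<bullet> (A *\<^sub>v v) > 0"
    using assms by (auto simp: sym_pos_def_mat_def)
  thus "dim_row A = n" "dim_col A = n" by auto
  show "v \<bullet> (A *\<^sub>v v) \<ge> 0" if v: "v \<in> carrier_vec n" for v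
    using 1 2[OF v] v by (cases "v = 0\<^sub>v n") (auto simp: less_imp_le)
qed

lemma mult_mat_zero_vec:
  fixes A :: "real mat"
  shows "dim_col A = n \<Longrightarrow> A *\<^sub>v 0\<^sub>v n = 0\<^sub>v (dim_row A)"
  by (intro eq_vecI) (auto simp: scalar_prod_def)

lemma quad_congruence:
  fixes A :: "real mat"
  assumes "A \<in> carrier_mat n n" "P \<in> carrier_mat n m" "x \<in> carrier_vec m" "y \<in> carrier_vec m"
  shows "x \<bullet> ((P\<^sup>T * A * P) *\<^sub>v y) = (P *\<^sub>v x) \<bullet> (A *\<^sub>v (P *\<^sub>v y))"
proof -
  have eq: "(P\<^sup>T * A * P) *\<^sub>v y = P\<^sup>T *\<^sub>v (A *\<^sub>v (P *\<^sub>v y))"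
    using assms by (simp add: mat_mult_assoc mat_vec_assoc)
  have "x \<bullet> ((P\<^sup>T * A * P) *\<^sub>v y) = (P\<^sup>T *\<^sub>v (A *\<^sub>v (P *\<^sub>v y))) \<bullet> x"
    unfolding eq using assms by (intro comm_scalar_prod[of _ m]) auto
  also have "\<dots> = (A *\<^sub>v (P *\<^sub>v y)) \<bullet> (P *\<^sub>v x)"
    using assms by (intro transpose_vec_mult_scalar[of _ n m]) auto
  also have "\<dots> = (P *\<^sub>v x) \<bullet> (A *\<^sub>v (P *\<^sub>v y))"
    using assms by (intro comm_scalar_prod[of _ n]) auto
  finally show ?thesis .
qed

lemma mat_diag_mult_vec:
  fixes e :: "nat \<Rightarrow> real"
  assumes "v \<in> carrier_vec n"
  shows "mat_diag n e *\<^sub>v v = vec n (\<lambda>i. e i * v $ i)"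
proof (rule eq_vecI)
  fix i assume "i < dim_vec (vec n (\<lambda>i. e i * v $ i))"
  hence i: "i < n" by simp
  have "(mat_diag n e *\<^sub>v v) $ i = (\<Sum>j<n. (if i = j then e j else 0) * v $ j)"
    using i assms by (auto simp: mat_diag_def scalar_prod_def lessThan_atLeast0 intro!: sum.cong)
  also have "\<dots> = (\<Sum>j<n. if i = j then e j * v $ j else 0)" by (intro sum.cong) auto
  also have "\<dots> = e i * v $ i" using i by simp
  finally show "(mat_diag n e *\<^sub>v v) $ i = vec n (\<lambda>i. e i * v $ i) $ i" using i by simp
qed (simp add: mat_diag_def)

lemma quad_mat_diag:
  fixes e :: "nat \<Rightarrow> real"
  assumes "v \<in> carrier_vec n"
  shows "v \<bullet> (mat_diag n e *\<^sub>v v) = (\<Sum>i<n. e i * (v $ i)\<^sup>2)"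
  using assms by (auto simp: mat_diag_mult_vec scalar_prod_def lessThan_atLeast0 power2_eq_square mult_ac intro!: sum.cong)

lemma spd_mat_diag:
  assumes "\<And>i. i < n \<Longrightarrow> e i > 0"
  shows "sym_pos_def_mat n (mat_diag n e)"
  unfolding sym_pos_def_mat_def
proof (intro conjI ballI impI)
  show "(mat_diag n e)\<^sup>T = mat_diag n e" by (rule eq_matI) (auto simp: mat_diag_def)
  fix v :: "real vec" assume v: "v \<in> carrier_vec n" "v \<noteq> 0\<^sub>v n"
  then obtain i where "i < n" "v $ i \<noteq> 0" by (metis carrier_vecD eq_vecI index_zero_vec)
  hence "0 < (\<Sum>i<n. e i * (v $ i)\<^sup>2)"
    using assms by (intro sum_pos2[of _ i]) (auto simp: less_imp_le)
  thus "v \<bullet> (mat_diag n e *\<^sub>v v) > 0" using v by (simp add: quad_mat_diag)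
qed auto

lemma spd_mat_diag_pos:
  assumes "sym_pos_def_mat n (mat_diag n e)" and i: "i < n"
  shows "0 < e i"
proof -
  have "0 < (\<Sum>k<n. e k * (unit_vec n i $ k)\<^sup>2)"
    using spdD(5)[OF assms(1), of "unit_vec n i"] i by (simp add: quad_mat_diag)
  also have "\<dots> = (\<Sum>k<n. if k = i then e k else 0)" by (intro sum.cong) (auto simp: unit_vec_def)
  finally show ?thesis using i by simp
qed

lemma spd_congruence:
  assumes A: "sym_pos_def_mat n A" and P: "P \<in> carrier_mat n m"
    and inj: "\<And>v :: real vec. v \<in> carrier_vec m \<Longrightarrow> P *\<^sub>v v = 0\<^sub>v n \<Longrightarrow> v = 0\<^sub>v m"
  shows "sym_pos_def_mat m (P\<^sup>T * A * P)"
  unfolding sym_pos_def_mat_def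
proof (intro conjI ballI impI)
  note a = spdD[OF A]
  show "P\<^sup>T * A * P \<in> carrier_mat m m" using a P by auto
  show "(P\<^sup>T * A * P)\<^sup>T = P\<^sup>T * A * P" using a P by (simp add: mat_transpose_mult mat_mult_assoc)
  fix v :: "real vec" assume v: "v \<in> carrier_vec m" "v \<noteq> 0\<^sub>v m"
  hence "P *\<^sub>v v \<noteq> 0\<^sub>v n" using inj by blast
  thus "v \<bullet> (P\<^sup>T * A * P *\<^sub>v v) > 0"
    using a(5)[of "P *\<^sub>v v"] P v by (simp add: quad_congruence[OF a(1) P v(1) v(1)])
qed

lemma left_inverse_inj:
  fixes P :: "real mat"
  assumes "Q * P = 1\<^sub>m m" "P \<in> carrier_mat n m" "Q \<in> carrier_mat m n" "v \<in> carrier_vec m" "P *\<^sub>v v = 0\<^sub>v n"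
  shows "v = 0\<^sub>v m"
proof -
  have "v = Q * P *\<^sub>v v" using assms by simp
  also have "\<dots> = Q *\<^sub>v (P *\<^sub>v v)" using assms by (intro assoc_mult_mat_vec) auto
  also have "\<dots> = 0\<^sub>v m" unfolding assms(5) using assms(3) by (intro eq_vecI) auto
  finally show ?thesis .
qed

lemma spd_diagonalize:
  assumes G: "sym_pos_def_mat n G"
  shows "\<exists>U\<in>carrier_mat n n. \<exists>e. U\<^sup>T * U = 1\<^sub>m n \<and> U * U\<^sup>T = 1\<^sub>m n \<and> U\<^sup>T * G * U = mat_diag n e \<and> (\<forall>i<n. e i > 0)"
proof -
  note g = spdD[OF G]
  obtain es where "char_poly G = (\<Prod>e\<leftarrow>es. [:-e, 1:])" using sym_char_poly_splits[OF g(1,2)] by blast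
  from spectral_theorem[OF g(1,2) this] obtain U where
    U: "U \<in> carrier_mat n n" "U\<^sup>T * U = 1\<^sub>m n" "U\<^sup>T * G * U = mat_diag n (\<lambda>i. es ! i)" by blast
  have "U * U\<^sup>T = 1\<^sub>m n" using mat_mult_left_right_inverse[OF _ U(1) U(2)] U(1) by simp
  moreover have "es ! i > 0" if i: "i < n" for i
  proof -
    have "sym_pos_def_mat n (mat_diag n (\<lambda>i. es ! i))"
      unfolding U(3)[symmetric]
      by (rule spd_congruence[OF G U(1)], rule left_inverse_inj[OF U(2) U(1)]) (use U in auto)
    thus ?thesis using i by (rule spd_mat_diag_pos)
  qed
  ultimately show ?thesis using U by blast
qed

lemma spd_whiten:
  assumes G: "sym_pos_def_mat n G"
  shows "\<exists>P\<in>carrier_mat n n. P\<^sup>T * G * P = 1\<^sub>m n"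
proof -
  note g = spdD[OF G]
  obtain U e where U: "U \<in> carrier_mat n n" "U\<^sup>T * G * U = mat_diag n e" "\<forall>i<n. e i > 0"
    using spd_diagonalize[OF G] by blast
  define D where "D = mat_diag n (\<lambda>i. 1 / sqrt (e i))"
  have D: "D \<in> carrier_mat n n" "D\<^sup>T = D" by (auto simp: D_def mat_diag_def intro!: eq_matI)
  have "(U * D)\<^sup>T * G * (U * D) = D * (U\<^sup>T * G * U) * D"
    using U(1) D g by (simp add: mat_transpose_mult mat_mult_assoc)
  also have "\<dots> = mat_diag n (\<lambda>i. 1 / sqrt (e i) * e i * (1 / sqrt (e i)))" by (simp add: U D_def)
  also have "\<dots> = 1\<^sub>m n" using U(3) by (intro eq_matI) (auto simp: mat_diag_def real_sqrt_mult_self)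
  finally show ?thesis using U D by (intro bexI[of _ "U * D"]) auto
qed

lemma pencil_diagonalize_whitened:
  assumes G: "sym_pos_def_mat n G" and H: "H \<in> carrier_mat n n" "H\<^sup>T = H"
    and P: "P \<in> carrier_mat n n" "P\<^sup>T * G * P = 1\<^sub>m n"
    and cp: "char_poly (P\<^sup>T * H * P) = (\<Prod>e\<leftarrow>es. [:-e, 1:])"
  shows "\<exists>P'\<in>carrier_mat n n. P'\<^sup>T * G * P' = 1\<^sub>m n \<and> P'\<^sup>T * H * P' = mat_diag n (\<lambda>i. es ! i)"
proof -
  note g = spdD[OF G]
  define A where "A = P\<^sup>T * H * P"
  have A: "A \<in> carrier_mat n n" "A\<^sup>T = A" using P H by (auto simp: A_def mat_transpose_mult mat_mult_assoc)
  from spectral_theorem[OF A cp[folded A_def]] obtain U where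
    U: "U \<in> carrier_mat n n" "U\<^sup>T * U = 1\<^sub>m n" "U\<^sup>T * A * U = mat_diag n (\<lambda>i. es ! i)" by blast
  have "(P * U)\<^sup>T * G * (P * U) = U\<^sup>T * (P\<^sup>T * G * P) * U"
    using U(1) P(1) g by (simp add: mat_transpose_mult mat_mult_assoc)
  also have "\<dots> = 1\<^sub>m n" using U by (simp add: P)
  finally have 1: "(P * U)\<^sup>T * G * (P * U) = 1\<^sub>m n" .
  have "(P * U)\<^sup>T * H * (P * U) = mat_diag n (\<lambda>i. es ! i)"
    unfolding U(3)[symmetric] using U(1) P(1) H by (simp add: A_def mat_transpose_mult mat_mult_assoc)
  with 1 U P show ?thesis by (intro bexI[of _ "P * U"]) auto
qed

text \<open>Congruence by a whitening matrix P turns t G - H into t I - P^T H P, and (det P)^2 det G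
  = 1, so the determinant hypothesis amounts to a factorization of the characteristic polynomial of
  P^T H P. In this way prescribed generalized eigenvalues, with multiplicity and order, become the
  diagonal in the frame.\<close>

lemma pencil_diagonalize:
  assumes G: "sym_pos_def_mat n G" and H: "H \<in> carrier_mat n n" "H\<^sup>T = H"
    and det: "\<And>t::real. det (t \<cdot>\<^sub>m G - H) = det G * (\<Prod>k<n. (t - r k))"
  shows "\<exists>P\<in>carrier_mat n n. P\<^sup>T * G * P = 1\<^sub>m n \<and> P\<^sup>T * H * P = mat_diag n r"
proof -
  note g = spdD[OF G]
  obtain P where P: "P \<in> carrier_mat n n" "P\<^sup>T * G * P = 1\<^sub>m n" using spd_whiten[OF G] by blast
  define A where "A = P\<^sup>T * H * P"
  have A: "A \<in> carrier_mat n n" "A\<^sup>T = A" using P H by (auto simp: A_def mat_transpose_mult mat_mult_assoc)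
  have detP: "det P * det G * det P = 1"
  proof -
    have "det (P\<^sup>T * G * P) = det P * det G * det P"
      using P(1) g by (simp add: det_mult[of _ n] det_transpose[of _ n])
    thus ?thesis unfolding P(2) by simp
  qed
  have "poly (char_poly A) t = poly (\<Prod>e\<leftarrow>map r [0..<n]. [:-e, 1:]) t" for t
  proof -
    have "P\<^sup>T * (t \<cdot>\<^sub>m G - H) * P = t \<cdot>\<^sub>m (P\<^sup>T * G * P) - A"
      using P H g unfolding A_def
      by (simp add: mult_minus_distrib_mat[of _ n n _ n] minus_mult_distrib_mat[of _ n n _ _ n]
          mult_smult_distrib[of _ n n _ n] mult_smult_assoc_mat[of _ n n _ n])
    hence eq: "P\<^sup>T * (t \<cdot>\<^sub>m G - H) * P = t \<cdot>\<^sub>m 1\<^sub>m n - A" by (simp add: P)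
    have "poly (char_poly A) t = det (- char_matrix A t)" by (rule char_poly_matrix[OF A(1)])
    also have "- char_matrix A t = t \<cdot>\<^sub>m 1\<^sub>m n - A"
      using A(1) by (intro eq_matI) (auto simp: char_matrix_def)
    also have "det \<dots> = det P * det (t \<cdot>\<^sub>m G - H) * det P"
    proof -
      have "t \<cdot>\<^sub>m G - H \<in> carrier_mat n n" using H by (simp add: minus_carrier_mat)
      thus ?thesis unfolding eq[symmetric] using P(1) by (simp add: det_mult[of _ n] det_transpose[of _ n])
    qed
    also have "\<dots> = (det P * det G * det P) * (\<Prod>k<n. (t - r k))" by (simp add: det)
    also have "\<dots> = poly (\<Prod>e\<leftarrow>map r [0..<n]. [:-e, 1:]) t"
      by (simp add: detP poly_prod_list poly_prod o_def prod.distinct_set_conv_list[symmetric] lessThan_atLeast0)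
    finally show ?thesis .
  qed
  hence "char_poly A = (\<Prod>e\<leftarrow>map r [0..<n]. [:-e, 1:])" by (simp add: poly_eq_poly_eq_iff[symmetric] fun_eq_iff)
  from pencil_diagonalize_whitened[OF G H P this[unfolded A_def]]
  have "\<exists>P'\<in>carrier_mat n n. P'\<^sup>T * G * P' = 1\<^sub>m n \<and> P'\<^sup>T * H * P' = mat_diag n (\<lambda>i. map r [0..<n] ! i)" .
  moreover have "mat_diag n (\<lambda>i. map r [0..<n] ! i) = mat_diag n r" by (intro eq_matI) (auto simp: mat_diag_def)
  ultimately show ?thesis by simp
qed

lemma pencil_diagonalize_ex:
  assumes G: "sym_pos_def_mat n G" and H: "H \<in> carrier_mat n n" "H\<^sup>T = H"
  shows "\<exists>P\<in>carrier_mat n n. \<exists>r. P\<^sup>T * G * P = 1\<^sub>m n \<and> P\<^sup>T * H * P = mat_diag n r"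
proof -
  obtain P where P: "P \<in> carrier_mat n n" "P\<^sup>T * G * P = 1\<^sub>m n" using spd_whiten[OF G] by blast
  have "P\<^sup>T * H * P \<in> carrier_mat n n" "(P\<^sup>T * H * P)\<^sup>T = P\<^sup>T * H * P"
    using P(1) H by (auto simp: mat_transpose_mult mat_mult_assoc)
  from sym_char_poly_splits[OF this] pencil_diagonalize_whitened[OF G H P] show ?thesis by blast
qed

lemma pencil_diagonalize_spd:
  assumes G: "sym_pos_def_mat n G" and H: "sym_pos_def_mat n H"
  obtains P e where "P \<in> carrier_mat n n" "P\<^sup>T * G * P = 1\<^sub>m n" "P\<^sup>T * H * P = mat_diag n e"
    "P * (P\<^sup>T * G) = 1\<^sub>m n" "\<And>i. i < n \<Longrightarrow> 0 < e i"
proof -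
  note g = spdD[OF G]
  obtain P e where P: "P \<in> carrier_mat n n" "P\<^sup>T * G * P = 1\<^sub>m n" "P\<^sup>T * H * P = mat_diag n e"
    using pencil_diagonalize_ex[OF G spdD(1,2)[OF H]] by blast
  have inv: "P * (P\<^sup>T * G) = 1\<^sub>m n"
    using mat_mult_left_right_inverse[of "P\<^sup>T * G" n P] P g by simp
  have "sym_pos_def_mat n (mat_diag n e)"
    unfolding P(3)[symmetric]
    by (rule spd_congruence[OF H P(1)], rule left_inverse_inj[OF P(2) P(1)]) (use P g in auto)
  with that[OF P inv] show thesis using spd_mat_diag_pos by blast
qed

text \<open>Since P has inverse P^T G, the substitution c = P w turns H c = r G c into e_i w_i = r
  w_i for all i, which has nonzero solutions exactly for r among the e_i.\<close>

lemma pencil_eigenvalues: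
  fixes G H :: "real mat"
  assumes G: "G \<in> carrier_mat n n" "G\<^sup>T = G" and H: "H \<in> carrier_mat n n" and P: "P \<in> carrier_mat n n"
    and PG: "P\<^sup>T * G * P = 1\<^sub>m n" and PH: "P\<^sup>T * H * P = mat_diag n e"
  shows "{r. \<exists>c\<in>carrier_vec n. c \<noteq> 0\<^sub>v n \<and> H *\<^sub>v c = r \<cdot>\<^sub>v (G *\<^sub>v c)} = e ` {..<n}"
proof -
  have [simp]: "dim_row P = n" "dim_col P = n" "dim_row G = n" "dim_col G = n" "dim_row H = n" "dim_col H = n"
    using P G H by auto
  have inv: "P * (P\<^sup>T * G) = 1\<^sub>m n"
    using mat_mult_left_right_inverse[of "P\<^sup>T * G" n P] PG P G by simp
  from arg_cong[OF this, of transpose_mat] have inv': "G * (P * P\<^sup>T) = 1\<^sub>m n"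
    using G by (simp add: mat_transpose_mult mat_mult_assoc)
  hence GPPT: "G *\<^sub>v (P *\<^sub>v (P\<^sup>T *\<^sub>v v)) = v" if "v \<in> carrier_vec n" for v
  proof -
    have "G *\<^sub>v (P *\<^sub>v (P\<^sup>T *\<^sub>v v)) = G * (P * P\<^sup>T) *\<^sub>v v" using that by (simp add: mat_vec_assoc)
    thus ?thesis using that by (simp add: inv')
  qed
  show ?thesis
  proof (intro equalityI subsetI)
    fix r assume "r \<in> {r. \<exists>c\<in>carrier_vec n. c \<noteq> 0\<^sub>v n \<and> H *\<^sub>v c = r \<cdot>\<^sub>v (G *\<^sub>v c)}"
    then obtain c where c: "c \<in> carrier_vec n" "c \<noteq> 0\<^sub>v n" "H *\<^sub>v c = r \<cdot>\<^sub>v (G *\<^sub>v c)" by blast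
    define w where "w = (P\<^sup>T * G) *\<^sub>v c"
    have w: "w \<in> carrier_vec n" using P by (intro carrier_vecI) (simp add: w_def)
    have Pw: "P *\<^sub>v w = c"
    proof -
      have "P *\<^sub>v w = P * (P\<^sup>T * G) *\<^sub>v c" using c by (simp add: w_def mat_vec_assoc)
      thus ?thesis using c by (simp add: inv)
    qed
    have "mat_diag n e *\<^sub>v w = P\<^sup>T *\<^sub>v (H *\<^sub>v c)"
      unfolding PH[symmetric] using w by (simp add: mat_mult_assoc mat_vec_assoc Pw)
    also have "\<dots> = r \<cdot>\<^sub>v (P\<^sup>T *\<^sub>v (G *\<^sub>v c))"
      unfolding c(3) using G P by (intro mult_mat_vec[of _ n n]) (use c in auto)
    also have "\<dots> = r \<cdot>\<^sub>v w" using c by (simp add: w_def mat_vec_assoc)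
    finally have eq: "vec n (\<lambda>i. e i * w $ i) = r \<cdot>\<^sub>v w" using w by (simp add: mat_diag_mult_vec)
    have "w \<noteq> 0\<^sub>v n" using Pw c(2) by (auto simp: mult_mat_zero_vec)
    then obtain i where i: "i < n" "w $ i \<noteq> 0" using w by (metis carrier_vecD eq_vecI index_zero_vec)
    have "e i * w $ i = r * w $ i" using arg_cong[OF eq, of "\<lambda>v. v $ i"] i w by simp
    thus "r \<in> e ` {..<n}" using i by auto
  next
    fix r assume "r \<in> e ` {..<n}"
    then obtain i where i: "i < n" "r = e i" by auto
    define c where "c = P *\<^sub>v unit_vec n i"
    have c: "c \<in> carrier_vec n" by (intro carrier_vecI) (simp add: c_def)
    have gc: "P\<^sup>T *\<^sub>v (G *\<^sub>v c) = unit_vec n i"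
    proof -
      have "P\<^sup>T *\<^sub>v (G *\<^sub>v c) = P\<^sup>T * G * P *\<^sub>v unit_vec n i" by (simp add: c_def mat_mult_assoc mat_vec_assoc)
      thus ?thesis by (simp add: PG)
    qed
    have "P\<^sup>T *\<^sub>v (H *\<^sub>v c) = P\<^sup>T * H * P *\<^sub>v unit_vec n i" by (simp add: c_def mat_mult_assoc mat_vec_assoc)
    also have "\<dots> = e i \<cdot>\<^sub>v unit_vec n i" unfolding PH
      by (rule eq_vecI) (auto simp: mat_diag_mult_vec unit_vec_def)
    finally have hc: "P\<^sup>T *\<^sub>v (H *\<^sub>v c) = e i \<cdot>\<^sub>v unit_vec n i" .
    have "H *\<^sub>v c = G *\<^sub>v (P *\<^sub>v (P\<^sup>T *\<^sub>v (H *\<^sub>v c)))" using GPPT[of "H *\<^sub>v c"] H c by simp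
    also have "\<dots> = e i \<cdot>\<^sub>v (G *\<^sub>v c)"
      unfolding hc using P G by (simp add: mult_mat_vec[of _ n n] c_def)
    finally have "H *\<^sub>v c = r \<cdot>\<^sub>v (G *\<^sub>v c)" using i by simp
    moreover have "c \<noteq> 0\<^sub>v n"
    proof
      assume "c = 0\<^sub>v n"
      hence "unit_vec n i = (0\<^sub>v n :: real vec)" using gc by (simp add: mult_mat_zero_vec)
      thus False using unit_vec_nonzero i by blast
    qed
    ultimately show "r \<in> {r. \<exists>c\<in>carrier_vec n. c \<noteq> 0\<^sub>v n \<and> H *\<^sub>v c = r \<cdot>\<^sub>v (G *\<^sub>v c)}" using c by blast
  qed
qed

section \<open>Traces, the trace metric and the inverse square root\<close>

lemma mat_trace_mult:
  "dim_row A = dim_col B \<Longrightarrow> dim_col A = dim_row B \<Longrightarrow>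
    mat_trace (A * B) = (\<Sum>i<dim_row A. \<Sum>k<dim_row B. A $$ (i,k) * B $$ (k,i))"
  by (auto simp: mat_trace_def scalar_prod_def lessThan_atLeast0 intro!: sum.cong)

lemma mat_trace_comm:
  "dim_col A = dim_row B \<Longrightarrow> dim_row A = dim_col B \<Longrightarrow> mat_trace (A * B) = mat_trace (B * A)"
  using sum.swap[of "\<lambda>i k. A $$ (i,k) * B $$ (k,i)" "{..<dim_row B}" "{..<dim_row A}"]
  by (simp add: mat_trace_mult mult.commute)

lemma mat_trace_add:
  "dim_row A = dim_row B \<Longrightarrow> dim_col B = dim_row B \<Longrightarrow> mat_trace (A + B) = mat_trace A + mat_trace B"
  by (auto simp: mat_trace_def sum.distrib[symmetric] intro!: sum.cong)

lemma mat_trace_transpose: "dim_row A = dim_col A \<Longrightarrow> mat_trace (A\<^sup>T) = mat_trace A"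
  by (auto simp: mat_trace_def intro!: sum.cong)

lemma metric_g_cols:
  assumes "M \<in> carrier_mat d d" "X \<in> carrier_mat d p" "Y \<in> carrier_mat d p"
  shows "metric_g M X Y = (\<Sum>j<p. col X j \<bullet> (M *\<^sub>v col Y j))"
proof -
  have "(X\<^sup>T * M * Y) $$ (j,j) = col X j \<bullet> (M *\<^sub>v col Y j)" if j: "j < p" for j
  proof -
    have "X\<^sup>T * M * Y = X\<^sup>T * (M * Y)" using assms by (simp add: mat_mult_assoc)
    hence "(X\<^sup>T * M * Y) $$ (j,j) = row (X\<^sup>T) j \<bullet> col (M * Y) j" using assms j by simp
    also have "col (M * Y) j = M *\<^sub>v col Y j" by (rule col_mult2[OF assms(1,3) j])
    finally show ?thesis using assms j by simp
  qed
  thus ?thesis using assms by (simp add: metric_g_def mat_trace_def)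
qed

lemma metric_g_pos:
  assumes M: "sym_pos_def_mat d M" and X: "X \<in> carrier_mat d p"
  shows "metric_g M X X \<ge> 0" "X \<noteq> 0\<^sub>m d p \<Longrightarrow> metric_g M X X > 0"
proof -
  note m = spdD[OF M]
  have nn: "col X j \<bullet> (M *\<^sub>v col X j) \<ge> 0" if "j < p" for j using m(6) X that by auto
  thus "metric_g M X X \<ge> 0" by (auto simp: metric_g_cols[OF m(1) X X] intro!: sum_nonneg)
  assume "X \<noteq> 0\<^sub>m d p"
  then obtain i j where ij: "i < d" "j < p" "X $$ (i,j) \<noteq> 0" using X by (auto simp: mat_eq_iff)
  hence "col X j $ i \<noteq> 0" using X by auto
  hence "col X j \<noteq> 0\<^sub>v d" using ij by auto
  hence "col X j \<bullet> (M *\<^sub>v col X j) > 0" using m(5) X ij by auto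
  thus "metric_g M X X > 0" unfolding metric_g_cols[OF m(1) X X]
    using nn ij by (intro sum_pos2[of _ j]) auto
qed

text \<open>This shows that the definite description in the definition denotes. Existence comes from
  an orthogonal diagonalization of \<open>M\<close>. For uniqueness, two candidates E and C have
  equal squares, so X = E - C satisfies X E + C X = 0; the trace of this against X is the sum of the
  squared E-norm and the squared C-norm of X, so X = 0.\<close>

lemma inv_sqrt_mat:
  assumes M: "sym_pos_def_mat d M"
  shows "sym_pos_def_mat d (inv_sqrt_mat d M) \<and> inv_sqrt_mat d M * inv_sqrt_mat d M * M = 1\<^sub>m d"
  unfolding inv_sqrt_mat_def
proof (rule theI')
  note m = spdD[OF M]
  obtain U e where U: "U \<in> carrier_mat d d" "U\<^sup>T * U = 1\<^sub>m d" "U * U\<^sup>T = 1\<^sub>m d"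
     "U\<^sup>T * M * U = mat_diag d e" "\<forall>i<d. e i > 0"
    using spd_diagonalize[OF M] by blast
  define D where "D = mat_diag d (\<lambda>i. 1 / sqrt (e i))"
  define C where "C = U\<^sup>T\<^sup>T * D * U\<^sup>T"
  have [simp]: "dim_row U = d" "dim_col U = d" "dim_row D = d" "dim_col D = d"  "dim_row M = d" "dim_col M = d"
    using U m by (auto simp: D_def mat_diag_def)
  have C: "sym_pos_def_mat d C" unfolding C_def
  proof (rule spd_congruence)
    show "sym_pos_def_mat d D" unfolding D_def using U by (intro spd_mat_diag) auto
    show "v = 0\<^sub>v d" if "v \<in> carrier_vec d" "U\<^sup>T *\<^sub>v v = 0\<^sub>v d" for v
      by (rule left_inverse_inj[OF U(3) _ U(1) that]) (use U in auto)
  qed (use U in auto)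
  have "C * C * M = U * (D * D) * (U\<^sup>T * M * (U * U\<^sup>T))"
    using U(2) by (simp add: C_def mat_mult_assoc mat_mult_cancel_left[OF U(2)] U(3))
  also have "\<dots> = U * ((D * D) * (U\<^sup>T * M * U)) * U\<^sup>T" by (simp add: mat_mult_assoc)
  also have "(D * D) * (U\<^sup>T * M * U) = mat_diag d (\<lambda>i. 1 / sqrt (e i) * (1 / sqrt (e i)) * e i)"
    by (simp add: U D_def)
  also have "\<dots> = 1\<^sub>m d" using U(5) by (intro eq_matI) (auto simp: mat_diag_def)
  finally have CC: "C * C * M = 1\<^sub>m d" using U by simp
  show "\<exists>!C. sym_pos_def_mat d C \<and> C * C * M = 1\<^sub>m d"
  proof (rule ex1I)
    show "sym_pos_def_mat d C \<and> C * C * M = 1\<^sub>m d" using C CC by simp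
    fix E assume E': "sym_pos_def_mat d E \<and> E * E * M = 1\<^sub>m d"
    note c = spdD[OF C] and e = spdD[OF conjunct1[OF E']]
    have "M * (C * C) = 1\<^sub>m d"
      using mat_mult_left_right_inverse[of "C * C" d M] CC c m by simp
    moreover have "E * E * (M * (C * C)) = E * E * M * (C * C)" using c e m by (simp add: mat_mult_assoc)
    ultimately have sq: "E * E = C * C" using E' c e by simp
    define X where "X = E - C"
    have X: "X \<in> carrier_mat d d" "X\<^sup>T = X" using c e by (auto simp: X_def transpose_minus minus_carrier_mat)
    have "X * E + C * X = E * E - C * E + (C * E - C * C)"
      unfolding X_def using c e
      by (simp add: minus_mult_distrib_mat[of _ d d _ _ d] mult_minus_distrib_mat[of _ d d _ d])
    also have "\<dots> = 0\<^sub>m d d" unfolding sq using c e by (intro eq_matI) auto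
    finally have z: "X * E + C * X = 0\<^sub>m d d" .
    have "metric_g E X X = mat_trace (X * (X * E))"
      unfolding metric_g_def X(2) using X(1) e by (intro mat_trace_comm) auto
    moreover have "metric_g C X X = mat_trace (X * (C * X))"
      unfolding metric_g_def X(2) using X(1) c by simp
    ultimately have "metric_g E X X + metric_g C X X = mat_trace (X * (X * E)) + mat_trace (X * (C * X))"
      by simp
    also have "\<dots> = mat_trace (X * (X * E + C * X))"
      using X c e by (simp add: mult_add_distrib_mat[of _ d d _ d] mat_trace_add)
    also have "\<dots> = 0" unfolding z using X by (simp add: mat_trace_def)
    finally have "metric_g E X X + metric_g C X X = 0" .
    hence "X = 0\<^sub>m d d" using metric_g_pos[OF C X(1)] metric_g_pos[of d E X d] E' X(1) by fastforce
    hence "(E - C) $$ (i,j) = 0" if "i < d" "j < d" for i j using that by (simp add: X_def)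
    thus "E = C" using c e by (intro eq_matI) auto
  qed
qed

text \<open>With C = M^{-1/2}, the substitution u = C v identifies the eigenvalues of C B C with
  those of the pencil (B, M), which are positive. Their extremes bound the quotient of the two
  quadratic forms on vectors, and summing over columns carries the bounds to d by p
  matrices.\<close>

lemma kappa_pencil_bounds:
  assumes B: "sym_pos_def_mat d B" and M: "sym_pos_def_mat d M" and d: "d > 0"
  obtains a b where "0 < a" "a \<le> b" "kappa_pencil d B M = b / a"
    "\<And>p X. X \<in> carrier_mat d p \<Longrightarrow> a * metric_g M X X \<le> metric_g B X X \<and> metric_g B X X \<le> b * metric_g M X X"
proof -
  note b = spdD[OF B] and m = spdD[OF M]
  define C where "C = inv_sqrt_mat d M"
  have C: "sym_pos_def_mat d C" "C * C * M = 1\<^sub>m d" using inv_sqrt_mat[OF M] by (auto simp: C_def)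
  note c = spdD[OF C(1)]
  note [simp] = b(3,4) m(3,4) c(3,4)
  have MCC: "M * (C * C) = 1\<^sub>m d" using mat_mult_left_right_inverse[of "C * C" d M] C c m by simp
  hence MCC': "M * C * C = 1\<^sub>m d" by (simp add: mat_mult_assoc)
  have CMC: "C * (M * C) = 1\<^sub>m d" using mat_mult_left_right_inverse[OF _ _ MCC'] c m by simp
  have CCM: "C * (C * M) = 1\<^sub>m d" using C(2) by (simp add: mat_mult_assoc)
  obtain P e where P: "P \<in> carrier_mat d d" "P\<^sup>T * M * P = 1\<^sub>m d" "P\<^sup>T * B * P = mat_diag d e"
    and PMP: "P * (P\<^sup>T * M) = 1\<^sub>m d" and epos: "\<And>i. i < d \<Longrightarrow> 0 < e i"
    using pencil_diagonalize_spd[OF M B] by blast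
  have ev: "{r. eigenvalue (C * B * C) r} = e ` {..<d}"
  proof -
    have "eigenvalue (C * B * C) r \<longleftrightarrow> (\<exists>u\<in>carrier_vec d. u \<noteq> 0\<^sub>v d \<and> B *\<^sub>v u = r \<cdot>\<^sub>v (M *\<^sub>v u))" for r
    proof
      assume "eigenvalue (C * B * C) r"
      then obtain v where v: "v \<in> carrier_vec d" "v \<noteq> 0\<^sub>v d" "C * B * C *\<^sub>v v = r \<cdot>\<^sub>v v"
        unfolding eigenvalue_def eigenvector_def index_mult_mat(2) c(3) by blast
      define u where "u = C *\<^sub>v v"
      have u: "u \<in> carrier_vec d" using v by (intro carrier_vecI) (simp add: u_def)
      have Mu: "C *\<^sub>v (M *\<^sub>v u) = v"
      proof -
        have "C *\<^sub>v (M *\<^sub>v u) = C * (M * C) *\<^sub>v v" using v by (simp add: u_def mat_vec_assoc)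
        thus ?thesis using v by (simp add: CMC)
      qed
      have "B *\<^sub>v u = M * (C * C) *\<^sub>v (B *\<^sub>v u)" unfolding MCC using u b by simp
      also have "\<dots> = M * C *\<^sub>v (C * B * C *\<^sub>v v)" using v by (simp add: u_def mat_mult_assoc mat_vec_assoc)
      also have "\<dots> = r \<cdot>\<^sub>v (M *\<^sub>v u)" unfolding v(3) using v m c
        by (simp add: mult_mat_vec[of _ d d] u_def mat_vec_assoc)
      finally have "B *\<^sub>v u = r \<cdot>\<^sub>v (M *\<^sub>v u)" .
      moreover have "u \<noteq> 0\<^sub>v d" using Mu v(2) by (auto simp: mult_mat_zero_vec)
      ultimately show "\<exists>u\<in>carrier_vec d. u \<noteq> 0\<^sub>v d \<and> B *\<^sub>v u = r \<cdot>\<^sub>v (M *\<^sub>v u)" using u by blast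
    next
      assume "\<exists>u\<in>carrier_vec d. u \<noteq> 0\<^sub>v d \<and> B *\<^sub>v u = r \<cdot>\<^sub>v (M *\<^sub>v u)"
      then obtain u where u: "u \<in> carrier_vec d" "u \<noteq> 0\<^sub>v d" "B *\<^sub>v u = r \<cdot>\<^sub>v (M *\<^sub>v u)" by blast
      define v where "v = C *\<^sub>v (M *\<^sub>v u)"
      have v: "v \<in> carrier_vec d" by (intro carrier_vecI) (simp add: v_def)
      have Cv: "C *\<^sub>v v = u" 
      proof -
        have "C *\<^sub>v v = C * (C * M) *\<^sub>v u" using u by (simp add: v_def mat_vec_assoc)
        thus ?thesis using u by (simp add: CCM)
      qed
      have "C * B * C *\<^sub>v v = C *\<^sub>v (B *\<^sub>v u)" using v by (simp add: mat_vec_assoc mat_mult_assoc Cv)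
      also have "\<dots> = r \<cdot>\<^sub>v v" unfolding u(3) using u m c by (simp add: mult_mat_vec[of _ d d] v_def)
      finally have "C * B * C *\<^sub>v v = r \<cdot>\<^sub>v v" .
      moreover have "v \<noteq> 0\<^sub>v d" using Cv u(2) by (auto simp: mult_mat_zero_vec)
      ultimately show "eigenvalue (C * B * C) r" using v unfolding eigenvalue_def eigenvector_def index_mult_mat(2) c(3) by blast
    qed
    thus ?thesis using pencil_eigenvalues[OF m(1,2) b(1) P] by auto
  qed
  define kmin where "kmin = Min (e ` {..<d})"
  define kmax where "kmax = Max (e ` {..<d})"
  have ne: "e ` {..<d} \<noteq> {}" "finite (e ` {..<d})" using d by auto
  have le: "kmin \<le> e i" "e i \<le> kmax" if "i < d" for i using that by (auto simp: kmin_def kmax_def)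
  have kp: "kmin > 0" using ne epos by (auto simp: kmin_def)
  have abs: "{\<bar>r\<bar> | r. eigenvalue (C * B * C) r} = e ` {..<d}"
  proof -
    have "{\<bar>r\<bar> | r. eigenvalue (C * B * C) r} = abs ` {r. eigenvalue (C * B * C) r}" by auto
    also have "\<dots> = e ` {..<d}" unfolding ev image_image
      by (intro image_cong refl) (use epos in \<open>auto simp: abs_of_pos\<close>)
    finally show ?thesis .
  qed
  have kap: "kappa_pencil d B M = kmax / kmin"
    unfolding kappa_pencil_def kappa_mat_def C_def[symmetric] abs kmin_def kmax_def ..
  have vec: "kmin * (v \<bullet> (M *\<^sub>v v)) \<le> v \<bullet> (B *\<^sub>v v) \<and> v \<bullet> (B *\<^sub>v v) \<le> kmax * (v \<bullet> (M *\<^sub>v v))"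
    if v: "v \<in> carrier_vec d" for v
  proof -
    define w where "w = P\<^sup>T * M *\<^sub>v v"
    have w: "w \<in> carrier_vec d" using P by (intro carrier_vecI) (simp add: w_def)
    have vw: "v = P *\<^sub>v w"
    proof -
      have "P *\<^sub>v w = P * (P\<^sup>T * M) *\<^sub>v v" using v P by (simp add: w_def mat_vec_assoc)
      thus ?thesis using v by (simp add: PMP)
    qed
    have 1: "v \<bullet> (M *\<^sub>v v) = (\<Sum>i<d. (w $ i)\<^sup>2)"
      unfolding vw using quad_congruence[OF m(1) P(1) w w] w
      by (simp add: P scalar_prod_def lessThan_atLeast0 power2_eq_square)
    have 2: "v \<bullet> (B *\<^sub>v v) = (\<Sum>i<d. e i * (w $ i)\<^sup>2)"
      unfolding vw using quad_congruence[OF b(1) P(1) w w] w by (simp add: P quad_mat_diag)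
    show ?thesis unfolding 1 2 sum_distrib_left using le by (auto intro!: sum_mono mult_right_mono)
  qed
  show thesis
  proof (rule that[OF kp _ kap])
    show "kmin \<le> kmax" using le[of 0] d by simp
    fix p and X :: "real mat" assume X: "X \<in> carrier_mat d p"
    show "kmin * metric_g M X X \<le> metric_g B X X \<and> metric_g B X X \<le> kmax * metric_g M X X"
      unfolding metric_g_cols[OF m(1) X X] metric_g_cols[OF b(1) X X] sum_distrib_left
      using vec X by (auto intro!: sum_mono)
  qed
qed

text \<open>An enumeration of \<open>I\<close> reduces this to matrices, where diagonalization
  identifies \<open>R\<close> with the set of diagonal entries. The index set is abstract because
  the tangent space will get a basis indexed by pairs; finiteness and nonemptiness give meaning to
  \<open>Max\<close> and \<open>Min\<close> of the Hessian spectrum.\<close>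

lemma sym_pencil_eigenvalues:
  fixes G H :: "'i \<Rightarrow> 'i \<Rightarrow> real"
  assumes I: "finite I" "I \<noteq> {}"
    and sG: "\<And>i j. i \<in> I \<Longrightarrow> j \<in> I \<Longrightarrow> G i j = G j i" and sH: "\<And>i j. i \<in> I \<Longrightarrow> j \<in> I \<Longrightarrow> H i j = H j i"
    and pos: "\<And>c. \<exists>i\<in>I. c i \<noteq> 0 \<Longrightarrow> 0 < (\<Sum>i\<in>I. c i * (\<Sum>j\<in>I. G i j * c j))"
  defines "R \<equiv> {r. \<exists>c. (\<exists>i\<in>I. c i \<noteq> 0) \<and> (\<forall>i\<in>I. (\<Sum>j\<in>I. H i j * c j) = r * (\<Sum>j\<in>I. G i j * c j))}"
  shows "finite R" "R \<noteq> {}"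
proof -
  obtain f where f: "bij_betw f {0..<card I} I" using ex_bij_betw_nat_finite[OF I(1)] by blast
  define n where "n = card I"
  have n: "n > 0" using I by (simp add: n_def card_gt_0_iff)
  have f: "bij_betw f {..<n} I" using f by (simp add: n_def lessThan_atLeast0)
  have fI: "f i \<in> I" if "i < n" for i using f that by (auto simp: bij_betw_def)
  have surj: "\<exists>k<n. i = f k" if "i \<in> I" for i using f that by (auto simp: bij_betw_def)
  have inj: "inj_on f {..<n}" using f by (simp add: bij_betw_def)
  have re: "(\<Sum>j\<in>I. h j) = (\<Sum>j<n. h (f j))" for h :: "'i \<Rightarrow> real"
    using sum.reindex_bij_betw[OF f, of h] by simp
  define G' where "G' = mat n n (\<lambda>(i,j). G (f i) (f j))"
  define H' where "H' = mat n n (\<lambda>(i,j). H (f i) (f j))"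
  have [simp]: "dim_row G' = n" "dim_col G' = n" "dim_row H' = n" "dim_col H' = n" by (auto simp: G'_def H'_def)
  have H': "H' \<in> carrier_mat n n" "H'\<^sup>T = H'" using sH fI by (auto simp: H'_def intro!: eq_matI)
  have Gv: "(G' *\<^sub>v v) $ i = (\<Sum>j<n. G (f i) (f j) * v $ j)" if "v \<in> carrier_vec n" "i < n" for v i
    using that by (auto simp: G'_def scalar_prod_def lessThan_atLeast0 intro!: sum.cong)
  have Hv: "(H' *\<^sub>v v) $ i = (\<Sum>j<n. H (f i) (f j) * v $ j)" if "v \<in> carrier_vec n" "i < n" for v i
    using that by (auto simp: H'_def scalar_prod_def lessThan_atLeast0 intro!: sum.cong)
  define g where "g = the_inv_into {..<n} f"
  have gf: "g (f k) = k" if "k < n" for k using the_inv_into_f_f[OF inj] that by (simp add: g_def)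
  have G': "sym_pos_def_mat n G'"
    unfolding sym_pos_def_mat_def
  proof (intro conjI ballI impI)
    show "G' \<in> carrier_mat n n" by auto
    show "G'\<^sup>T = G'" using sG fI by (auto simp: G'_def intro!: eq_matI)
    fix v :: "real vec" assume v: "v \<in> carrier_vec n" "v \<noteq> 0\<^sub>v n"
    then obtain k where k: "k < n" "v $ k \<noteq> 0" by (metis carrier_vecD eq_vecI index_zero_vec)
    have "0 < (\<Sum>i\<in>I. v $ g i * (\<Sum>j\<in>I. G i j * v $ g j))"
      by (rule pos, rule bexI[of _ "f k"]) (use k fI gf in auto)
    also have "\<dots> = (\<Sum>i<n. v $ i * (\<Sum>j<n. G (f i) (f j) * v $ j))"
      unfolding re by (intro sum.cong refl arg_cong2[where f = "(*)"]) (auto simp: gf)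
    also have "\<dots> = v \<bullet> (G' *\<^sub>v v)"
      using v by (simp add: scalar_prod_def[of v] lessThan_atLeast0[symmetric] Gv del: index_mult_mat_vec)
    finally show "v \<bullet> (G' *\<^sub>v v) > 0" .
  qed
  have R: "R = {r. \<exists>c\<in>carrier_vec n. c \<noteq> 0\<^sub>v n \<and> H' *\<^sub>v c = r \<cdot>\<^sub>v (G' *\<^sub>v c)}"
  proof (intro equalityI subsetI)
    fix r assume "r \<in> R"
    then obtain c where c: "\<exists>i\<in>I. c i \<noteq> 0" "\<And>i. i \<in> I \<Longrightarrow> (\<Sum>j\<in>I. H i j * c j) = r * (\<Sum>j\<in>I. G i j * c j)"
      by (auto simp: R_def)
    define v where "v = vec n (\<lambda>k. c (f k))"
    have v: "v \<in> carrier_vec n" by (simp add: v_def)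
    obtain k where "k < n" "c (f k) \<noteq> 0" using c(1) surj by blast
    hence "v $ k \<noteq> 0\<^sub>v n $ k" by (simp add: v_def)
    hence "v \<noteq> 0\<^sub>v n" by metis
    moreover have "H' *\<^sub>v v = r \<cdot>\<^sub>v (G' *\<^sub>v v)"
    proof (rule eq_vecI)
      fix i assume "i < dim_vec (r \<cdot>\<^sub>v (G' *\<^sub>v v))"
      hence i: "i < n" by simp
      have "(\<Sum>j<n. H (f i) (f j) * v $ j) = r * (\<Sum>j<n. G (f i) (f j) * v $ j)"
        using c(2)[OF fI[OF i]] by (simp add: re v_def)
      thus "(H' *\<^sub>v v) $ i = (r \<cdot>\<^sub>v (G' *\<^sub>v v)) $ i" using i by (simp add: Gv[OF v] Hv[OF v] del: index_mult_mat_vec)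
    qed simp
    ultimately show "r \<in> {r. \<exists>c\<in>carrier_vec n. c \<noteq> 0\<^sub>v n \<and> H' *\<^sub>v c = r \<cdot>\<^sub>v (G' *\<^sub>v c)}" using v by blast
  next
    fix r assume "r \<in> {r. \<exists>c\<in>carrier_vec n. c \<noteq> 0\<^sub>v n \<and> H' *\<^sub>v c = r \<cdot>\<^sub>v (G' *\<^sub>v c)}"
    then obtain v where v: "v \<in> carrier_vec n" "v \<noteq> 0\<^sub>v n" "H' *\<^sub>v v = r \<cdot>\<^sub>v (G' *\<^sub>v v)" by blast
    then obtain k where k: "k < n" "v $ k \<noteq> 0" by (metis carrier_vecD eq_vecI index_zero_vec)
    have "(\<Sum>j\<in>I. H i j * v $ g j) = r * (\<Sum>j\<in>I. G i j * v $ g j)" if "i \<in> I" for i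
    proof -
      obtain l where l: "l < n" "i = f l" using surj \<open>i \<in> I\<close> by blast
      have "(H' *\<^sub>v v) $ l = r * (G' *\<^sub>v v) $ l" unfolding v(3) using l by simp
      thus ?thesis using l by (simp add: Gv[OF v(1)] Hv[OF v(1)] re gf del: index_mult_mat_vec)
    qed
    moreover have "\<exists>i\<in>I. v $ g i \<noteq> 0" using k fI gf by (intro bexI[of _ "f k"]) auto
    ultimately show "r \<in> R" unfolding R_def by (intro CollectI exI[of _ "\<lambda>i. v $ g i"]) auto
  qed
  obtain P e where P: "P \<in> carrier_mat n n" "P\<^sup>T * G' * P = 1\<^sub>m n" "P\<^sup>T * H' * P = mat_diag n e"
    using pencil_diagonalize_ex[OF G' H'] by blast
  have "R = e ` {..<n}" unfolding R by (rule pencil_eigenvalues[OF spdD(1,2)[OF G'] H'(1) P])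
  thus "finite R" "R \<noteq> {}" using n by auto
qed

section \<open>Lyapunov equations\<close>

text \<open>\<open>J\<close> is the inverse of \<open>M\<close>. In coordinates w that diagonalize
  the pencil (B, M) the two sides are c times the sum of e_i w_i^2 and the sum of e_i^2 w_i^2, so
  \<open>c\<close> can be the smallest e_i. The bound later makes a Gram matrix coercive.\<close>

lemma spd_inverse_bound:
  assumes B: "sym_pos_def_mat d B" and M: "sym_pos_def_mat d M" and d: "d > 0"
  obtains J c where "J \<in> carrier_mat d d" "J\<^sup>T = J" "M * J = 1\<^sub>m d" "J * M = 1\<^sub>m d" "c > 0"
    "\<And>z. z \<in> carrier_vec d \<Longrightarrow> c * (z \<bullet> (B *\<^sub>v z)) \<le> (B *\<^sub>v z) \<bullet> (J *\<^sub>v (B *\<^sub>v z))"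
proof -
  note b = spdD[OF B] and m = spdD[OF M]
  obtain P e where P: "P \<in> carrier_mat d d" "P\<^sup>T * M * P = 1\<^sub>m d" "P\<^sup>T * B * P = mat_diag d e"
    and PMP: "P * (P\<^sup>T * M) = 1\<^sub>m d" and epos: "\<And>i. i < d \<Longrightarrow> 0 < e i"
    using pencil_diagonalize_spd[OF M B] by blast
  note [simp] = b(3,4) m(3,4)
  have [simp]: "dim_row P = d" "dim_col P = d" using P by auto
  define J where "J = P * P\<^sup>T"
  have J: "J \<in> carrier_mat d d" "J\<^sup>T = J" using P(1) by (auto simp: J_def mat_transpose_mult)
  have JM: "J * M = 1\<^sub>m d" using PMP by (simp add: J_def mat_mult_assoc)
  have MJ: "M * J = 1\<^sub>m d" using mat_mult_left_right_inverse[OF J(1) m(1) JM] .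
  define c where "c = Min (e ` {..<d})"
  have "e ` {..<d} \<noteq> {}" using d by auto
  hence c: "c > 0" "i < d \<Longrightarrow> c \<le> e i" for i using epos by (auto simp: c_def)
  show thesis
  proof (rule that[OF J MJ JM])
    show "c > 0" by (rule c(1))
    fix z :: "real vec" assume z: "z \<in> carrier_vec d"
    define w where "w = P\<^sup>T * M *\<^sub>v z"
    have w: "w \<in> carrier_vec d" by (intro carrier_vecI) (simp add: w_def)
    have zw: "z = P *\<^sub>v w"
    proof -
      have "P *\<^sub>v w = P * (P\<^sup>T * M) *\<^sub>v z" using z by (simp add: w_def mat_vec_assoc)
      thus ?thesis using z by (simp add: PMP)
    qed
    have "z \<bullet> (B *\<^sub>v z) = (\<Sum>i<d. e i * (w $ i)\<^sup>2)"
      unfolding zw using quad_congruence[OF b(1) P(1) w w] w by (simp add: P quad_mat_diag)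
    moreover have "(B *\<^sub>v z) \<bullet> (J *\<^sub>v (B *\<^sub>v z)) = (\<Sum>i<d. e i * e i * (w $ i)\<^sup>2)"
    proof -
      define u where "u = P\<^sup>T *\<^sub>v (B *\<^sub>v z)"
      have u: "u = vec d (\<lambda>i. e i * w $ i)"
      proof -
        have "u = P\<^sup>T * B * P *\<^sub>v w" using w by (simp add: u_def zw mat_mult_assoc mat_vec_assoc)
        thus ?thesis using w by (simp add: P mat_diag_mult_vec)
      qed
      have "(B *\<^sub>v z) \<bullet> (J *\<^sub>v (B *\<^sub>v z)) = (B *\<^sub>v z) \<bullet> ((P\<^sup>T\<^sup>T * 1\<^sub>m d * P\<^sup>T) *\<^sub>v (B *\<^sub>v z))"
        using P(1) by (simp add: J_def)
      also have "\<dots> = u \<bullet> (1\<^sub>m d *\<^sub>v u)"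
        unfolding u_def using z P(1) b(1) by (intro quad_congruence[of _ d]) (auto intro: carrier_vecI)
      also have "\<dots> = (\<Sum>i<d. e i * e i * (w $ i)\<^sup>2)"
        by (simp add: u scalar_prod_def lessThan_atLeast0 power2_eq_square mult_ac)
      finally show ?thesis .
    qed
    ultimately show "c * (z \<bullet> (B *\<^sub>v z)) \<le> (B *\<^sub>v z) \<bullet> (J *\<^sub>v (B *\<^sub>v z))"
      using c epos by (auto simp: sum_distrib_left mult.assoc[symmetric] less_imp_le
        intro!: sum_mono mult_right_mono)
  qed
qed

text \<open>In an orthonormal eigenbasis of \<open>Q\<close> the equation decouples into (e_i + e_j)
  S_ij = T_ij, and the divisors are positive.\<close>

lemma lyapunov_solvable:
  assumes Q: "sym_pos_def_mat p Q" and R: "R \<in> carrier_mat p p" "R\<^sup>T = R"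
  shows "\<exists>S\<in>carrier_mat p p. S\<^sup>T = S \<and> Q * S + S * Q = R"
proof -
  note q = spdD[OF Q]
  obtain U e where U: "U \<in> carrier_mat p p" "U\<^sup>T * U = 1\<^sub>m p" "U * U\<^sup>T = 1\<^sub>m p"
     "U\<^sup>T * Q * U = mat_diag p e" "\<forall>i<p. e i > 0"
    using spd_diagonalize[OF Q] by blast
  note [simp] = q(3,4)
  have [simp]: "dim_row U = p" "dim_col U = p" "dim_row R = p" "dim_col R = p" using U R by auto
  define T where "T = U\<^sup>T * R * U"
  have T: "T \<in> carrier_mat p p" "T\<^sup>T = T" using U(1) R by (auto simp: T_def mat_transpose_mult mat_mult_assoc)
  have Tij: "T $$ (i,j) = T $$ (j,i)" if "i < p" "j < p" for i j
    using T that by (metis carrier_matD index_transpose_mat(1))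
  define S where "S = mat p p (\<lambda>(i,j). T $$ (i,j) / (e i + e j))"
  have S: "S \<in> carrier_mat p p" "S\<^sup>T = S" using Tij by (auto simp: S_def add.commute intro!: eq_matI)
  have [simp]: "dim_row S = p" "dim_col S = p" using S by auto
  define D where "D = mat_diag p e"
  have D: "D \<in> carrier_mat p p" by (simp add: D_def)
  have [simp]: "dim_row D = p" "dim_col D = p" using D by auto
  have DS: "D * S + S * D = T"
    unfolding D_def mat_diag_mult_left[OF S(1)] mat_diag_mult_right[OF S(1)]
  proof (rule eq_matI)
    fix i j assume "i < dim_row T" "j < dim_col T"
    hence ij: "i < p" "j < p" using T by auto
    have "e i + e j > 0" using U(5) ij by (simp add: add_pos_pos)
    moreover have "e i * (T $$ (i,j) / (e i + e j)) + T $$ (i,j) / (e i + e j) * e j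
        = T $$ (i,j) / (e i + e j) * (e i + e j)" by (metis distrib_left mult.commute)
    ultimately have "e i * (T $$ (i,j) / (e i + e j)) + T $$ (i,j) / (e i + e j) * e j = T $$ (i,j)"
      by simp
    thus "(mat p p (\<lambda>(i, j). e i * S $$ (i, j)) + mat p p (\<lambda>(i, j). S $$ (i, j) * e j)) $$ (i, j) = T $$ (i, j)"
      using ij by (simp add: S_def)
  qed (use T in auto)
  have QUDU: "Q = U * D * U\<^sup>T"
  proof -
    have "U * D * U\<^sup>T = (U * U\<^sup>T) * Q * (U * U\<^sup>T)"
      unfolding D_def U(4)[symmetric] using U(1) q(1) by (simp add: mat_mult_assoc)
    thus ?thesis using q(1) by (simp add: U(3))
  qed
  have RUTU: "R = U * T * U\<^sup>T"
  proof -
    have "U * T * U\<^sup>T = (U * U\<^sup>T) * R * (U * U\<^sup>T)"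
      unfolding T_def using U(1) R(1) by (simp add: mat_mult_assoc)
    thus ?thesis using R(1) by (simp add: U(3))
  qed
  have c: "D * S \<in> carrier_mat p p" "S * D \<in> carrier_mat p p" using D S by auto
  define X where "X = U * S * U\<^sup>T"
  have "Q * X = U * (D * S) * U\<^sup>T"
    unfolding QUDU X_def using U(1) D S by (simp add: mat_mult_assoc mat_mult_cancel_left[OF U(2)])
  moreover have "X * Q = U * (S * D) * U\<^sup>T"
    unfolding QUDU X_def using U(1) D S by (simp add: mat_mult_assoc mat_mult_cancel_left[OF U(2)])
  ultimately have "Q * X + X * Q = U * (D * S + S * D) * U\<^sup>T"
    using U(1) c by (simp add: mult_add_distrib_mat[of _ p p _ p] add_mult_distrib_mat[of _ p p _ _ p])
  also have "\<dots> = R" unfolding DS RUTU ..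
  finally have "Q * X + X * Q = R" .
  moreover have "X \<in> carrier_mat p p" "X\<^sup>T = X" unfolding X_def using U(1) S
    by (auto simp: mat_transpose_mult mat_mult_assoc)
  ultimately show ?thesis by blast
qed

text \<open>Taking the trace of the equation against E gives tr(E R) = 2 tr(E Q E), at least 2 c
  |E|^2 in the Frobenius norm. Together with 4 c tr(E R) \<le> 4 c^2 |E|^2 + |R|^2 this yields the
  constant 4 c^2.\<close>

lemma lyapunov_coercive:
  fixes Q E R :: "real mat"
  assumes Q: "Q \<in> carrier_mat p p" and E: "E \<in> carrier_mat p p" "E\<^sup>T = E" and c: "c > 0"
    and coer: "\<And>v. v \<in> carrier_vec p \<Longrightarrow> c * (v \<bullet> v) \<le> v \<bullet> (Q *\<^sub>v v)"
    and eq: "Q * E + E * Q = R"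
  shows "4 * c\<^sup>2 * (\<Sum>i<p. \<Sum>j<p. (E $$ (i,j))\<^sup>2) \<le> (\<Sum>i<p. \<Sum>j<p. (R $$ (i,j))\<^sup>2)"
proof -
  have R: "R \<in> carrier_mat p p" using eq Q E by auto
  define F where "F = (\<Sum>i<p. \<Sum>j<p. (E $$ (i,j))\<^sup>2)"
  define H where "H = (\<Sum>i<p. \<Sum>j<p. (R $$ (i,j))\<^sup>2)"
  have F: "F = (\<Sum>j<p. col E j \<bullet> col E j)"
    unfolding F_def power2_eq_square using E(1)
    by (subst sum.swap) (auto simp: scalar_prod_def lessThan_atLeast0 intro!: sum.cong)
  have "c * F \<le> (\<Sum>j<p. col E j \<bullet> (Q *\<^sub>v col E j))"
    unfolding F sum_distrib_left using coer E by (intro sum_mono) auto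
  also have "\<dots> = metric_g Q E E" by (rule metric_g_cols[OF Q E(1) E(1), symmetric])
  finally have 1: "c * F \<le> mat_trace (E * (Q * E))" using Q E by (simp add: metric_g_def)
  have "mat_trace (E * R) = mat_trace (E * (Q * E)) + mat_trace (E * (E * Q))"
    unfolding eq[symmetric] using Q E(1) by (simp add: mult_add_distrib_mat[of _ p p _ p] mat_trace_add)
  also have "mat_trace (E * (E * Q)) = mat_trace ((E * Q) * E)"
    using Q E(1) by (intro mat_trace_comm) auto
  also have "\<dots> = mat_trace (E * (Q * E))" using Q E(1) by simp
  finally have 2: "mat_trace (E * R) = 2 * mat_trace (E * (Q * E))" by simp
  have "4 * c * mat_trace (E * R) = (\<Sum>i<p. \<Sum>k<p. 4 * c * (E $$ (i,k) * R $$ (k,i)))"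
    using E(1) R by (simp add: mat_trace_mult sum_distrib_left)
  also have "\<dots> = (\<Sum>i<p. \<Sum>k<p. 4 * c * (E $$ (k,i) * R $$ (k,i)))"
    using E by (intro sum.cong refl arg_cong2[where f="(*)"]) (metis carrier_matD index_transpose_mat(1) lessThan_iff)+
  also have "\<dots> \<le> (\<Sum>i<p. \<Sum>k<p. 4 * c\<^sup>2 * (E $$ (k,i))\<^sup>2 + (R $$ (k,i))\<^sup>2)"
  proof (intro sum_mono)
    fix i k
    have "0 \<le> (2 * c * E $$ (k,i) - R $$ (k,i))\<^sup>2" by simp
    thus "4 * c * (E $$ (k,i) * R $$ (k,i)) \<le> 4 * c\<^sup>2 * (E $$ (k,i))\<^sup>2 + (R $$ (k,i))\<^sup>2"
      by (simp add: power2_diff power_mult_distrib algebra_simps)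
  qed
  also have "\<dots> = (\<Sum>i<p. \<Sum>k<p. 4 * c\<^sup>2 * (E $$ (i,k))\<^sup>2 + (R $$ (i,k))\<^sup>2)" by (rule sum.swap)
  also have "\<dots> = 4 * c\<^sup>2 * F + H" by (simp add: F_def H_def sum.distrib sum_distrib_left)
  finally have "4 * c * (2 * mat_trace (E * (Q * E))) \<le> 4 * c\<^sup>2 * F + H" unfolding 2 .
  moreover have "4 * c * (2 * (c * F)) \<le> 4 * c * (2 * mat_trace (E * (Q * E)))" using 1 c by simp
  ultimately have "4 * c\<^sup>2 * F \<le> H" by (simp add: power2_eq_square)
  thus ?thesis by (simp add: F_def H_def)
qed

section \<open>Entrywise limits of matrix curves at 0 and continuity of Lyapunov solutions\<close>

definition mat_tends :: "nat \<Rightarrow> nat \<Rightarrow> (real \<Rightarrow> real mat) \<Rightarrow> real mat \<Rightarrow> bool" where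
  "mat_tends r c A L \<longleftrightarrow> (\<forall>t. A t \<in> carrier_mat r c) \<and> L \<in> carrier_mat r c \<and>
     (\<forall>i<r. \<forall>j<c. ((\<lambda>t. A t $$ (i,j)) \<longlongrightarrow> L $$ (i,j)) (at 0))"

lemma mat_tendsD:
  assumes "mat_tends r c A L"
  shows "A t \<in> carrier_mat r c" "L \<in> carrier_mat r c" "dim_row (A t) = r" "dim_col (A t) = c"
    "dim_row L = r" "dim_col L = c"
    "i < r \<Longrightarrow> j < c \<Longrightarrow> ((\<lambda>t. A t $$ (i,j)) \<longlongrightarrow> L $$ (i,j)) (at 0)"
  using assms unfolding mat_tends_def by (auto dest: spec[of _ t])

lemma mat_tends_const: "A \<in> carrier_mat r c \<Longrightarrow> mat_tends r c (\<lambda>t. A) A"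
  by (simp add: mat_tends_def)

lemma mat_tends_add:
  assumes A: "mat_tends r c A L" and A': "mat_tends r c A' L'"
  shows "mat_tends r c (\<lambda>t. A t + A' t) (L + L')"
  unfolding mat_tends_def
proof (intro conjI allI impI)
  note d = mat_tendsD[OF A] mat_tendsD[OF A']
  show "A t + A' t \<in> carrier_mat r c" for t using d(1,8)[of t] by auto
  show "L + L' \<in> carrier_mat r c" using d(2,9) by auto
  fix i j assume ij: "i < r" "j < c"
  have "(A t + A' t) $$ (i,j) = A t $$ (i,j) + A' t $$ (i,j)" for t using ij d(10,11)[of t] by simp
  thus "((\<lambda>t. (A t + A' t) $$ (i,j)) \<longlongrightarrow> (L + L') $$ (i,j)) (at 0)"
    using tendsto_add[OF d(7)[OF ij] d(14)[OF ij]] ij d(12,13) by simp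
qed

lemma mat_tends_diff:
  assumes A: "mat_tends r c A L" and A': "mat_tends r c A' L'"
  shows "mat_tends r c (\<lambda>t. A t - A' t) (L - L')"
  unfolding mat_tends_def
proof (intro conjI allI impI)
  note d = mat_tendsD[OF A] mat_tendsD[OF A']
  show "A t - A' t \<in> carrier_mat r c" for t using d(1,8)[of t] by (auto intro: minus_carrier_mat)
  show "L - L' \<in> carrier_mat r c" using d(2,9) by (auto intro: minus_carrier_mat)
  fix i j assume ij: "i < r" "j < c"
  have "(A t - A' t) $$ (i,j) = A t $$ (i,j) - A' t $$ (i,j)" for t using ij d(10,11)[of t] by simp
  thus "((\<lambda>t. (A t - A' t) $$ (i,j)) \<longlongrightarrow> (L - L') $$ (i,j)) (at 0)"
    using tendsto_diff[OF d(7)[OF ij] d(14)[OF ij]] ij d(12,13) by simp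
qed

lemma mat_tends_transpose:
  assumes A: "mat_tends r c A L"
  shows "mat_tends c r (\<lambda>t. (A t)\<^sup>T) (L\<^sup>T)"
  unfolding mat_tends_def
proof (intro conjI allI impI)
  note d = mat_tendsD[OF A]
  show "(A t)\<^sup>T \<in> carrier_mat c r" for t using d(1)[of t] by simp
  show "L\<^sup>T \<in> carrier_mat c r" using d(2) by simp
  fix i j assume ij: "i < c" "j < r"
  have "(A t)\<^sup>T $$ (i,j) = A t $$ (j,i)" for t using ij d(3,4)[of t] by simp
  thus "((\<lambda>t. (A t)\<^sup>T $$ (i,j)) \<longlongrightarrow> L\<^sup>T $$ (i,j)) (at 0)"
    using d(7)[OF ij(2,1)] ij d(5,6) by simp
qed

lemma mat_tends_mult:
  assumes A: "mat_tends r m A L" and A': "mat_tends m c A' L'"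
  shows "mat_tends r c (\<lambda>t. A t * A' t) (L * L')"
  unfolding mat_tends_def
proof (intro conjI allI impI)
  note d = mat_tendsD[OF A] mat_tendsD[OF A']
  show "A t * A' t \<in> carrier_mat r c" for t using d(1,8) by (rule mult_carrier_mat)
  show "L * L' \<in> carrier_mat r c" using d(2,9) by (rule mult_carrier_mat)
  fix i j assume ij: "i < r" "j < c"
  have "((\<lambda>t. \<Sum>k<m. A t $$ (i,k) * A' t $$ (k,j)) \<longlongrightarrow> (\<Sum>k<m. L $$ (i,k) * L' $$ (k,j))) (at 0)"
    using ij d(7,14) by (intro tendsto_sum tendsto_mult) auto
  moreover have "(A t * A' t) $$ (i,j) = (\<Sum>k<m. A t $$ (i,k) * A' t $$ (k,j))" for t
    using ij d(3,4,10,11)[of t] by (simp add: scalar_prod_def lessThan_atLeast0)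
  moreover have "(L * L') $$ (i,j) = (\<Sum>k<m. L $$ (i,k) * L' $$ (k,j))"
    using ij d(5,6,12,13) by (simp add: scalar_prod_def lessThan_atLeast0)
  ultimately show "((\<lambda>t. (A t * A' t) $$ (i,j)) \<longlongrightarrow> (L * L') $$ (i,j)) (at 0)" by simp
qed

lemma mat_tends_line:
  assumes "W \<in> carrier_mat r c" "X \<in> carrier_mat r c"
  shows "mat_tends r c (\<lambda>t. W + t \<cdot>\<^sub>m X) W"
  unfolding mat_tends_def
proof (intro conjI allI impI)
  fix i j assume "i < r" "j < c"
  have "((\<lambda>t. W $$ (i,j) + t * X $$ (i,j)) \<longlongrightarrow> W $$ (i,j) + 0 * X $$ (i,j)) (at 0)"
    by (intro tendsto_intros)
  thus "((\<lambda>t. (W + t \<cdot>\<^sub>m X) $$ (i,j)) \<longlongrightarrow> W $$ (i,j)) (at 0)"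
    using \<open>i < r\<close> \<open>j < c\<close> assms by simp
qed (use assms in auto)

lemma lyapunov_solution_tends:
  assumes Q: "mat_tends p p Q (Q 0)" and R: "mat_tends p p R (R 0)" and c: "c > 0"
    and coer: "\<And>t v. v \<in> carrier_vec p \<Longrightarrow> c * (v \<bullet> v) \<le> v \<bullet> (Q t *\<^sub>v v)"
    and S: "\<And>t. S t \<in> carrier_mat p p" "\<And>t. (S t)\<^sup>T = S t" "\<And>t. Q t * S t + S t * Q t = R t"
  shows "mat_tends p p S (S 0)"
proof -
  note q = mat_tendsD(1)[OF Q] and r = mat_tendsD(1)[OF R]
  define N where "N = (\<lambda>t. R t - (Q t * S 0 + S 0 * Q t))"
  have "mat_tends p p N (R 0 - (Q 0 * S 0 + S 0 * Q 0))"
    unfolding N_def by (intro mat_tends_diff mat_tends_add R mat_tends_mult[OF Q mat_tends_const[OF S(1)]]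
        mat_tends_mult[OF mat_tends_const[OF S(1)] Q])
  hence Nt: "mat_tends p p N (0\<^sub>m p p)" using r[of 0] by (simp add: S(3))
  have EN: "Q t * (S t - S 0) + (S t - S 0) * Q t = N t" for t
  proof -
    have "Q t * (S t - S 0) + (S t - S 0) * Q t = (Q t * S t - Q t * S 0) + (S t * Q t - S 0 * Q t)"
      using q S(1) by (simp add: mult_minus_distrib_mat[of _ p p _ p] minus_mult_distrib_mat[of _ p p _ _ p])
    also have "\<dots> = (Q t * S t + S t * Q t) - (Q t * S 0 + S 0 * Q t)"
      using q[of t] S(1)[of t] S(1)[of 0] by (intro eq_matI) auto
    finally show ?thesis by (simp add: N_def S(3))
  qed
  have "((\<lambda>t. \<Sum>i<p. \<Sum>j<p. (N t $$ (i,j))\<^sup>2) \<longlongrightarrow> (\<Sum>i<p. \<Sum>j<p. (0\<^sub>m p p $$ (i,j))\<^sup>2)) (at 0)"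
    using mat_tendsD(7)[OF Nt] by (intro tendsto_sum tendsto_power) auto
  also have "(\<Sum>i<p. \<Sum>j<p. (0\<^sub>m p p $$ (i,j) :: real)\<^sup>2) = 0" by simp
  finally have N0: "((\<lambda>t. \<Sum>i<p. \<Sum>j<p. (N t $$ (i,j))\<^sup>2) \<longlongrightarrow> 0) (at 0)" .
  have lim: "((\<lambda>t. (S t - S 0) $$ (i,j)) \<longlongrightarrow> 0) (at 0)" if ij: "i < p" "j < p" for i j
  proof -
    have bd: "((S t - S 0) $$ (i,j))\<^sup>2 \<le> (\<Sum>i<p. \<Sum>j<p. (N t $$ (i,j))\<^sup>2) / (4 * c\<^sup>2)" for t
    proof -
      have "((S t - S 0) $$ (i,j))\<^sup>2 \<le> (\<Sum>j<p. ((S t - S 0) $$ (i,j))\<^sup>2)"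
        using ij by (intro member_le_sum[of j _ "\<lambda>j. ((S t - S 0) $$ (i,j))\<^sup>2"]) auto
      also have "\<dots> \<le> (\<Sum>i<p. \<Sum>j<p. ((S t - S 0) $$ (i,j))\<^sup>2)"
        using ij by (intro member_le_sum[of i _ "\<lambda>i. \<Sum>j<p. ((S t - S 0) $$ (i,j))\<^sup>2"]) (auto intro!: sum_nonneg)
      finally have 1: "((S t - S 0) $$ (i,j))\<^sup>2 \<le> (\<Sum>i<p. \<Sum>j<p. ((S t - S 0) $$ (i,j))\<^sup>2)" .
      have "4 * c\<^sup>2 * (\<Sum>i<p. \<Sum>j<p. ((S t - S 0) $$ (i,j))\<^sup>2) \<le> (\<Sum>i<p. \<Sum>j<p. (N t $$ (i,j))\<^sup>2)"
        using S(1)[of t] S(1)[of 0] S(2)[of t] S(2)[of 0]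
        by (intro lyapunov_coercive[OF q _ _ c coer EN]) (auto simp: transpose_minus minus_carrier_mat)
      moreover have "4 * c\<^sup>2 * ((S t - S 0) $$ (i,j))\<^sup>2 \<le> 4 * c\<^sup>2 * (\<Sum>i<p. \<Sum>j<p. ((S t - S 0) $$ (i,j))\<^sup>2)"
        using 1 by (intro mult_left_mono) auto
      ultimately have "4 * c\<^sup>2 * ((S t - S 0) $$ (i,j))\<^sup>2 \<le> (\<Sum>i<p. \<Sum>j<p. (N t $$ (i,j))\<^sup>2)"
        by (rule order_trans[rotated])
      thus ?thesis using c by (simp add: pos_le_divide_eq mult.commute)
    qed
    have "((\<lambda>t. ((S t - S 0) $$ (i,j))\<^sup>2) \<longlongrightarrow> 0) (at 0)"
    proof (rule tendsto_sandwich[OF _ _ tendsto_const])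
      show "((\<lambda>t. (\<Sum>i<p. \<Sum>j<p. (N t $$ (i,j))\<^sup>2) / (4 * c\<^sup>2)) \<longlongrightarrow> 0) (at 0)"
        using tendsto_divide[OF N0 tendsto_const[of "4 * c\<^sup>2"]] c by simp
    qed (use bd in auto)
    hence "((\<lambda>t. sqrt (((S t - S 0) $$ (i,j))\<^sup>2)) \<longlongrightarrow> sqrt 0) (at 0)" by (rule tendsto_real_sqrt)
    thus ?thesis by (simp add: tendsto_rabs_zero_iff)
  qed
  have "((\<lambda>t. S t $$ (i,j)) \<longlongrightarrow> S 0 $$ (i,j)) (at 0)" if ij: "i < p" "j < p" for i j
  proof -
    have "(S t - S 0) $$ (i,j) = S t $$ (i,j) - S 0 $$ (i,j)" for t
      using ij S(1)[of t] S(1)[of 0] by simp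
    thus ?thesis using lim[OF ij] by (simp add: LIM_zero_cancel)
  qed
  thus ?thesis using S(1) by (simp add: mat_tends_def)
qed

section \<open>Derivatives at 0 and algebra of the trace metric\<close>

lemma deriv0_eq: "(g has_real_derivative D) (at 0) \<Longrightarrow> deriv0 g = D"
  unfolding deriv0_def by (rule the_equality) (auto intro: DERIV_unique)

text \<open>The difference quotient of t \<phi>(t) at 0 is \<phi>(t) itself, so a limit of \<phi>
  suffices. This differentiates a gradient that is t times a field known only to be continuous at
  0.\<close>

lemma deriv0_scaled:
  assumes "(\<phi> \<longlongrightarrow> L) (at (0::real))"
  shows "deriv0 (\<lambda>t. t * \<phi> t) = L"
proof (rule deriv0_eq, unfold DERIV_def)
  have "((\<lambda>h. (h * \<phi> h) / h) \<longlongrightarrow> L) (at 0)"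
    by (rule Lim_transform_eventually[OF assms]) (auto simp: eventually_at_filter)
  thus "((\<lambda>h. ((0 + h) * \<phi> (0 + h) - 0 * \<phi> 0) / h) \<longlongrightarrow> L) (at 0)" by simp
qed

lemma metric_g_minus_left:
  assumes "M \<in> carrier_mat d d" "X \<in> carrier_mat d p" "Y \<in> carrier_mat d p" "Z \<in> carrier_mat d p"
  shows "metric_g M (X - Y) Z = metric_g M X Z - metric_g M Y Z"
proof -
  have "(X - Y)\<^sup>T * M * Z = X\<^sup>T * M * Z - Y\<^sup>T * M * Z"
    using assms by (simp add: transpose_minus[of _ d p] minus_mult_distrib_mat[of _ p d _ _ p] minus_mult_distrib_mat[of _ p d _ _ d])
  thus ?thesis using assms by (simp add: metric_g_def mat_trace_def sum_subtractf)
qed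

lemma metric_g_smult_left:
  assumes "M \<in> carrier_mat d d" "X \<in> carrier_mat d p" "Z \<in> carrier_mat d p"
  shows "metric_g M (a \<cdot>\<^sub>m X) Z = a * metric_g M X Z"
proof -
  have "(a \<cdot>\<^sub>m X)\<^sup>T = a \<cdot>\<^sub>m X\<^sup>T" by (rule eq_matI) auto
  hence "(a \<cdot>\<^sub>m X)\<^sup>T * M * Z = a \<cdot>\<^sub>m (X\<^sup>T * M * Z)"
    using assms by (simp add: mult_smult_assoc_mat[of _ p d _ d] mult_smult_assoc_mat[of _ p d _ p])
  thus ?thesis using assms by (simp add: metric_g_def mat_trace_def sum_distrib_left)
qed

lemma metric_g_commute:
  assumes "M \<in> carrier_mat d d" "M\<^sup>T = M" "X \<in> carrier_mat d p" "Y \<in> carrier_mat d p"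
  shows "metric_g M X Y = metric_g M Y X"
proof -
  have "(X\<^sup>T * M * Y)\<^sup>T = Y\<^sup>T * M * X" using assms by (simp add: mat_transpose_mult mat_mult_assoc)
  moreover have "mat_trace ((X\<^sup>T * M * Y)\<^sup>T) = mat_trace (X\<^sup>T * M * Y)"
    using assms by (intro mat_trace_transpose) auto
  ultimately show ?thesis by (simp add: metric_g_def)
qed

text \<open>Transposition and cyclicity of the trace give tr(S A) = tr(S A^T) = - tr(S A). This is
  the source of orthogonality between normal and tangent directions.\<close>

lemma mat_trace_sym_skew:
  assumes S: "S \<in> carrier_mat p p" "S\<^sup>T = S" and A: "A \<in> carrier_mat p p" "A\<^sup>T + A = 0\<^sub>m p p"
  shows "mat_trace (S * A) = 0"
proof -
  have "mat_trace (S * A) = mat_trace ((S * A)\<^sup>T)" using S A by (intro mat_trace_transpose[symmetric]) auto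
  also have "(S * A)\<^sup>T = A\<^sup>T * S" using S A by (simp add: mat_transpose_mult)
  also have "mat_trace \<dots> = mat_trace (S * A\<^sup>T)" using S A by (intro mat_trace_comm) auto
  finally have "2 * mat_trace (S * A) = mat_trace (S * A\<^sup>T) + mat_trace (S * A)" by simp
  also have "\<dots> = mat_trace (S * (A\<^sup>T + A))"
    using S(1) A(1) by (simp add: mult_add_distrib_mat[of _ p p _ p] mat_trace_add)
  also have "\<dots> = 0" unfolding A(2) using S by (simp add: mat_trace_def)
  finally show ?thesis by simp
qed

section \<open>The Riemannian Hessian at a critical point\<close>

text \<open>The objective is -1/2 times the quadratic form of the symmetric bilinear
  \<open>\<tau>\<close>, so its derivative in direction \<eta> is - \<tau> \<eta> Y. The factor
  \<open>J\<close>, the inverse of \<open>M\<close>, represents this functional in the metric of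
  \<open>M\<close>; testing the difference of two candidates against itself gives
  uniqueness.\<close>

lemma euclid_grad_f_FDA:
  assumes M: "sym_pos_def_mat d M" and J: "J \<in> carrier_mat d d" "J\<^sup>T = J" "J * M = 1\<^sub>m d"
    and A: "A \<in> carrier_mat d d" "A\<^sup>T = A" and N: "N \<in> carrier_mat p p" "N\<^sup>T = N"
    and Y: "Y \<in> carrier_mat d p"
  shows "euclid_grad p d M (f_FDA A N) Y = (-1) \<cdot>\<^sub>m (J * A * Y * N)"
proof -
  note m = spdD[OF M]
  have [simp]: "dim_row A = d" "dim_col A = d" "dim_row N = p" "dim_col N = p" "dim_row M = d" "dim_col M = d"
    "dim_row J = d" "dim_col J = d" "dim_row Y = d" "dim_col Y = p" using A N Y m J by auto
  define \<tau> where "\<tau> X Z = mat_trace (X\<^sup>T * (A * (Z * N)))" for X Z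
  have \<tau>_sym: "\<tau> X Z = \<tau> Z X" if X: "X \<in> carrier_mat d p" and Z: "Z \<in> carrier_mat d p" for X Z
  proof -
    have "\<tau> X Z = mat_trace ((X\<^sup>T * (A * (Z * N)))\<^sup>T)" unfolding \<tau>_def
      using X Z by (intro mat_trace_transpose[symmetric]) auto
    also have "(X\<^sup>T * (A * (Z * N)))\<^sup>T = N * (Z\<^sup>T * (A * X))"
      using X Z by (simp add: mat_transpose_mult A N mat_mult_assoc)
    also have "mat_trace \<dots> = mat_trace ((Z\<^sup>T * (A * X)) * N)"
      using X Z by (intro mat_trace_comm) auto
    also have "\<dots> = \<tau> Z X" unfolding \<tau>_def using X Z by (simp add: mat_mult_assoc)
    finally show ?thesis .
  qed
  have \<tau>_add: "\<tau> (X + t \<cdot>\<^sub>m X') Z = \<tau> X Z + t * \<tau> X' Z"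
    if X: "X \<in> carrier_mat d p" "X' \<in> carrier_mat d p" and Z: "Z \<in> carrier_mat d p" for X X' Z t
  proof -
    define U where "U = A * (Z * N)"
    have U: "U \<in> carrier_mat d p" using Z A N by (simp add: U_def)
    have T: "(X + t \<cdot>\<^sub>m X')\<^sup>T = X\<^sup>T + t \<cdot>\<^sub>m X'\<^sup>T" using X by (intro eq_matI) auto
    have "(X + t \<cdot>\<^sub>m X')\<^sup>T * U = X\<^sup>T * U + t \<cdot>\<^sub>m (X'\<^sup>T * U)"
      unfolding T using X U by (simp add: add_mult_distrib_mat[of _ p d _ _ p] mult_smult_assoc_mat[of _ p d _ p])
    thus ?thesis unfolding \<tau>_def U_def[symmetric] using X U
      by (simp add: mat_trace_def sum.distrib sum_distrib_left)
  qed
  have f: "f_FDA A N (Y + t \<cdot>\<^sub>m \<eta>) = - (1/2) * (\<tau> Y Y + 2 * t * \<tau> \<eta> Y + t\<^sup>2 * \<tau> \<eta> \<eta>)"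
    if \<eta>: "\<eta> \<in> carrier_mat d p" for \<eta> t
  proof -
    let ?Z = "Y + t \<cdot>\<^sub>m \<eta>"
    have Z: "?Z \<in> carrier_mat d p" using Y \<eta> by auto
    have "f_FDA A N ?Z = - (1/2) * \<tau> ?Z ?Z"
      unfolding f_FDA_def \<tau>_def using Z A N \<eta> by (simp add: mat_mult_assoc)
    also have "\<tau> ?Z ?Z = \<tau> ?Z Y + t * \<tau> ?Z \<eta>"
      using \<tau>_add[OF Y \<eta> Z] \<tau>_sym[OF Y Z] \<tau>_sym[OF \<eta> Z] by simp
    also have "\<dots> = \<tau> Y Y + 2 * t * \<tau> \<eta> Y + t\<^sup>2 * \<tau> \<eta> \<eta>"
      using \<tau>_add[OF Y \<eta> Y] \<tau>_add[OF Y \<eta> \<eta>] \<tau>_sym[OF Y \<eta>]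
      by (simp add: algebra_simps power2_eq_square)
    finally show ?thesis .
  qed
  have D: "deriv0 (\<lambda>t. f_FDA A N (Y + t \<cdot>\<^sub>m \<eta>)) = - \<tau> \<eta> Y" if \<eta>: "\<eta> \<in> carrier_mat d p" for \<eta>
    unfolding f[OF \<eta>] by (rule deriv0_eq) (auto intro!: derivative_eq_intros)
  define G where "G = (-1) \<cdot>\<^sub>m (J * A * Y * N)"
  have G: "G \<in> carrier_mat d p" by (intro carrier_matI) (simp_all add: G_def)
  have mG: "metric_g M G \<eta> = - \<tau> \<eta> Y" if \<eta>: "\<eta> \<in> carrier_mat d p" for \<eta>
  proof -
    have c: "J * A * Y * N \<in> carrier_mat d p" by (intro carrier_matI) simp_all
    have "metric_g M G \<eta> = - metric_g M (J * A * Y * N) \<eta>"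
      unfolding G_def using metric_g_smult_left[OF m(1) c \<eta>, of "-1"] by simp
    also have "metric_g M (J * A * Y * N) \<eta> = metric_g M \<eta> (J * A * Y * N)"
      by (rule metric_g_commute[OF m(1,2) c \<eta>])
    also have "\<dots> = mat_trace (\<eta>\<^sup>T * ((M * J) * (A * (Y * N))))"
      unfolding metric_g_def using \<eta> by (simp add: mat_mult_assoc)
    also have "M * J = 1\<^sub>m d" by (rule mat_mult_left_right_inverse[OF J(1) m(1) J(3)])
    also have "mat_trace (\<eta>\<^sup>T * (1\<^sub>m d * (A * (Y * N)))) = \<tau> \<eta> Y"
      unfolding \<tau>_def using A N Y by simp
    finally show ?thesis .
  qed
  show ?thesis unfolding euclid_grad_def G_def[symmetric]
  proof (rule the_equality)
    show "G \<in> carrier_mat d p \<and> (\<forall>\<eta>\<in>carrier_mat d p. deriv0 (\<lambda>t. f_FDA A N (Y + t \<cdot>\<^sub>m \<eta>)) = metric_g M G \<eta>)"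
      using G mG D by simp
    fix G' assume G': "G' \<in> carrier_mat d p \<and> (\<forall>\<eta>\<in>carrier_mat d p. deriv0 (\<lambda>t. f_FDA A N (Y + t \<cdot>\<^sub>m \<eta>)) = metric_g M G' \<eta>)"
    have X: "G' - G \<in> carrier_mat d p" using G G' by (simp add: minus_carrier_mat)
    have "metric_g M (G' - G) (G' - G) = 0"
      using metric_g_minus_left[OF m(1) conjunct1[OF G'] G X] G' X mG[OF X] D[OF X] by simp
    hence "G' - G = 0\<^sub>m d p" using metric_g_pos(2)[OF M X] by fastforce
    hence "(G' - G) $$ (i,j) = 0" if "i < d" "j < p" for i j using that by simp
    thus "G' = G" using G G' by (intro eq_matI) auto
  qed
qed

text \<open>\<open>J\<close> stands for the inverse of \<open>M\<close>. The assumption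
  \<open>bound\<close> is the quantitative input: z^T B J B z controls z^T B z with a constant that
  depends on no base point, which makes the later Lyapunov equations uniformly coercive.\<close>

locale stiefel_geometry =
  fixes p d :: nat and B M J :: "real mat" and c :: real
  assumes B: "sym_pos_def_mat d B" and M: "sym_pos_def_mat d M"
    and J: "J \<in> carrier_mat d d" "J\<^sup>T = J" "J * M = 1\<^sub>m d" and c: "c > 0"
    and bound: "\<And>z. z \<in> carrier_vec d \<Longrightarrow> c * (z \<bullet> (B *\<^sub>v z)) \<le> (B *\<^sub>v z) \<bullet> (J *\<^sub>v (B *\<^sub>v z))"
begin

lemmas b = spdD[OF B] and m = spdD[OF M]

lemma dims [simp]: "dim_row B = d" "dim_col B = d" "dim_row M = d" "dim_col M = d" "dim_row J = d" "dim_col J = d"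
  using b m J by auto

lemma MJ: "M * J = 1\<^sub>m d"
  by (rule mat_mult_left_right_inverse[OF J(1) m(1) J(3)])

abbreviation "T \<equiv> tangent_space p d B"

lemma tangentD: "\<xi> \<in> T Y \<Longrightarrow> \<xi> \<in> carrier_mat d p"
  "\<xi> \<in> T Y \<Longrightarrow> \<xi>\<^sup>T * B * Y + Y\<^sup>T * B * \<xi> = 0\<^sub>m p p"
  by (auto simp: tangent_space_def)

lemma tangent_diff:
  assumes Y: "Y \<in> carrier_mat d p" and "\<xi> \<in> T Y" "\<eta> \<in> T Y"
  shows "\<xi> - \<eta> \<in> T Y"
proof -
  note x = tangentD[OF assms(2)] and e = tangentD[OF assms(3)]
  have "(\<xi> - \<eta>)\<^sup>T * B * Y + Y\<^sup>T * B * (\<xi> - \<eta>)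
    = (\<xi>\<^sup>T * B * Y - \<eta>\<^sup>T * B * Y) + (Y\<^sup>T * B * \<xi> - Y\<^sup>T * B * \<eta>)"
    using x(1) e(1) Y b(1)
    by (simp add: transpose_minus[of _ d p] minus_mult_distrib_mat[of _ p d _ _ p] minus_mult_distrib_mat[of _ p d _ _ d]
        mult_minus_distrib_mat[of _ p d _ p] mult_minus_distrib_mat[of _ d d _ p])
  also have "\<dots> = (\<xi>\<^sup>T * B * Y + Y\<^sup>T * B * \<xi>) - (\<eta>\<^sup>T * B * Y + Y\<^sup>T * B * \<eta>)"
    using x(1) e(1) Y b(1) by (intro eq_matI) auto
  also have "\<dots> = 0\<^sub>m p p" unfolding x(2) e(2) by (intro eq_matI) auto
  finally show ?thesis using x(1) e(1) by (simp add: tangent_space_def minus_carrier_mat)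
qed

lemma tangent_smult:
  assumes Y: "Y \<in> carrier_mat d p" and "\<xi> \<in> T Y"
  shows "a \<cdot>\<^sub>m \<xi> \<in> T Y"
proof -
  note x = tangentD[OF assms(2)]
  have t: "(a \<cdot>\<^sub>m \<xi>)\<^sup>T = a \<cdot>\<^sub>m \<xi>\<^sup>T" by (rule eq_matI) auto
  have "(a \<cdot>\<^sub>m \<xi>)\<^sup>T * B * Y + Y\<^sup>T * B * (a \<cdot>\<^sub>m \<xi>) = a \<cdot>\<^sub>m (\<xi>\<^sup>T * B * Y + Y\<^sup>T * B * \<xi>)"
    unfolding t using x(1) Y b(1)
    by (simp add: mult_smult_assoc_mat[of _ p d _ p] mult_smult_assoc_mat[of _ p d _ d]
        mult_smult_distrib[of _ p d _ p] mult_smult_distrib[of _ d d _ p] add_smult_distrib_left_mat[of _ p p])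
  thus ?thesis using x by (simp add: tangent_space_def)
qed

text \<open>The difference of the two vectors is itself tangent, so it may be tested against itself
  and has norm zero. Identities between projections can thus be proved from inner products
  alone.\<close>

lemma tangent_eqI:
  assumes Y: "Y \<in> carrier_mat d p" and \<xi>: "\<xi> \<in> T Y" and \<eta>: "\<eta> \<in> T Y"
    and eq: "\<And>\<zeta>. \<zeta> \<in> T Y \<Longrightarrow> metric_g M \<xi> \<zeta> = metric_g M \<eta> \<zeta>"
  shows "\<xi> = \<eta>"
proof -
  have D: "\<xi> - \<eta> \<in> T Y" by (rule tangent_diff[OF Y \<xi> \<eta>])
  note c = tangentD(1)[OF \<xi>] tangentD(1)[OF \<eta>] tangentD(1)[OF D]
  have "metric_g M (\<xi> - \<eta>) (\<xi> - \<eta>) = 0"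
    using eq[OF D] by (simp add: metric_g_minus_left[OF m(1) c])
  hence "\<xi> - \<eta> = 0\<^sub>m d p" using metric_g_pos(2)[OF M c(3)] by fastforce
  hence "(\<xi> - \<eta>) $$ (i,j) = 0" if "i < d" "j < p" for i j using that by simp
  thus ?thesis using c by (intro eq_matI) auto
qed

text \<open>\<open>J\<close> cancels \<open>M\<close>, leaving tr(S A) with A = Y^T B \<eta>, and
  tangency of \<eta> says exactly that A is skew. So the vectors J B Y S with symmetric S are normal
  in the metric of \<open>M\<close>.\<close>

lemma normal_orthogonal:
  assumes Y: "Y \<in> carrier_mat d p" and S: "S \<in> carrier_mat p p" "S\<^sup>T = S" and \<eta>: "\<eta> \<in> T Y"
  shows "metric_g M (J * B * Y * S) \<eta> = 0"
proof -
  note e = tangentD[OF \<eta>]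
  define A where "A = Y\<^sup>T * B * \<eta>"
  have A: "A \<in> carrier_mat p p" using Y b(1) e(1) by (simp add: A_def)
  have "A\<^sup>T = \<eta>\<^sup>T * B * Y" using Y b(1,2) e(1) by (simp add: A_def mat_transpose_mult mat_mult_assoc)
  hence sk: "A\<^sup>T + A = 0\<^sub>m p p" using e(2) by (simp add: A_def)
  have "(J * B * Y * S)\<^sup>T * M * \<eta> = S * (Y\<^sup>T * (B * ((J * M) * \<eta>)))"
    using Y S b(1,2) e(1) J(1,2) m(1) by (simp add: mat_transpose_mult mat_mult_assoc)
  also have "\<dots> = S * A" using Y S(1) b(1) e(1) by (simp add: J(3) A_def mat_mult_assoc)
  finally show ?thesis using mat_trace_sym_skew[OF S A sk] by (simp add: metric_g_def)
qed

text \<open>Subtracting the normal vector J B Y S from Z leaves a tangent vector exactly when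
  \<open>S\<close> solves this Lyapunov equation. The point \<open>Y\<close> ranges over all d by p
  matrices, since the gradient has to be projected off the manifold too.\<close>

lemma tangent_proj_formula:
  assumes Y: "Y \<in> carrier_mat d p" and Z: "Z \<in> carrier_mat d p" and S: "S \<in> carrier_mat p p" "S\<^sup>T = S"
    and eq: "(Y\<^sup>T * B * J * B * Y) * S + S * (Y\<^sup>T * B * J * B * Y) = Y\<^sup>T * B * Z + Z\<^sup>T * B * Y"
  shows "tangent_proj p d B M Y Z = Z - J * B * Y * S" "Z - J * B * Y * S \<in> T Y"
    "\<forall>\<eta> \<in> T Y. metric_g M (Z - (Z - J * B * Y * S)) \<eta> = 0"
proof -
  have [simp]: "dim_row Y = d" "dim_col Y = p" "dim_row S = p" "dim_col S = p" "dim_row Z = d" "dim_col Z = p"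
    using Y S Z by auto
  define V where "V = J * B * Y * S"
  have V: "V \<in> carrier_mat d p" using Y S by (intro carrier_matI) (simp_all add: V_def)
  have VT: "V\<^sup>T * B * Y = S * (Y\<^sup>T * B * J * B * Y)"
    using J(1,2) b(1,2) Y S by (simp add: V_def mat_transpose_mult mat_mult_assoc)
  have VY: "Y\<^sup>T * B * V = (Y\<^sup>T * B * J * B * Y) * S"
    using J(1) b(1) Y S(1) by (simp add: V_def mat_mult_assoc)
  have "(Z - V)\<^sup>T * B * Y + Y\<^sup>T * B * (Z - V) = (Z\<^sup>T * B * Y - V\<^sup>T * B * Y) + (Y\<^sup>T * B * Z - Y\<^sup>T * B * V)"
    using Z V Y b(1)
    by (simp add: transpose_minus[of _ d p] minus_mult_distrib_mat[of _ p d _ _ p] minus_mult_distrib_mat[of _ p d _ _ d]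
        mult_minus_distrib_mat[of _ p d _ p] mult_minus_distrib_mat[of _ d d _ p])
  also have "\<dots> = (Y\<^sup>T * B * Z + Z\<^sup>T * B * Y) - (Y\<^sup>T * B * V + V\<^sup>T * B * Y)"
    using Z V Y b(1) by (intro eq_matI) auto
  also have "\<dots> = 0\<^sub>m p p" unfolding VT VY eq using Y Z b(1) by (intro eq_matI) auto
  finally have T: "Z - V \<in> T Y" using V Z by (simp add: tangent_space_def minus_carrier_mat)
  have ZV: "Z - (Z - V) = V" using Z V by (intro eq_matI) auto
  have orth: "\<forall>\<eta> \<in> T Y. metric_g M (Z - (Z - V)) \<eta> = 0"
    unfolding ZV unfolding V_def using normal_orthogonal[OF Y S] by simp
  show "Z - J * B * Y * S \<in> T Y" using T by (simp add: V_def)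
  show "\<forall>\<eta> \<in> T Y. metric_g M (Z - (Z - J * B * Y * S)) \<eta> = 0" using orth by (simp add: V_def)
  show "tangent_proj p d B M Y Z = Z - J * B * Y * S"
    unfolding V_def[symmetric] tangent_proj_def
  proof (rule the_equality)
    show "Z - V \<in> T Y \<and> (\<forall>\<eta>\<in>T Y. metric_g M (Z - (Z - V)) \<eta> = 0)" using T orth by simp
    fix \<xi> assume x: "\<xi> \<in> T Y \<and> (\<forall>\<eta>\<in>T Y. metric_g M (Z - \<xi>) \<eta> = 0)"
    show "\<xi> = Z - V"
    proof (rule tangent_eqI[OF Y conjunct1[OF x] T])
      fix \<zeta> assume z: "\<zeta> \<in> T Y"
      have "metric_g M (Z - \<xi>) \<zeta> = metric_g M (Z - (Z - V)) \<zeta>" using x orth z by simp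
      thus "metric_g M \<xi> \<zeta> = metric_g M (Z - V) \<zeta>"
        using tangentD(1)[OF conjunct1[OF x]] tangentD(1)[OF T] tangentD(1)[OF z] Z
        by (simp add: metric_g_minus_left[OF m(1), of _ p])
    qed
  qed
qed

text \<open>The Gram matrix, in the metric of \<open>M\<close>, of the columns of J B Y, from which
  the normal vectors J B Y S are formed.\<close>

definition "gramQ Y = Y\<^sup>T * B * J * B * Y"

text \<open>Tangency cancels the term of first order in t, so with Y = W + t \<xi> the matrix Y^T B
  Y equals I + t^2 \<xi>^T B \<xi> and dominates I. Applying \<open>bound\<close> to Y v then gives
  coercivity with the same \<open>c\<close> for all t, however far Y is from the manifold.\<close>

lemma gramQ_bound:
  assumes W: "W \<in> gen_stiefel p d B" and \<xi>: "\<xi> \<in> T W" and v: "v \<in> carrier_vec p"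
  shows "c * (v \<bullet> v) \<le> v \<bullet> (gramQ (W + t \<cdot>\<^sub>m \<xi>) *\<^sub>v v)"
proof -
  note x = tangentD[OF \<xi>]
  have W': "W \<in> carrier_mat d p" "W\<^sup>T * B * W = 1\<^sub>m p" using W by (auto simp: gen_stiefel_def)
  define Y where "Y = W + t \<cdot>\<^sub>m \<xi>"
  have Y: "Y \<in> carrier_mat d p" using W' x by (simp add: Y_def)
  have [simp]: "dim_row Y = d" "dim_col Y = p" "dim_row W = d" "dim_col W = p" "dim_row \<xi> = d" "dim_col \<xi> = p"
     using Y W' x by auto
  have "v \<bullet> v \<le> v \<bullet> ((Y\<^sup>T * B * Y) *\<^sub>v v)"
  proof -
    have Yt: "Y\<^sup>T = W\<^sup>T + t \<cdot>\<^sub>m \<xi>\<^sup>T" unfolding Y_def by (intro eq_matI) auto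
    have "Y\<^sup>T * B * Y = (W\<^sup>T * B * W + t \<cdot>\<^sub>m (\<xi>\<^sup>T * B * W)) + (t \<cdot>\<^sub>m (W\<^sup>T * B * \<xi>) + t \<cdot>\<^sub>m (t \<cdot>\<^sub>m (\<xi>\<^sup>T * B * \<xi>)))"
      unfolding Yt unfolding Y_def using W'(1) x(1) b(1)
      by (simp add: add_mult_distrib_mat[of _ p d _ _ d] add_mult_distrib_mat[of _ p d _ _ p]
          mult_add_distrib_mat[of _ p d _ p] mult_add_distrib_mat[of _ d d _ p]
          mult_smult_assoc_mat[of _ p d _ d] mult_smult_assoc_mat[of _ p d _ p]
          mult_smult_distrib[of _ p d _ p] mult_smult_distrib[of _ d d _ p] add_smult_distrib_left_mat[of _ p p])
    also have "\<dots> = W\<^sup>T * B * W + t \<cdot>\<^sub>m (\<xi>\<^sup>T * B * W + W\<^sup>T * B * \<xi>) + (t * t) \<cdot>\<^sub>m (\<xi>\<^sup>T * B * \<xi>)"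
      using W'(1) x(1) b(1) by (intro eq_matI) (auto simp: algebra_simps)
    also have "\<dots> = 1\<^sub>m p + (t * t) \<cdot>\<^sub>m (\<xi>\<^sup>T * B * \<xi>)"
      unfolding W'(2) x(2) using x(1) b(1) by (intro eq_matI) auto
    finally have eq: "Y\<^sup>T * B * Y = 1\<^sub>m p + (t * t) \<cdot>\<^sub>m (\<xi>\<^sup>T * B * \<xi>)" .
    have cX: "\<xi>\<^sup>T * B * \<xi> \<in> carrier_mat p p" using x(1) b(1) by simp
    have sv: "((t * t) \<cdot>\<^sub>m X) *\<^sub>v v = (t * t) \<cdot>\<^sub>v (X *\<^sub>v v)" if "X \<in> carrier_mat p p" for X
      using that v by (intro eq_vecI) (auto simp: scalar_prod_def sum_distrib_left mult.assoc)
    have "v \<bullet> ((Y\<^sup>T * B * Y) *\<^sub>v v) = v \<bullet> (1\<^sub>m p *\<^sub>v v + (t * t) \<cdot>\<^sub>v ((\<xi>\<^sup>T * B * \<xi>) *\<^sub>v v))"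
      unfolding eq sv[OF cX, symmetric] using cX v
      by (subst add_mult_distrib_mat_vec[of _ p p]) auto
    also have "\<dots> = v \<bullet> v + (t * t) * (v \<bullet> ((\<xi>\<^sup>T * B * \<xi>) *\<^sub>v v))"
    proof -
      have "(\<xi>\<^sup>T * B * \<xi>) *\<^sub>v v \<in> carrier_vec p" using cX v by (rule mult_mat_vec_carrier)
      thus ?thesis using v by (simp add: scalar_prod_add_distrib[of _ p])
    qed
    also have "v \<bullet> ((\<xi>\<^sup>T * B * \<xi>) *\<^sub>v v) = (\<xi> *\<^sub>v v) \<bullet> (B *\<^sub>v (\<xi> *\<^sub>v v))"
      by (rule quad_congruence[OF b(1) x(1) v v])
    finally show ?thesis using b(6)[OF mult_mat_vec_carrier[OF x(1) v]] by simp
  qed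
  also have "\<dots> = (Y *\<^sub>v v) \<bullet> (B *\<^sub>v (Y *\<^sub>v v))" by (rule quad_congruence[OF b(1) Y v v])
  finally have "c * (v \<bullet> v) \<le> c * ((Y *\<^sub>v v) \<bullet> (B *\<^sub>v (Y *\<^sub>v v)))" using c by simp
  also have "\<dots> \<le> (B *\<^sub>v (Y *\<^sub>v v)) \<bullet> (J *\<^sub>v (B *\<^sub>v (Y *\<^sub>v v)))"
    by (rule bound[OF mult_mat_vec_carrier[OF Y v]])
  also have "\<dots> = ((B * Y) *\<^sub>v v) \<bullet> (J *\<^sub>v ((B * Y) *\<^sub>v v))"
    using v by (simp add: mat_vec_assoc)
  also have "\<dots> = v \<bullet> (((B * Y)\<^sup>T * J * (B * Y)) *\<^sub>v v)"
    using b(1) Y by (intro quad_congruence[OF J(1) _ v v, symmetric]) simp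
  also have "(B * Y)\<^sup>T * J * (B * Y) = gramQ Y"
    using b(1,2) Y J(1) by (simp add: gramQ_def mat_transpose_mult mat_mult_assoc)
  finally show ?thesis by (simp add: Y_def)
qed

lemma gramQ_spd:
  assumes W: "W \<in> gen_stiefel p d B" and \<xi>: "\<xi> \<in> T W"
  shows "sym_pos_def_mat p (gramQ (W + t \<cdot>\<^sub>m \<xi>))"
  unfolding sym_pos_def_mat_def
proof (intro conjI ballI impI)
  have Y: "W + t \<cdot>\<^sub>m \<xi> \<in> carrier_mat d p" using W tangentD(1)[OF \<xi>] by (auto simp: gen_stiefel_def)
  show "gramQ (W + t \<cdot>\<^sub>m \<xi>) \<in> carrier_mat p p" using Y tangentD(1)[OF \<xi>] by (intro carrier_matI) (simp_all add: gramQ_def)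
  show "(gramQ (W + t \<cdot>\<^sub>m \<xi>))\<^sup>T = gramQ (W + t \<cdot>\<^sub>m \<xi>)"
    unfolding gramQ_def using Y tangentD(1)[OF \<xi>] b(1,2) J(1,2) by (simp add: mat_transpose_mult mat_mult_assoc)
  fix v :: "real vec" assume v: "v \<in> carrier_vec p" "v \<noteq> 0\<^sub>v p"
  have "0 < c * (v \<bullet> v)" using c scalar_prod_self_pos[OF v] by simp
  thus "v \<bullet> (gramQ (W + t \<cdot>\<^sub>m \<xi>) *\<^sub>v v) > 0" using gramQ_bound[OF W \<xi> v(1), of t] by linarith
qed

lemma zero_tangent: "Y \<in> carrier_mat d p \<Longrightarrow> 0\<^sub>m d p \<in> T Y"
  using b(1) by (auto simp: tangent_space_def)

lemma tangent_proj_ex: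
  fixes t :: real
  assumes W: "W \<in> gen_stiefel p d B" and \<xi>: "\<xi> \<in> T W" and Z: "Z \<in> carrier_mat d p"
  defines "Y \<equiv> W + t \<cdot>\<^sub>m \<xi>"
  shows "\<exists>S\<in>carrier_mat p p. S\<^sup>T = S \<and> gramQ Y * S + S * gramQ Y = Y\<^sup>T * B * Z + Z\<^sup>T * B * Y"
proof (rule lyapunov_solvable)
  have Y: "Y \<in> carrier_mat d p" using W tangentD(1)[OF \<xi>] by (auto simp: gen_stiefel_def Y_def)
  show "sym_pos_def_mat p (gramQ Y)" unfolding Y_def by (rule gramQ_spd[OF W \<xi>])
  show "Y\<^sup>T * B * Z + Z\<^sup>T * B * Y \<in> carrier_mat p p" using Y Z b(1) by simp
  have "(Y\<^sup>T * B * Z)\<^sup>T = Z\<^sup>T * B * Y" "(Z\<^sup>T * B * Y)\<^sup>T = Y\<^sup>T * B * Z"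
    using Y Z b(1,2) by (simp_all add: mat_transpose_mult mat_mult_assoc)
  thus "(Y\<^sup>T * B * Z + Z\<^sup>T * B * Y)\<^sup>T = Y\<^sup>T * B * Z + Z\<^sup>T * B * Y"
    using Y Z b(1) by (simp add: transpose_add[of _ p p] comm_add_mat[of _ p p])
qed

text \<open>The projection is Z - J B Y S with a Lyapunov solution S. Solutions may be picked
  independently for each t: uniform coercivity of the Gram matrices forces their continuity at
  0.\<close>

lemma tangent_proj_tends:
  assumes W: "W \<in> gen_stiefel p d B" and \<xi>: "\<xi> \<in> T W" and Z: "Z \<in> carrier_mat d p"
  shows "mat_tends d p (\<lambda>t. tangent_proj p d B M (W + t \<cdot>\<^sub>m \<xi>) Z) (tangent_proj p d B M W Z)"
proof -
  have W': "W \<in> carrier_mat d p" using W by (simp add: gen_stiefel_def)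
  note x = tangentD(1)[OF \<xi>]
  define Y where "Y = (\<lambda>t. W + t \<cdot>\<^sub>m \<xi>)"
  have Y0: "Y 0 = W" using W' x by (auto simp: Y_def intro!: eq_matI)
  have Yc: "Y t \<in> carrier_mat d p" for t using W' x by (simp add: Y_def)
  have YW: "mat_tends d p Y (Y 0)" unfolding Y0 unfolding Y_def by (rule mat_tends_line[OF W' x])
  define R where "R = (\<lambda>t. (Y t)\<^sup>T * B * Z + Z\<^sup>T * B * Y t)"
  define Q where "Q = (\<lambda>t. gramQ (Y t))"
  have cZ: "Z\<^sup>T * B \<in> carrier_mat p d" using Z b(1) by simp
  have R: "mat_tends p p R (R 0)"
    unfolding R_def
    by (intro mat_tends_add mat_tends_mult[OF mat_tends_mult[OF mat_tends_transpose[OF YW] mat_tends_const[OF b(1)]] mat_tends_const[OF Z]]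
        mat_tends_mult[OF mat_tends_const[OF cZ] YW])
  have Q: "mat_tends p p Q (Q 0)"
    unfolding Q_def gramQ_def
    by (intro mat_tends_mult[OF mat_tends_mult[OF mat_tends_mult[OF mat_tends_mult[OF mat_tends_transpose[OF YW]
      mat_tends_const[OF b(1)]] mat_tends_const[OF J(1)]] mat_tends_const[OF b(1)]] YW])
  have "\<forall>t. \<exists>S. S \<in> carrier_mat p p \<and> S\<^sup>T = S \<and> Q t * S + S * Q t = R t"
    using tangent_proj_ex[OF W \<xi> Z] unfolding Q_def R_def Y_def by blast
  then obtain S where S: "\<And>t. S t \<in> carrier_mat p p" "\<And>t. (S t)\<^sup>T = S t" "\<And>t. Q t * S t + S t * Q t = R t"
    by metis
  have St: "mat_tends p p S (S 0)"
    by (rule lyapunov_solution_tends[OF Q R c _ S]) (use gramQ_bound[OF W \<xi>] in \<open>auto simp: Q_def Y_def\<close>)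
  have P: "tangent_proj p d B M (Y t) Z = Z - J * B * Y t * S t" for t
    using tangent_proj_formula(1)[OF Yc Z S(1,2)] S(3)[of t] by (simp add: Q_def R_def gramQ_def)
  have cJ: "J * B \<in> carrier_mat d d" using J(1) b(1) by simp
  have "mat_tends d p (\<lambda>t. Z - J * B * Y t * S t) (Z - J * B * Y 0 * S 0)"
    by (intro mat_tends_diff[OF mat_tends_const[OF Z]] mat_tends_mult[OF mat_tends_mult[OF mat_tends_const[OF cJ] YW] St])
  hence "mat_tends d p (\<lambda>t. tangent_proj p d B M (Y t) Z) (tangent_proj p d B M (Y 0) Z)" by (simp only: P)
  thus ?thesis unfolding Y0 unfolding Y_def .
qed

text \<open>These two properties determine the projection; from here on they replace the explicit
  formula with its Lyapunov solution.\<close>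

lemma tangent_proj_char:
  fixes t :: real
  assumes W: "W \<in> gen_stiefel p d B" and \<xi>: "\<xi> \<in> T W" and Z: "Z \<in> carrier_mat d p"
  defines "Y \<equiv> W + t \<cdot>\<^sub>m \<xi>"
  shows "tangent_proj p d B M Y Z \<in> T Y"
    "\<eta> \<in> T Y \<Longrightarrow> metric_g M (tangent_proj p d B M Y Z) \<eta> = metric_g M Z \<eta>"
proof -
  have Y: "Y \<in> carrier_mat d p" using W tangentD(1)[OF \<xi>] by (auto simp: gen_stiefel_def Y_def)
  obtain S where S: "S \<in> carrier_mat p p" "S\<^sup>T = S" "gramQ Y * S + S * gramQ Y = Y\<^sup>T * B * Z + Z\<^sup>T * B * Y"
    using tangent_proj_ex[OF W \<xi> Z] unfolding Y_def by blast
  note f = tangent_proj_formula[OF Y Z S(1,2) S(3)[unfolded gramQ_def]]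
  show T: "tangent_proj p d B M Y Z \<in> T Y" unfolding f(1) by (rule f(2))
  assume e: "\<eta> \<in> T Y"
  have "metric_g M (Z - tangent_proj p d B M Y Z) \<eta> = 0" using f(3) e unfolding f(1) by blast
  thus "metric_g M (tangent_proj p d B M Y Z) \<eta> = metric_g M Z \<eta>"
    using metric_g_minus_left[OF m(1) Z tangentD(1)[OF T] tangentD(1)[OF e]] by simp
qed

text \<open>At a critical point \<open>W\<close> (where \<open>A W N = B W S\<close>), the normal component cancels from the
  gradient field along the line \<open>W + t \<xi>\<close>, so the gradient is \<open>t\<close> times a projection and
  only continuity of the projection is needed to differentiate it at \<open>t = 0\<close>.\<close>

lemma riem_hess_critical:
  assumes W: "W \<in> gen_stiefel p d B" and \<xi>: "\<xi> \<in> T W"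
    and A: "A \<in> carrier_mat d d" "A\<^sup>T = A" and N: "N \<in> carrier_mat p p" "N\<^sup>T = N"
    and S: "S \<in> carrier_mat p p" "S\<^sup>T = S" and crit: "A * W * N = B * W * S"
  shows "riem_hess p d B M (f_FDA A N) W \<xi> = tangent_proj p d B M W (J * (B * \<xi> * S - A * \<xi> * N))"
proof -
  define K where "K = J * (B * \<xi> * S - A * \<xi> * N)"
  have W': "W \<in> carrier_mat d p" using W by (simp add: gen_stiefel_def)
  note x = tangentD(1)[OF \<xi>]
  have K: "K \<in> carrier_mat d p" using J(1) b(1) x S A N by (auto simp: K_def minus_carrier_mat)
  define Y where "Y = (\<lambda>t. W + t \<cdot>\<^sub>m \<xi>)"
  have Y0: "Y 0 = W" using W' x by (auto simp: Y_def intro!: eq_matI)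
  have Yc: "Y t \<in> carrier_mat d p" for t using W' x by (simp add: Y_def)
  define P where "P = tangent_proj p d B M"
  have PT: "P (Y t) Z \<in> T (Y t)" and Pg: "\<eta> \<in> T (Y t) \<Longrightarrow> metric_g M (P (Y t) Z) \<eta> = metric_g M Z \<eta>"
    if "Z \<in> carrier_mat d p" for Z t \<eta>
    using tangent_proj_char[OF W \<xi> that] by (auto simp: P_def Y_def)
  have grad: "riem_grad p d B M (f_FDA A N) (Y t) = t \<cdot>\<^sub>m P (Y t) K" for t
  proof -
    \<comment> \<open>\<open>V\<close> keeps the multiplier \<open>S\<close> of \<open>W\<close> but
      moves the base point to Y t, so it is normal at Y t and the projection there kills it.
      Criticality cancels the terms of order 0 in t, and the Euclidean gradient becomes t K -
      V.\<close>
    define V where "V = J * B * Y t * S"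
    have V: "V \<in> carrier_mat d p" using Yc[of t] S by (intro carrier_matI) (simp_all add: V_def)
    have E: "euclid_grad p d M (f_FDA A N) (Y t) = t \<cdot>\<^sub>m K - V"
    proof -
      have "euclid_grad p d M (f_FDA A N) (Y t) = (-1) \<cdot>\<^sub>m (J * A * Y t * N)"
        by (rule euclid_grad_f_FDA[OF M J A N Yc])
      also have "J * A * Y t * N = J * (A * W * N) + t \<cdot>\<^sub>m (J * (A * \<xi> * N))"
        unfolding Y_def using J(1) A(1) W' x N(1)
        by (simp add: mult_add_distrib_mat[of _ d d _ p] add_mult_distrib_mat[of _ d p _ _ p] mat_mult_assoc
          mult_smult_assoc_mat[of _ d p _ p] mult_smult_distrib[of _ d d _ p])
      also have "\<dots> = J * (B * W * S) + t \<cdot>\<^sub>m (J * (A * \<xi> * N))" unfolding crit ..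
      finally have 1: "euclid_grad p d M (f_FDA A N) (Y t) = (-1) \<cdot>\<^sub>m (J * (B * W * S) + t \<cdot>\<^sub>m (J * (A * \<xi> * N)))" .
      have 2: "V = J * (B * W * S) + t \<cdot>\<^sub>m (J * (B * \<xi> * S))"
        unfolding V_def Y_def using J(1) b(1) W' x S(1)
        by (simp add: mult_add_distrib_mat[of _ d d _ p] add_mult_distrib_mat[of _ d p _ _ p] mat_mult_assoc
          mult_smult_assoc_mat[of _ d p _ p] mult_smult_distrib[of _ d d _ p])
      have 3: "K = J * (B * \<xi> * S) - J * (A * \<xi> * N)"
        unfolding K_def using J(1) b(1) x S(1) A(1) N(1) by (intro mult_minus_distrib_mat[of _ d d _ p]) auto
      define C1 where "C1 = J * (B * W * S)"
      define C2 where "C2 = J * (A * \<xi> * N)"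
      define C3 where "C3 = J * (B * \<xi> * S)"
      have "C1 \<in> carrier_mat d p" "C2 \<in> carrier_mat d p" "C3 \<in> carrier_mat d p"
        unfolding C1_def C2_def C3_def using J(1) b(1) x S(1) A(1) N(1) W' by auto
      thus ?thesis unfolding 1 2 3 C1_def[symmetric] C2_def[symmetric] C3_def[symmetric]
        by (intro eq_matI) (auto simp: algebra_simps)
    qed
    have c: "t \<cdot>\<^sub>m K - V \<in> carrier_mat d p" using K V by (simp add: minus_carrier_mat)
    have "P (Y t) (t \<cdot>\<^sub>m K - V) = t \<cdot>\<^sub>m P (Y t) K"
    proof (rule tangent_eqI[OF Yc PT[OF c] tangent_smult[OF Yc PT[OF K]]])
      fix \<zeta> assume z: "\<zeta> \<in> T (Y t)"
      note z' = tangentD(1)[OF z]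
      have "metric_g M (P (Y t) (t \<cdot>\<^sub>m K - V)) \<zeta> = t * metric_g M K \<zeta> - metric_g M V \<zeta>"
        using K V z' m(1) Pg[OF c z] by (simp add: metric_g_minus_left[of _ d _ p] metric_g_smult_left[of _ d _ p])
      also have "metric_g M V \<zeta> = 0" unfolding V_def by (rule normal_orthogonal[OF Yc S z])
      also have "metric_g M K \<zeta> = metric_g M (P (Y t) K) \<zeta>" using Pg[OF K z] by simp
      finally show "metric_g M (P (Y t) (t \<cdot>\<^sub>m K - V)) \<zeta> = metric_g M (t \<cdot>\<^sub>m P (Y t) K) \<zeta>"
        using metric_g_smult_left[OF m(1) tangentD(1)[OF PT[OF K]] z'] by simp
    qed
    thus ?thesis unfolding riem_grad_def E P_def .
  qed
  have PW: "P W K \<in> T W" using PT[OF K, of 0] by (simp add: Y0)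
  note PWc = tangentD(1)[OF PW]
  have tends: "mat_tends d p (\<lambda>t. P (Y t) K) (P W K)"
    using tangent_proj_tends[OF W \<xi> K] by (simp add: P_def Y_def)
  have "dir_deriv_mat d p (riem_grad p d B M (f_FDA A N)) W \<xi> = P W K"
  proof (rule eq_matI)
    fix i j assume "i < dim_row (P W K)" "j < dim_col (P W K)"
    hence ij: "i < d" "j < p" using PWc by auto
    have "riem_grad p d B M (f_FDA A N) (W + t \<cdot>\<^sub>m \<xi>) $$ (i,j) = t * P (Y t) K $$ (i,j)" for t
      using grad[of t] ij mat_tendsD(3,4)[OF tends, of t] by (simp add: Y_def)
    hence "deriv0 (\<lambda>t. riem_grad p d B M (f_FDA A N) (W + t \<cdot>\<^sub>m \<xi>) $$ (i,j)) = P W K $$ (i,j)"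
      using deriv0_scaled[OF mat_tendsD(7)[OF tends ij]] by simp
    thus "dir_deriv_mat d p (riem_grad p d B M (f_FDA A N)) W \<xi> $$ (i,j) = P W K $$ (i,j)"
      using ij by (simp add: dir_deriv_mat_def)
  qed (use PWc in \<open>auto simp: dir_deriv_mat_def\<close>)
  \<comment> \<open>The derivative is already tangent, so the outer projection in the Hessian leaves
    it fixed.\<close>
  moreover have "P W (P W K) = P W K"
  proof (rule tangent_eqI[OF W' _ PW])
    show "P W (P W K) \<in> T W" using PT[OF PWc, of 0] by (simp add: Y0)
    show "metric_g M (P W (P W K)) \<zeta> = metric_g M (P W K) \<zeta>" if "\<zeta> \<in> T W" for \<zeta>
      using Pg[OF PWc, of \<zeta> 0] that by (simp add: Y0)
  qed
  ultimately show ?thesis unfolding riem_hess_def by (simp add: P_def K_def)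
qed

text \<open>Pairing with a tangent \<eta> removes the projection, and the factor \<open>J\<close>
  cancels against \<open>M\<close>. What remains on the left is a bilinear form free of
  \<open>M\<close>; the metric survives only on the right-hand side of the eigenvalue
  equation.\<close>

lemma hess_eigenvalues_critical:
  assumes W: "W \<in> gen_stiefel p d B"
    and A: "A \<in> carrier_mat d d" "A\<^sup>T = A" and N: "N \<in> carrier_mat p p" "N\<^sup>T = N"
    and S: "S \<in> carrier_mat p p" "S\<^sup>T = S" and crit: "A * W * N = B * W * S"
  shows "hess_eigenvalues p d B M (f_FDA A N) W = {r. \<exists>\<xi>\<in>T W. \<xi> \<noteq> 0\<^sub>m d p \<and>
    (\<forall>\<eta>\<in>T W. mat_trace (\<eta>\<^sup>T * (B * \<xi> * S - A * \<xi> * N)) = r * metric_g M \<eta> \<xi>)}"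
proof -
  have W': "W \<in> carrier_mat d p" using W by (simp add: gen_stiefel_def)
  have "riem_hess p d B M (f_FDA A N) W \<xi> = r \<cdot>\<^sub>m \<xi> \<longleftrightarrow>
    (\<forall>\<eta>\<in>T W. mat_trace (\<eta>\<^sup>T * (B * \<xi> * S - A * \<xi> * N)) = r * metric_g M \<eta> \<xi>)" if \<xi>: "\<xi> \<in> T W" for \<xi> r
  proof -
    define L where "L = B * \<xi> * S - A * \<xi> * N"
    note x = tangentD(1)[OF \<xi>]
    have L: "L \<in> carrier_mat d p" using b(1) x S A N by (auto simp: L_def minus_carrier_mat)
    have K: "J * L \<in> carrier_mat d p" using J(1) L by simp
    \<comment> \<open>The facts on projections are stated along a line; at the base point they are
      used with t = 0 and direction 0.\<close>
    have W0: "W + 0 \<cdot>\<^sub>m 0\<^sub>m d p = W" using W' by (intro eq_matI) auto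
    have PT: "tangent_proj p d B M W (J * L) \<in> T W"
      and Pg: "\<And>\<eta>. \<eta> \<in> T W \<Longrightarrow> metric_g M (tangent_proj p d B M W (J * L)) \<eta> = metric_g M (J * L) \<eta>"
      using tangent_proj_char[OF W zero_tangent[OF W'] K, where t = 0, unfolded W0] by auto
    have g: "metric_g M (J * L) \<eta> = mat_trace (\<eta>\<^sup>T * L)" if "\<eta> \<in> T W" for \<eta>
    proof -
      note e = tangentD(1)[OF that]
      have "metric_g M (J * L) \<eta> = metric_g M \<eta> (J * L)" by (rule metric_g_commute[OF m(1,2) K e])
      also have "\<dots> = mat_trace (\<eta>\<^sup>T * ((M * J) * L))"
        unfolding metric_g_def using e L by (simp add: mat_mult_assoc)
      finally show ?thesis using L by (simp add: MJ)
    qed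
    have gs: "metric_g M (r \<cdot>\<^sub>m \<xi>) \<eta> = r * metric_g M \<eta> \<xi>" if "\<eta> \<in> T W" for \<eta>
      using metric_g_smult_left[OF m(1) x tangentD(1)[OF that], of r]
        metric_g_commute[OF m(1,2) x tangentD(1)[OF that]] by simp
    have "tangent_proj p d B M W (J * L) = r \<cdot>\<^sub>m \<xi> \<longleftrightarrow>
      (\<forall>\<eta>\<in>T W. metric_g M (tangent_proj p d B M W (J * L)) \<eta> = metric_g M (r \<cdot>\<^sub>m \<xi>) \<eta>)"
      using tangent_eqI[OF W' PT tangent_smult[OF W' \<xi>]] by auto
    also have "\<dots> \<longleftrightarrow> (\<forall>\<eta>\<in>T W. mat_trace (\<eta>\<^sup>T * L) = r * metric_g M \<eta> \<xi>)"
      using Pg g gs by simp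
    finally show ?thesis unfolding riem_hess_critical[OF W \<xi> A N S crit] L_def .
  qed
  thus ?thesis unfolding hess_eigenvalues_def by blast
qed

end

section \<open>The Hessian form in an eigenframe\<close>

text \<open>Indices start at 0: \<open>r k\<close> and \<open>\<mu> k\<close> stand for \<rho>_{k+1}
  and \<mu>_{k+1} of the statement. Eigenvalues of index at least \<open>p\<close> may coincide
  among themselves, but each of the first p exceeds all later ones strictly.\<close>

locale fda_weights =
  fixes p d :: nat and r \<mu> :: "nat \<Rightarrow> real"
  assumes p_pos: "0 < p" and p_less: "p < d"
    and r_anti: "\<And>a b. a \<le> b \<Longrightarrow> b < d \<Longrightarrow> r b \<le> r a"
    and r_strict: "\<And>j a. j < p \<Longrightarrow> j < a \<Longrightarrow> a < d \<Longrightarrow> r a < r j"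
    and \<mu>_strict: "\<And>j k. j < k \<Longrightarrow> k < p \<Longrightarrow> \<mu> k < \<mu> j"
    and \<mu>_pos: "\<And>j. j < p \<Longrightarrow> 0 < \<mu> j"
begin

text \<open>The pair \<open>\<alpha>, \<beta>\<close> below is a feasible solution of the linear program dual to the assignment
  problem \<open>max \<Sum> r\<^sub>a \<mu>\<^sub>j w\<^sub>a\<^sub>j\<close>; averaging neighbouring weights \<open>\<mu>\<close> makes every off-diagonal constraint
  strict, so complementary slackness forces an optimal \<open>w\<close> to be diagonal.\<close>

lemma assignment_optimum:
  assumes w: "\<And>a j. a < d \<Longrightarrow> j < p \<Longrightarrow> 0 \<le> w a j"
    and cols: "\<And>j. j < p \<Longrightarrow> (\<Sum>a<d. w a j) = 1"
    and rows: "\<And>a. a < d \<Longrightarrow> (\<Sum>j<p. w a j) \<le> 1"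
    and opt: "(\<Sum>j<p. r j * \<mu> j) \<le> (\<Sum>a<d. \<Sum>j<p. r a * \<mu> j * w a j)"
    and a: "a < d" and j: "j < p" and aj: "a \<noteq> j"
  shows "w a j = 0"
proof (rule ccontr)
  assume "w a j \<noteq> 0"
  hence pos: "w a j > 0" using w[OF a j] by simp
  \<comment> \<open>The weights are continued by 0 past the last one, so the last midpoint
    \<open>h (p - 1)\<close> is half of \<open>\<mu> (p - 1)\<close>.\<close>
  define m where "m k = (if k < p then \<mu> k else 0)" for k
  have m_less: "m k < m i" if "i < k" "k \<le> p" for i k using that \<mu>_strict \<mu>_pos by (auto simp: m_def)
  have m_le: "m k \<le> m i" if "i \<le> k" "k \<le> p" for i k using m_less[of i k] that by (cases "i = k") auto
  have m_nonneg: "0 \<le> m k" for k using \<mu>_pos[of k] by (auto simp: m_def)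
  define h where "h k = (m k + m (Suc k)) / 2" for k
  \<comment> \<open>\<open>\<alpha>\<close> vanishes from index p on, so rows without a matched
    column carry no price. \<open>\<beta>\<close> is then fixed by equality on the diagonal.\<close>
  define \<alpha> where "\<alpha> i = (\<Sum>k\<in>{i..<p}. h k * (r k - r (Suc k)))" for i
  define \<beta> where "\<beta> i = r i * \<mu> i - \<alpha> i" for i
  have rstep: "r (Suc k) < r k" if "k < p" for k using r_strict[of k "Suc k"] that p_less by simp
  have tele: "(\<Sum>k\<in>{i..<b}. r k - r (Suc k)) = r i - r b" if "i \<le> b" for i b
    using sum_Suc_diff'[OF that, of "\<lambda>k. - r k"] by (simp add: sum_negf)
  have \<alpha>_nonneg: "0 \<le> \<alpha> i" for i unfolding \<alpha>_def
    by (intro sum_nonneg mult_nonneg_nonneg) (use m_nonneg rstep in \<open>auto simp: h_def less_imp_le\<close>)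
  have \<alpha>_split: "\<alpha> i = (\<Sum>k\<in>{i..<b}. h k * (r k - r (Suc k))) + \<alpha> b" if "i \<le> b" "b \<le> p" for i b
    unfolding \<alpha>_def by (simp add: sum.atLeastLessThan_concat[OF that])
  \<comment> \<open>Every midpoint \<open>h k\<close> between the two indices lies strictly above
    \<open>\<mu> j\<close> if a < j and strictly below it if j < a, so both cases compare
    telescoping sums of gaps of \<open>r\<close>.\<close>
  have strict: "r a * \<mu> j < \<alpha> a + \<beta> j" if a: "a < d" and j: "j < p" and aj: "a \<noteq> j" for a j
  proof (cases "a < j")
    case True
    have "\<mu> j * (r a - r j) = (\<Sum>k\<in>{a..<j}. \<mu> j * (r k - r (Suc k)))"
      by (simp only: tele[OF less_imp_le[OF True], symmetric] sum_distrib_left)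
    also have "\<dots> < (\<Sum>k\<in>{a..<j}. h k * (r k - r (Suc k)))"
    proof (rule sum_strict_mono)
      fix k assume k: "k \<in> {a..<j}"
      have "m j < m k" "m j \<le> m (Suc k)" using k j m_less[of k j] m_le[of "Suc k" j] by auto
      hence "\<mu> j < h k" using j by (simp add: h_def m_def[of j])
      thus "\<mu> j * (r k - r (Suc k)) < h k * (r k - r (Suc k))"
        using rstep[of k] k j by (intro mult_strict_right_mono) auto
    qed (use True in auto)
    also have "\<dots> = \<alpha> a - \<alpha> j" using \<alpha>_split[of a j] True j by simp
    finally show ?thesis by (simp add: \<beta>_def algebra_simps)
  next
    case False
    \<comment> \<open>Past index p the potential \<open>\<alpha>\<close> is flat, so the sum is cut
      at p; monotonicity of \<open>r\<close> from b to a covers the rest.\<close>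
    define b where "b = min a p"
    have b: "j < b" "b \<le> p" "b \<le> a" using False aj j by (auto simp: b_def)
    have \<alpha>b: "\<alpha> a = \<alpha> b" by (cases "a \<le> p") (auto simp: b_def \<alpha>_def)
    have "\<alpha> j - \<alpha> a = (\<Sum>k\<in>{j..<b}. h k * (r k - r (Suc k)))"
      using \<alpha>_split[of j b] b \<alpha>b by simp
    also have "\<dots> < (\<Sum>k\<in>{j..<b}. \<mu> j * (r k - r (Suc k)))"
    proof (rule sum_strict_mono)
      fix k assume k: "k \<in> {j..<b}"
      have "m k \<le> m j" "m (Suc k) < m j" using k b m_less[of j "Suc k"] m_le[of j k] by auto
      hence "h k < \<mu> j" using j by (simp add: h_def m_def[of j])
      thus "h k * (r k - r (Suc k)) < \<mu> j * (r k - r (Suc k))"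
        using rstep[of k] k b by (intro mult_strict_right_mono) auto
    qed (use b in auto)
    also have "\<dots> = \<mu> j * (r j - r b)" using tele[of j b] b by (simp add: sum_distrib_left[symmetric])
    also have "\<dots> \<le> \<mu> j * (r j - r a)" using r_anti[OF b(3) a] \<mu>_pos[OF j] by (intro mult_left_mono) auto
    finally show ?thesis by (simp add: \<beta>_def algebra_simps)
  qed
  have le: "r a * \<mu> j * w a j \<le> (\<alpha> a + \<beta> j) * w a j" if "a < d" "j < p" for a j
  proof (cases "a = j")
    case True thus ?thesis by (simp add: \<beta>_def)
  next
    case False thus ?thesis using strict[OF that False] w[OF that] by (intro mult_right_mono) auto
  qed
  have "(\<Sum>a<d. \<Sum>j<p. r a * \<mu> j * w a j) < (\<Sum>a<d. \<Sum>j<p. (\<alpha> a + \<beta> j) * w a j)"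
  proof (rule sum_strict_mono_ex1)
    show "\<forall>x\<in>{..<d}. (\<Sum>j<p. r x * \<mu> j * w x j) \<le> (\<Sum>j<p. (\<alpha> x + \<beta> j) * w x j)"
      using le by (auto intro!: sum_mono)
    have "(\<Sum>j<p. r a * \<mu> j * w a j) < (\<Sum>j<p. (\<alpha> a + \<beta> j) * w a j)"
    proof (rule sum_strict_mono_ex1)
      show "\<exists>j\<in>{..<p}. r a * \<mu> j * w a j < (\<alpha> a + \<beta> j) * w a j"
        using strict[OF a j aj] pos j by (intro bexI[of _ j] mult_strict_right_mono) auto
    qed (use le[OF a] in auto)
    thus "\<exists>x\<in>{..<d}. (\<Sum>j<p. r x * \<mu> j * w x j) < (\<Sum>j<p. (\<alpha> x + \<beta> j) * w x j)" using a by blast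
  qed simp
  also have "\<dots> = (\<Sum>a<d. \<alpha> a * (\<Sum>j<p. w a j)) + (\<Sum>a<d. \<Sum>j<p. \<beta> j * w a j)"
    by (simp add: distrib_right sum.distrib sum_distrib_left)
  also have "(\<Sum>a<d. \<Sum>j<p. \<beta> j * w a j) = (\<Sum>j<p. \<beta> j * (\<Sum>a<d. w a j))"
    by (subst sum.swap) (simp add: sum_distrib_left)
  also have "\<dots> = (\<Sum>j<p. \<beta> j)" using cols by simp
  also have "(\<Sum>a<d. \<alpha> a * (\<Sum>j<p. w a j)) \<le> (\<Sum>a<d. \<alpha> a)"
    using rows \<alpha>_nonneg by (intro sum_mono mult_left_le) auto
  also have "(\<Sum>a<d. \<alpha> a) = (\<Sum>a<p. \<alpha> a)"
    by (rule sum.mono_neutral_right) (use p_less in \<open>auto simp: \<alpha>_def\<close>)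
  also have "(\<Sum>a<p. \<alpha> a) + (\<Sum>j<p. \<beta> j) = (\<Sum>j<p. r j * \<mu> j)"
    by (simp add: sum.distrib[symmetric] \<beta>_def)
  finally show False using opt by simp
qed

text \<open>Tangent vectors at the minimizer in frame coordinates: the top p by p block is skew and
  the d - p rows below it are free.\<close>

definition skew_top :: "(nat \<Rightarrow> nat \<Rightarrow> real) \<Rightarrow> bool" where
  "skew_top X \<longleftrightarrow> (\<forall>a<p. \<forall>j<p. X a j = - X j a)"

text \<open>The Hessian form at the minimizer in frame coordinates, with one weight per entry before
  mirrored entries are merged.\<close>

definition hform :: "(nat \<Rightarrow> nat \<Rightarrow> real) \<Rightarrow> (nat \<Rightarrow> nat \<Rightarrow> real) \<Rightarrow> real" where
  "hform Y X = (\<Sum>a<d. \<Sum>j<p. (r j - r a) * \<mu> j * Y a j * X a j)"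

definition \<omega> :: "nat \<Rightarrow> nat \<Rightarrow> real" where
  "\<omega> a j = (if a < p then (1/2) * (\<mu> j - \<mu> a) * (r j - r a) else \<mu> j * (r j - r a))"

text \<open>Skewness makes the product Y_aj X_aj symmetric in a and j within the top block. The
  weights (r_j - r_a) \<mu>_j and (r_a - r_j) \<mu>_a of two mirrored entries may therefore be
  replaced by their mean, while the free rows keep their weights.\<close>

lemma hform_\<omega>:
  assumes "skew_top X" "skew_top Y"
  shows "hform Y X = (\<Sum>a<d. \<Sum>j<p. \<omega> a j * (Y a j * X a j))"
proof -
  have sym: "Y a j * X a j = Y j a * X j a" if "a < p" "j < p" for a j
    using assms that unfolding skew_top_def by (metis minus_mult_minus)
  have sp: "(\<Sum>a<d. g a) = (\<Sum>a<p. g a) + (\<Sum>a\<in>{p..<d}. g a)" for g :: "nat \<Rightarrow> real"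
    using sum.atLeastLessThan_concat[of 0 p d g] p_less by (simp add: lessThan_atLeast0)
  let ?S = "\<Sum>a<p. \<Sum>j<p. (r j - r a) * \<mu> j * (Y a j * X a j)"
  let ?S' = "\<Sum>a<p. \<Sum>j<p. (r a - r j) * \<mu> a * (Y a j * X a j)"
  have "?S = (\<Sum>j<p. \<Sum>a<p. (r j - r a) * \<mu> j * (Y a j * X a j))" by (rule sum.swap)
  also have "\<dots> = ?S'" by (intro sum.cong refl) (simp add: sym)
  finally have "?S = (?S + ?S') / 2" by simp
  also have "\<dots> = (\<Sum>a<p. \<Sum>j<p. \<omega> a j * (Y a j * X a j))"
    by (simp add: sum.distrib[symmetric] sum_divide_distrib \<omega>_def)
      (intro sum.cong refl, simp add: field_simps)
  finally have 1: "?S = (\<Sum>a<p. \<Sum>j<p. \<omega> a j * (Y a j * X a j))" .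
  have 2: "(\<Sum>a\<in>{p..<d}. \<Sum>j<p. (r j - r a) * \<mu> j * (Y a j * X a j))
    = (\<Sum>a\<in>{p..<d}. \<Sum>j<p. \<omega> a j * (Y a j * X a j))"
    by (intro sum.cong refl) (auto simp: \<omega>_def)
  show ?thesis unfolding hform_def sp mult.assoc using 1 2 by (simp add: mult.assoc)
qed

definition \<omega>max :: real where "\<omega>max = \<mu> 0 * (r 0 - r (d - 1))"

definition \<omega>min :: real where
  "\<omega>min = Min ({\<mu> (p - 1) * (r (p - 1) - r p)} \<union> {(1/2) * (\<mu> j - \<mu> (j + 1)) * (r j - r (j + 1)) | j. j + 1 < p})"

lemma \<omega>min_set: "finite ({\<mu> (p - 1) * (r (p - 1) - r p)} \<union> {(1/2) * (\<mu> j - \<mu> (j + 1)) * (r j - r (j + 1)) | j. j + 1 < p})"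
proof -
  have "{(1/2) * (\<mu> j - \<mu> (j + 1)) * (r j - r (j + 1)) | j. j + 1 < p}
    = (\<lambda>j. (1/2) * (\<mu> j - \<mu> (j + 1)) * (r j - r (j + 1))) ` {j. j + 1 < p}" by blast
  moreover have "finite {j. j + 1 < p}" by (rule finite_subset[of _ "{..<p}"]) auto
  ultimately show ?thesis by simp
qed

lemma \<omega>min_le: "\<omega>min \<le> \<mu> (p - 1) * (r (p - 1) - r p)"
  "j + 1 < p \<Longrightarrow> \<omega>min \<le> (1/2) * (\<mu> j - \<mu> (j + 1)) * (r j - r (j + 1))"
  unfolding \<omega>min_def by (rule Min_le[OF \<omega>min_set], blast)+

lemma \<mu>_le: "j \<le> k \<Longrightarrow> k < p \<Longrightarrow> \<mu> k \<le> \<mu> j"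
  using \<mu>_strict[of j k] by (cases "j = k") auto

lemma \<omega>_sym: "a < p \<Longrightarrow> j < p \<Longrightarrow> \<omega> a j = \<omega> j a"
  by (simp add: \<omega>_def algebra_simps)

text \<open>The gaps grow as the indices a and j move apart, so the least weights occur at
  neighbours: (j+1, j) within the top block and (p, p-1) among the free rows. The two factors of
  \<open>\<omega>max\<close> dominate the corresponding factors of every weight.\<close>

lemma \<omega>_bounds_lower_triangle:
  assumes a: "a < d" and j: "j < p" and ja: "j < a"
  shows "\<omega>min \<le> \<omega> a j \<and> \<omega> a j \<le> \<omega>max"
proof -
  have rd: "r (d - 1) \<le> r a" by (rule r_anti) (use a in auto)
  show ?thesis
  proof (cases "a < p")
    case True
    have "\<omega>min \<le> (1/2) * (\<mu> j - \<mu> (j + 1)) * (r j - r (j + 1))" using True ja by (intro \<omega>min_le) auto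
    also have "\<dots> \<le> (1/2) * (\<mu> j - \<mu> a) * (r j - r a)"
      using \<mu>_le[of "j + 1" a] \<mu>_le[of j a] \<mu>_le[of j "j + 1"] r_anti[of "j + 1" a] r_anti[of j "j + 1"] True ja a
      by (intro mult_mono) auto
    finally have 1: "\<omega>min \<le> \<omega> a j" using True by (simp add: \<omega>_def)
    have "(1/2) * (\<mu> j - \<mu> a) * (r j - r a) \<le> \<mu> 0 * (r 0 - r (d - 1))"
      using \<mu>_le[of 0 j] \<mu>_pos[OF True] \<mu>_pos[OF j] \<mu>_pos[OF p_pos] r_anti[of 0 j] rd r_anti[of j a] j a ja
      by (intro mult_mono) auto
    thus ?thesis using 1 True by (simp add: \<omega>_def \<omega>max_def)
  next
    case False
    have min: "\<omega>min \<le> \<mu> (p - 1) * (r (p - 1) - r p)" by (rule \<omega>min_le)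
    have "\<mu> (p - 1) \<le> \<mu> j" "r (p - 1) \<le> r j" by (rule \<mu>_le r_anti; use j p_less in force)+
    hence "\<mu> (p - 1) * (r (p - 1) - r p) \<le> \<mu> j * (r j - r a)"
      using \<mu>_pos[OF j] r_anti[of "p - 1" p] r_anti[of p a] j a p_pos p_less False
      by (intro mult_mono) auto
    hence 1: "\<omega>min \<le> \<omega> a j" using min False by (simp add: \<omega>_def)
    have "\<mu> j * (r j - r a) \<le> \<mu> 0 * (r 0 - r (d - 1))"
      using \<mu>_le[of 0 j] \<mu>_pos[OF p_pos] r_anti[of 0 j] rd r_anti[of j a] j a ja p_less
      by (intro mult_mono) auto
    thus ?thesis using 1 False by (simp add: \<omega>_def \<omega>max_def)
  qed
qed

lemma \<omega>_bounds:
  assumes a: "a < d" and j: "j < p" and "a \<noteq> j"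
  shows "\<omega>min \<le> \<omega> a j" "\<omega> a j \<le> \<omega>max"
proof -
  have "\<omega>min \<le> \<omega> a j \<and> \<omega> a j \<le> \<omega>max"
  proof (cases "j < a")
    case False
    hence "\<omega> a j = \<omega> j a" using \<omega>_sym[of a j] assms by simp
    thus ?thesis using \<omega>_bounds_lower_triangle[of j a] assms False p_less by simp
  qed (use \<omega>_bounds_lower_triangle assms in blast)
  thus "\<omega>min \<le> \<omega> a j" "\<omega> a j \<le> \<omega>max" by auto
qed

lemma \<omega>min_pos: "0 < \<omega>min"
proof -
  have "0 < \<mu> (p - 1) * (r (p - 1) - r p)" using \<mu>_pos[of "p - 1"] r_strict[of "p - 1" p] p_pos p_less by simp
  moreover have "0 < (1/2) * (\<mu> j - \<mu> (j + 1)) * (r j - r (j + 1))" if "j + 1 < p" for j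
    using \<mu>_strict[of j "j + 1"] r_strict[of j "j + 1"] that p_less by simp
  ultimately have "\<forall>x\<in>{\<mu> (p - 1) * (r (p - 1) - r p)} \<union> {(1/2) * (\<mu> j - \<mu> (j + 1)) * (r j - r (j + 1)) | j. j + 1 < p}. 0 < x"
    by blast
  thus ?thesis unfolding \<omega>min_def by (subst Min_gr_iff[OF \<omega>min_set]) auto
qed

lemma \<omega>min_attained: "\<exists>a<d. \<exists>j<p. j < a \<and> \<omega> a j = \<omega>min"
proof -
  have "\<omega>min \<in> {\<mu> (p - 1) * (r (p - 1) - r p)} \<union> {(1/2) * (\<mu> j - \<mu> (j + 1)) * (r j - r (j + 1)) | j. j + 1 < p}"
    unfolding \<omega>min_def by (rule Min_in[OF \<omega>min_set]) simp
  thus ?thesis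
  proof
    assume "\<omega>min \<in> {\<mu> (p - 1) * (r (p - 1) - r p)}"
    hence "\<omega> p (p - 1) = \<omega>min" by (simp add: \<omega>_def)
    thus ?thesis using p_pos p_less by (intro exI[of _ p] exI[of _ "p - 1"] conjI) auto
  next
    assume "\<omega>min \<in> {(1/2) * (\<mu> j - \<mu> (j + 1)) * (r j - r (j + 1)) | j. j + 1 < p}"
    then obtain j where j: "j + 1 < p" "\<omega>min = (1/2) * (\<mu> j - \<mu> (j + 1)) * (r j - r (j + 1))" by blast
    hence "\<omega> (j + 1) j = \<omega>min" by (simp add: \<omega>_def)
    thus ?thesis using j p_less by (intro exI[of _ "j + 1"] conjI exI[of _ j]) auto
  qed
qed

text \<open>Since p < d, the pair (d - 1, 0) lies in the free rows, where the weight has no factor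
  1/2.\<close>

lemma \<omega>max_attained: "\<exists>a<d. \<exists>j<p. j < a \<and> \<omega> a j = \<omega>max"
  using p_pos p_less by (intro exI[of _ "d - 1"] conjI exI[of _ 0]) (auto simp: \<omega>_def \<omega>max_def)

text \<open>The squared norm in the metric of \<open>B\<close>, which is the standard one in a
  B-orthonormal frame.\<close>

definition sqnorm :: "(nat \<Rightarrow> nat \<Rightarrow> real) \<Rightarrow> real" where
  "sqnorm X = (\<Sum>a<d. \<Sum>j<p. X a j * X a j)"

lemma skew_top_diag: "skew_top X \<Longrightarrow> a < p \<Longrightarrow> X a a = 0"
proof -
  assume "skew_top X" "a < p"
  hence "X a a = - X a a" unfolding skew_top_def by blast
  thus "X a a = 0" by simp
qed

lemma hform_bounds:
  assumes X: "skew_top X"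
  shows "\<omega>min * sqnorm X \<le> hform X X" "hform X X \<le> \<omega>max * sqnorm X"
proof -
  note z = skew_top_diag[OF X]
  have "\<omega>min * (X a j * X a j) \<le> \<omega> a j * (X a j * X a j) \<and> \<omega> a j * (X a j * X a j) \<le> \<omega>max * (X a j * X a j)"
    if "a < d" "j < p" for a j
  proof (cases "a = j")
    case False thus ?thesis using \<omega>_bounds[OF that] by (auto intro!: mult_right_mono)
  qed (use z that in simp)
  thus "\<omega>min * sqnorm X \<le> hform X X" "hform X X \<le> \<omega>max * sqnorm X"
    unfolding hform_\<omega>[OF X X] sqnorm_def sum_distrib_left by (auto intro!: sum_mono)
qed

section \<open>A basis of the tangent coordinates and finiteness of the spectrum\<close>

definition strict_lower :: "(nat \<times> nat) set" where "strict_lower = {(a,j). a < d \<and> j < p \<and> j < a}"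

text \<open>Entries strictly below the diagonal are the free parameters. If the row index of the
  pair \<open>i\<close> is less than p, skewness forces the mirrored entry -1; a row from p on has
  no mirror, which is the purpose of the test \<open>l < p\<close>.\<close>

definition skew_basis :: "nat \<times> nat \<Rightarrow> nat \<Rightarrow> nat \<Rightarrow> real" where
  "skew_basis i k l = (if (k,l) = i then 1 else if (l,k) = i \<and> l < p then -1 else 0)"

lemma finite_strict_lower: "finite strict_lower"
  by (rule finite_subset[of _ "{..<d} \<times> {..<p}"]) (auto simp: strict_lower_def)

lemma strict_lower_nonempty: "strict_lower \<noteq> {}"
proof -
  have "(p,0) \<in> strict_lower" using p_pos p_less by (simp add: strict_lower_def)
  thus ?thesis by blast
qed

lemma skew_top_basis: "i \<in> strict_lower \<Longrightarrow> skew_top (skew_basis i)"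
  by (auto simp: skew_top_def skew_basis_def strict_lower_def)

lemma sum_skew_basis:
  assumes "k < d" "l < p"
  shows "(\<Sum>i\<in>strict_lower. c i * skew_basis i k l) = (if l < k then c (k,l) else if k < l then - c (l,k) else 0)"
proof -
  \<comment> \<open>At position (k,l) at most one basis element is nonzero, the one whose pair lists
    the larger index first.\<close>
  have "(\<Sum>i\<in>strict_lower. c i * skew_basis i k l) = (\<Sum>i\<in>strict_lower. if i = (if l < k then (k,l) else (l,k)) then
      (if l < k then c (k,l) else if k < l then - c (l,k) else 0) else 0)"
    using assms by (intro sum.cong) (auto simp: skew_basis_def strict_lower_def)
  also have "\<dots> = (if l < k then c (k,l) else if k < l then - c (l,k) else 0)"
    using assms p_less by (subst sum.delta[OF finite_strict_lower]) (auto simp: strict_lower_def)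
  finally show ?thesis .
qed

definition expand :: "(nat \<times> nat \<Rightarrow> real) \<Rightarrow> nat \<Rightarrow> nat \<Rightarrow> real" where
  "expand c k l = (\<Sum>i\<in>strict_lower. c i * skew_basis i k l)"

lemma skew_top_expand: "skew_top (expand c)"
  unfolding skew_top_def
proof (intro allI impI)
  fix a j assume "a < p" "j < p"
  hence "skew_basis i a j = - skew_basis i j a" if "i \<in> strict_lower" for i using skew_top_basis[OF that] unfolding skew_top_def by blast
  hence "expand c a j = (\<Sum>i\<in>strict_lower. c i * - skew_basis i j a)" unfolding expand_def by (intro sum.cong refl) simp
  thus "expand c a j = - expand c j a" by (simp add: expand_def sum_negf)
qed

lemma expand_coords:
  assumes X: "skew_top X" and "k < d" "l < p"
  shows "expand (\<lambda>(a,j). X a j) k l = X k l"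
proof -
  have "X k l = - X l k" if "k < p" using X that assms(3) unfolding skew_top_def by blast
  moreover note skew_top_diag[OF X]
  ultimately show ?thesis using assms by (auto simp: expand_def sum_skew_basis not_less)
qed

lemma expand_nonzero: "(\<exists>a<d. \<exists>j<p. expand c a j \<noteq> 0) \<longleftrightarrow> (\<exists>i\<in>strict_lower. c i \<noteq> 0)"
proof
  assume "\<exists>a<d. \<exists>j<p. expand c a j \<noteq> 0"
  thus "\<exists>i\<in>strict_lower. c i \<noteq> 0" unfolding expand_def using sum.neutral by fastforce
next
  assume "\<exists>i\<in>strict_lower. c i \<noteq> 0"
  then obtain a j where aj: "(a,j) \<in> strict_lower" "c (a,j) \<noteq> 0" by auto
  hence "a < d" "j < p" "j < a" by (auto simp: strict_lower_def)
  moreover from this have "expand c a j = c (a,j)" unfolding expand_def by (subst sum_skew_basis) auto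
  ultimately have "expand c a j \<noteq> 0" "a < d" "j < p" using aj(2) by auto
  thus "\<exists>a<d. \<exists>j<p. expand c a j \<noteq> 0" by blast
qed

text \<open>The metric of \<open>M\<close> in frame coordinates, when \<open>G\<close> is V^T M
  V.\<close>

definition gform :: "(nat \<Rightarrow> nat \<Rightarrow> real) \<Rightarrow> (nat \<Rightarrow> nat \<Rightarrow> real) \<Rightarrow> (nat \<Rightarrow> nat \<Rightarrow> real) \<Rightarrow> real" where
  "gform G Y X = (\<Sum>a<d. \<Sum>j<p. Y a j * (\<Sum>b<d. G a b * X b j))"

lemma gform_commute:
  assumes "\<And>a b. a < d \<Longrightarrow> b < d \<Longrightarrow> G a b = G b a"
  shows "gform G Y X = gform G X Y"
proof -
  have "gform G Y X = (\<Sum>j<p. \<Sum>a<d. \<Sum>b<d. Y a j * (G a b * X b j))"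
    unfolding gform_def sum_distrib_left by (rule sum.swap)
  also have "\<dots> = (\<Sum>j<p. \<Sum>b<d. \<Sum>a<d. Y a j * (G a b * X b j))"
    by (intro sum.cong refl sum.swap)
  also have "\<dots> = (\<Sum>j<p. \<Sum>b<d. \<Sum>a<d. X b j * (G b a * Y a j))"
    using assms by (intro sum.cong refl) simp
  also have "\<dots> = gform G X Y" unfolding gform_def sum_distrib_left by (rule sum.swap)
  finally show ?thesis .
qed

lemma hform_commute: "hform Y X = hform X Y"
  by (simp add: hform_def mult_ac)

lemma hform_expand: "hform (expand c) X = (\<Sum>i\<in>strict_lower. c i * hform (skew_basis i) X)"
proof -
  have "hform (expand c) X = (\<Sum>a<d. \<Sum>j<p. \<Sum>i\<in>strict_lower. c i * ((r j - r a) * \<mu> j * skew_basis i a j * X a j))"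
    unfolding hform_def expand_def by (simp add: sum_distrib_left sum_distrib_right mult_ac)
  also have "\<dots> = (\<Sum>a<d. \<Sum>i\<in>strict_lower. \<Sum>j<p. c i * ((r j - r a) * \<mu> j * skew_basis i a j * X a j))"
    by (intro sum.cong refl sum.swap)
  also have "\<dots> = (\<Sum>i\<in>strict_lower. \<Sum>a<d. \<Sum>j<p. c i * ((r j - r a) * \<mu> j * skew_basis i a j * X a j))" by (rule sum.swap)
  finally show ?thesis by (simp add: hform_def sum_distrib_left)
qed

lemma gform_expand: "gform G (expand c) X = (\<Sum>i\<in>strict_lower. c i * gform G (skew_basis i) X)"
proof -
  have "gform G (expand c) X = (\<Sum>a<d. \<Sum>j<p. \<Sum>i\<in>strict_lower. c i * (skew_basis i a j * (\<Sum>b<d. G a b * X b j)))"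
    unfolding gform_def expand_def sum_distrib_right mult.assoc ..
  also have "\<dots> = (\<Sum>a<d. \<Sum>i\<in>strict_lower. \<Sum>j<p. c i * (skew_basis i a j * (\<Sum>b<d. G a b * X b j)))"
    by (intro sum.cong refl sum.swap)
  also have "\<dots> = (\<Sum>i\<in>strict_lower. \<Sum>a<d. \<Sum>j<p. c i * (skew_basis i a j * (\<Sum>b<d. G a b * X b j)))" by (rule sum.swap)
  finally show ?thesis by (simp add: gform_def sum_distrib_left)
qed

text \<open>Eigenvalues are taken in weak form, tested against all tangent \<open>Y\<close>; this
  matches the Hessian equation after pairing with tangent vectors and confines the metric to
  \<open>G\<close>.\<close>

definition form_eigenvalues :: "(nat \<Rightarrow> nat \<Rightarrow> real) \<Rightarrow> real set" where
  "form_eigenvalues G = {t. \<exists>X. skew_top X \<and> (\<exists>a<d. \<exists>j<p. X a j \<noteq> 0) \<and> (\<forall>Y. skew_top Y \<longrightarrow> hform Y X = t * gform G Y X)}"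

lemma form_cong:
  assumes "\<And>a j. a < d \<Longrightarrow> j < p \<Longrightarrow> X a j = X' a j"
  shows "hform X Y = hform X' Y" "gform G X Y = gform G X' Y"
  using assms by (auto simp: hform_def gform_def intro!: sum.cong)

text \<open>Both forms are bilinear, so testing against \<open>skew_basis\<close> suffices, and the
  weak problem becomes one for a symmetric pencil indexed by \<open>strict_lower\<close> whose
  metric part is positive definite.\<close>

lemma form_eigenvalues_finite_nonempty:
  assumes sym: "\<And>a b. a < d \<Longrightarrow> b < d \<Longrightarrow> G a b = G b a"
    and pos: "\<And>X. skew_top X \<Longrightarrow> \<exists>a<d. \<exists>j<p. X a j \<noteq> 0 \<Longrightarrow> 0 < gform G X X"
  shows "finite (form_eigenvalues G)" "form_eigenvalues G \<noteq> {}"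
proof -
  define R where "R = {t. \<exists>c. (\<exists>i\<in>strict_lower. c i \<noteq> 0) \<and> (\<forall>i\<in>strict_lower. (\<Sum>j\<in>strict_lower. hform (skew_basis i) (skew_basis j) * c j)
    = t * (\<Sum>j\<in>strict_lower. gform G (skew_basis i) (skew_basis j) * c j))}"
  have H: "(\<Sum>j\<in>strict_lower. hform (skew_basis i) (skew_basis j) * c j) = hform (skew_basis i) (expand c)" for i c
    by (simp add: hform_commute[of "skew_basis i"] hform_expand mult.commute)
  have G: "(\<Sum>j\<in>strict_lower. gform G (skew_basis i) (skew_basis j) * c j) = gform G (skew_basis i) (expand c)" for i c
    by (simp add: gform_commute[of G "skew_basis i", OF sym] gform_expand mult.commute)
  have "form_eigenvalues G = R"
  proof (intro equalityI subsetI)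
    fix t assume "t \<in> form_eigenvalues G"
    then obtain X where X: "skew_top X" "\<exists>a<d. \<exists>j<p. X a j \<noteq> 0" "\<And>Y. skew_top Y \<Longrightarrow> hform Y X = t * gform G Y X"
      by (auto simp: form_eigenvalues_def)
    define c where "c = (\<lambda>(a,j). X a j)"
    have e: "expand c a j = X a j" if "a < d" "j < p" for a j
      unfolding c_def by (rule expand_coords[OF X(1) that])
    have "\<exists>i\<in>strict_lower. c i \<noteq> 0" using X(2) e expand_nonzero[of c] by metis
    moreover have "hform (skew_basis i) (expand c) = t * gform G (skew_basis i) (expand c)" if "i \<in> strict_lower" for i
    proof -
      have "hform (skew_basis i) (expand c) = hform (skew_basis i) X" "gform G (skew_basis i) (expand c) = gform G (skew_basis i) X"
        using form_cong[OF e] by (simp_all add: hform_commute[of "skew_basis i"] gform_commute[of G "skew_basis i", OF sym])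
      thus ?thesis using X(3)[OF skew_top_basis[OF that]] by simp
    qed
    ultimately show "t \<in> R" unfolding R_def H G by blast
  next
    fix t assume "t \<in> R"
    then obtain c where c: "\<exists>i\<in>strict_lower. c i \<noteq> 0" "\<And>i. i \<in> strict_lower \<Longrightarrow> hform (skew_basis i) (expand c) = t * gform G (skew_basis i) (expand c)"
      unfolding R_def H G by blast
    have "hform Y (expand c) = t * gform G Y (expand c)" if Y: "skew_top Y" for Y
    proof -
      define c' where "c' = (\<lambda>(a,j). Y a j)"
      have e: "expand c' a j = Y a j" if "a < d" "j < p" for a j
        unfolding c'_def by (rule expand_coords[OF Y that])
      have "hform (expand c') (expand c) = t * gform G (expand c') (expand c)"
        using c(2) by (simp add: hform_expand[of c'] gform_expand[of G c'] sum_distrib_left mult_ac)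
      thus ?thesis using form_cong[OF e] by simp
    qed
    thus "t \<in> form_eigenvalues G" unfolding form_eigenvalues_def using c(1) skew_top_expand expand_nonzero[of c] by blast
  qed
  moreover have P: "0 < (\<Sum>i\<in>strict_lower. c i * (\<Sum>j\<in>strict_lower. gform G (skew_basis i) (skew_basis j) * c j))" if "\<exists>i\<in>strict_lower. c i \<noteq> 0" for c
  proof -
    have "0 < gform G (expand c) (expand c)" using that pos[OF skew_top_expand] expand_nonzero by blast
    thus ?thesis by (simp add: G gform_expand[symmetric])
  qed
  have "finite R" "R \<noteq> {}" unfolding R_def
    by (rule sym_pencil_eigenvalues[OF finite_strict_lower strict_lower_nonempty gform_commute[OF sym] hform_commute P]; assumption)+
  ultimately show "finite (form_eigenvalues G)" "form_eigenvalues G \<noteq> {}" by auto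
qed

lemma gform_identity: "gform (\<lambda>a b. if a = b then 1 else 0) Y X = (\<Sum>a<d. \<Sum>j<p. Y a j * X a j)"
proof -
  have "(\<Sum>b<d. (if a = b then 1 else 0) * X b j) = X a j" if "a < d" for a j
    using that by (simp add: if_distrib[of "\<lambda>x. x * _"] cong: if_cong)
  thus ?thesis by (simp add: gform_def)
qed

text \<open>The eigenvector is \<open>skew_basis (a,j)\<close>: it is supported on (a,j) and
  possibly the mirror (j,a), where \<open>\<omega>\<close> takes the same value.\<close>

lemma \<omega>_eig:
  assumes "a < d" "j < p" "j < a"
  shows "\<omega> a j \<in> form_eigenvalues (\<lambda>a b. if a = b then 1 else 0)"
proof -
  have i: "(a,j) \<in> strict_lower" using assms by (simp add: strict_lower_def)
  have "hform Y (skew_basis (a,j)) = \<omega> a j * (\<Sum>k<d. \<Sum>l<p. Y k l * skew_basis (a,j) k l)" if Y: "skew_top Y" for Y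
    unfolding hform_\<omega>[OF skew_top_basis[OF i] Y] sum_distrib_left
    by (intro sum.cong refl) (use assms \<omega>_sym in \<open>auto simp: skew_basis_def\<close>)
  moreover have "skew_basis (a,j) a j \<noteq> 0" by (simp add: skew_basis_def)
  ultimately show ?thesis unfolding form_eigenvalues_def gform_identity using skew_top_basis[OF i] assms by blast
qed

text \<open>The eigenvalue is a Rayleigh quotient that factors as hform / sqnorm times sqnorm /
  gform. The first factor lies between the extreme weights, the second between \<open>ka\<close> and
  \<open>kb\<close>.\<close>

lemma form_eigenvalues_bounds:
  assumes t: "t \<in> form_eigenvalues G"
    and pos: "\<And>X. \<exists>a<d. \<exists>j<p. X a j \<noteq> 0 \<Longrightarrow> 0 < gform G X X"
    and ka: "0 < ka" and bnd: "\<And>X. ka * gform G X X \<le> sqnorm X" "\<And>X. sqnorm X \<le> kb * gform G X X"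
  shows "\<omega>min * ka \<le> t" "t \<le> \<omega>max * kb"
proof -
  obtain X where X: "skew_top X" "\<exists>a<d. \<exists>j<p. X a j \<noteq> 0" "hform X X = t * gform G X X"
    using t by (auto simp: form_eigenvalues_def)
  note g = pos[OF X(2)]
  have mm: "0 \<le> \<omega>max" using \<omega>max_attained \<omega>_bounds \<omega>min_pos by (metis less_imp_le nat_neq_iff order.trans)
  have "\<omega>min * ka * gform G X X \<le> \<omega>min * sqnorm X"
    using mult_left_mono[OF bnd(1)[of X], of \<omega>min] \<omega>min_pos by (simp add: mult.assoc)
  also have "\<dots> \<le> t * gform G X X" using hform_bounds(1)[OF X(1)] X(3) by simp
  finally show "\<omega>min * ka \<le> t" using g by simp
  have "t * gform G X X \<le> \<omega>max * sqnorm X" using hform_bounds(2)[OF X(1)] X(3) by simp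
  also have "\<dots> \<le> \<omega>max * kb * gform G X X"
    using mult_left_mono[OF bnd(2)[of X] mm] by (simp add: mult.assoc)
  finally show "t \<le> \<omega>max * kb" using g by simp
qed

end

section \<open>The minimizer and its Hessian\<close>

text \<open>R = Q Q^T is a symmetric projection, so R_aa^2 is at most the sum over b of R_ab^2,
  which is R_aa; hence R_aa \<le> 1. For the assignment problem this is the row constraint.\<close>

lemma bessel_rows:
  fixes Q :: "real mat"
  assumes Q: "Q \<in> carrier_mat d p" and QQ: "Q\<^sup>T * Q = 1\<^sub>m p" and a: "a < d"
  shows "(\<Sum>j<p. (Q $$ (a,j))\<^sup>2) \<le> 1"
proof -
  define R where "R = Q * Q\<^sup>T"
  have R: "R \<in> carrier_mat d d" using Q by (simp add: R_def)
  have "R * R = Q * ((Q\<^sup>T * Q) * Q\<^sup>T)" unfolding R_def using Q by (simp add: mat_mult_assoc)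
  also have "\<dots> = R" unfolding QQ R_def using Q by simp
  finally have RR: "R * R = R" .
  have sym: "R $$ (a,b) = R $$ (b,a)" if "b < d" for b
  proof -
    have "R\<^sup>T = R" using Q by (simp add: R_def mat_transpose_mult)
    thus ?thesis using R a that by (metis carrier_matD index_transpose_mat(1))
  qed
  have Raa: "R $$ (a,a) = (\<Sum>j<p. (Q $$ (a,j))\<^sup>2)"
    using Q a by (simp add: R_def scalar_prod_def lessThan_atLeast0 power2_eq_square)
  have "(R $$ (a,a))\<^sup>2 \<le> (\<Sum>b<d. (R $$ (a,b))\<^sup>2)"
    using a by (intro member_le_sum[of a _ "\<lambda>b. (R $$ (a,b))\<^sup>2"]) auto
  also have "\<dots> = (\<Sum>b<d. R $$ (a,b) * R $$ (b,a))"
    using sym by (intro sum.cong) (auto simp: power2_eq_square)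
  also have "\<dots> = (R * R) $$ (a,a)"
    using R a by (simp add: scalar_prod_def lessThan_atLeast0)
  finally have "(R $$ (a,a))\<^sup>2 \<le> R $$ (a,a)" unfolding RR .
  have "R $$ (a,a) \<le> 1"
  proof (rule ccontr)
    assume "\<not> R $$ (a,a) \<le> 1"
    hence "R $$ (a,a) * 1 < R $$ (a,a) * R $$ (a,a)" by (intro mult_strict_left_mono) auto
    thus False using \<open>(R $$ (a,a))\<^sup>2 \<le> R $$ (a,a)\<close> by (simp add: power2_eq_square)
  qed
  thus ?thesis by (simp add: Raa)
qed

lemma mat_diag_mult_both:
  fixes X :: "'a::semiring_0 mat"
  assumes X: "X \<in> carrier_mat d p"
  shows "mat_diag d r * X * mat_diag p \<mu> = mat d p (\<lambda>(a,j). r a * X $$ (a,j) * \<mu> j)"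
  unfolding mat_diag_mult_right[OF mult_carrier_mat[OF mat_diag_dim X]]
  unfolding mat_diag_mult_left[OF X] by (rule eq_matI) auto

lemma mat_trace_transpose_mult:
  assumes "Y \<in> carrier_mat d p" "L \<in> carrier_mat d p"
  shows "mat_trace (Y\<^sup>T * L) = (\<Sum>a<d. \<Sum>j<p. Y $$ (a,j) * L $$ (a,j))"
proof -
  have "mat_trace (Y\<^sup>T * L) = (\<Sum>j<p. \<Sum>a<d. Y $$ (a,j) * L $$ (a,j))"
    using assms by (simp add: mat_trace_mult)
  also have "\<dots> = (\<Sum>a<d. \<Sum>j<p. Y $$ (a,j) * L $$ (a,j))" by (rule sum.swap)
  finally show ?thesis .
qed

text \<open>Right multiplication by \<open>E\<close> selects the leading p columns of a
  frame.\<close>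

definition (in fda_weights) E :: "real mat" where
  "E = mat d p (\<lambda>(i,j). if i = j then 1 else 0)"

lemma (in fda_weights) E_carrier: "E \<in> carrier_mat d p"
  by (simp add: E_def)

lemma (in fda_weights) E_orthonormal: "E\<^sup>T * E = 1\<^sub>m p"
proof (rule eq_matI)
  fix i j assume "i < dim_row (1\<^sub>m p :: real mat)" "j < dim_col (1\<^sub>m p :: real mat)"
  hence ij: "i < p" "j < p" by auto
  have "(E\<^sup>T * E) $$ (i,j) = (\<Sum>k<d. (if k = i then 1 else 0) * (if k = j then 1 else 0))"
    using ij by (auto simp: E_def scalar_prod_def lessThan_atLeast0 intro!: sum.cong)
  also have "\<dots> = (\<Sum>k<d. if k = i then (if i = j then 1 else 0) else 0)" by (intro sum.cong) auto
  also have "\<dots> = 1\<^sub>m p $$ (i,j)" using ij p_less by simp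
  finally show "(E\<^sup>T * E) $$ (i,j) = 1\<^sub>m p $$ (i,j)" .
qed (simp_all add: E_def)

text \<open>In the frame \<open>V\<^sub>0\<close> the minimizer has a coordinate matrix Q with
  orthonormal columns, and the objective depends only on the squares of its entries. These squares
  are feasible for the assignment problem and do at least as well as the diagonal choice
  \<open>E\<close>, so Q vanishes off the diagonal and has diagonal entries 1 or -1. Absorbing these
  signs into the frame gives \<open>V\<close>.\<close>

lemma (in fda_weights) minimizer_structure:
  assumes B: "sym_pos_def_mat d B" and A: "A \<in> carrier_mat d d"
    and V0: "V\<^sub>0 \<in> carrier_mat d d" "V\<^sub>0\<^sup>T * B * V\<^sub>0 = 1\<^sub>m d" "V\<^sub>0\<^sup>T * A * V\<^sub>0 = mat_diag d r"
    and W: "W \<in> gen_stiefel p d B"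
    and opt: "\<And>W'. W' \<in> gen_stiefel p d B \<Longrightarrow> f_FDA A (mat_diag p \<mu>) W \<le> f_FDA A (mat_diag p \<mu>) W'"
  obtains V where "V \<in> carrier_mat d d" "V\<^sup>T * B * V = 1\<^sub>m d" "V\<^sup>T * A * V = mat_diag d r" "W = V * E"
proof -
  note b = spdD[OF B]
  have W': "W \<in> carrier_mat d p" "W\<^sup>T * B * W = 1\<^sub>m p" using W by (auto simp: gen_stiefel_def)
  note [simp] = b(3,4)
  have [simp]: "dim_row A = d" "dim_col A = d" "dim_row V\<^sub>0 = d" "dim_col V\<^sub>0 = d" "dim_row W = d" "dim_col W = p"
    using A V0 W' by auto
  have inv: "V\<^sub>0 * (V\<^sub>0\<^sup>T * B) = 1\<^sub>m d"
    by (rule mat_mult_left_right_inverse[OF _ V0(1) V0(2)]) (use V0 b in auto)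
  define Q where "Q = V\<^sub>0\<^sup>T * B * W"
  have Q: "Q \<in> carrier_mat d p" by (intro carrier_matI) (simp_all add: Q_def)
  have [simp]: "dim_row Q = d" "dim_col Q = p" using Q by auto
  have VQ: "V\<^sub>0 * Q = W"
  proof -
    have "V\<^sub>0 * Q = (V\<^sub>0 * (V\<^sub>0\<^sup>T * B)) * W" by (simp add: Q_def mat_mult_assoc)
    thus ?thesis using W' by (simp add: inv)
  qed
  have QQ: "Q\<^sup>T * Q = 1\<^sub>m p"
  proof -
    have "Q\<^sup>T * Q = W\<^sup>T * (B * ((V\<^sub>0 * (V\<^sub>0\<^sup>T * B)) * W))"
      by (simp add: Q_def mat_transpose_mult b(2) mat_mult_assoc)
    also have "\<dots> = W\<^sup>T * B * W" using W' by (simp add: inv mat_mult_assoc)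
    finally show ?thesis using W'(2) by simp
  qed
  have f: "f_FDA A (mat_diag p \<mu>) (V\<^sub>0 * X) = - (1/2) * (\<Sum>a<d. \<Sum>j<p. r a * \<mu> j * (X $$ (a,j))\<^sup>2)"
    if X: "X \<in> carrier_mat d p" for X
  proof -
    have dN: "dim_row (mat_diag p \<mu>) = p" by (simp add: mat_diag_def)
    have "(V\<^sub>0 * X)\<^sup>T * A * (V\<^sub>0 * X) * mat_diag p \<mu> = X\<^sup>T * ((V\<^sub>0\<^sup>T * A * V\<^sub>0) * X * mat_diag p \<mu>)"
      using X dN by (simp add: mat_transpose_mult mat_mult_assoc)
    also have "\<dots> = X\<^sup>T * mat d p (\<lambda>(a,j). r a * X $$ (a,j) * \<mu> j)"
      unfolding V0(3) mat_diag_mult_both[OF X] ..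
    finally have "(V\<^sub>0 * X)\<^sup>T * A * (V\<^sub>0 * X) * mat_diag p \<mu> = X\<^sup>T * mat d p (\<lambda>(a,j). r a * X $$ (a,j) * \<mu> j)" .
    thus ?thesis unfolding f_FDA_def using mat_trace_transpose_mult[OF X, of "mat d p (\<lambda>(a,j). r a * X $$ (a,j) * \<mu> j)"]
      by (simp add: power2_eq_square mult_ac)
  qed
  have "V\<^sub>0 * E \<in> gen_stiefel p d B"
  proof -
    have "(V\<^sub>0 * E)\<^sup>T * B * (V\<^sub>0 * E) = E\<^sup>T * ((V\<^sub>0\<^sup>T * B * V\<^sub>0) * E)"
      using E_carrier by (simp add: mat_transpose_mult mat_mult_assoc)
    also have "\<dots> = 1\<^sub>m p" unfolding V0(2) using E_carrier E_orthonormal by simp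
    finally show ?thesis using V0(1) E_carrier by (simp add: gen_stiefel_def)
  qed
  from opt[OF this] have "(\<Sum>a<d. \<Sum>j<p. r a * \<mu> j * (E $$ (a,j))\<^sup>2) \<le> (\<Sum>a<d. \<Sum>j<p. r a * \<mu> j * (Q $$ (a,j))\<^sup>2)"
    unfolding f[OF E_carrier] VQ[symmetric] f[OF Q] by simp
  also have "(\<Sum>a<d. \<Sum>j<p. r a * \<mu> j * (E $$ (a,j))\<^sup>2) = (\<Sum>j<p. \<Sum>a<d. r a * \<mu> j * (E $$ (a,j))\<^sup>2)"
    by (rule sum.swap)
  also have "\<dots> = (\<Sum>j<p. r j * \<mu> j)"
  proof (rule sum.cong[OF refl])
    fix j assume j: "j \<in> {..<p}"
    have "(\<Sum>a<d. r a * \<mu> j * (E $$ (a,j))\<^sup>2) = (\<Sum>a<d. if a = j then r a * \<mu> j else 0)"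
      using j by (intro sum.cong) (auto simp: E_def)
    thus "(\<Sum>a<d. r a * \<mu> j * (E $$ (a,j))\<^sup>2) = r j * \<mu> j" using j p_less by simp
  qed
  finally have opt': "(\<Sum>j<p. r j * \<mu> j) \<le> (\<Sum>a<d. \<Sum>j<p. r a * \<mu> j * (Q $$ (a,j))\<^sup>2)" .
  have cols: "(\<Sum>a<d. (Q $$ (a,j))\<^sup>2) = 1" if j: "j < p" for j
  proof -
    have "(Q\<^sup>T * Q) $$ (j,j) = (\<Sum>a<d. (Q $$ (a,j))\<^sup>2)"
      using j by (simp add: scalar_prod_def lessThan_atLeast0 power2_eq_square)
    thus ?thesis using j by (simp add: QQ)
  qed
  have "(Q $$ (a,j))\<^sup>2 = 0" if "a < d" "j < p" "a \<noteq> j" for a j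
    by (rule assignment_optimum[of "\<lambda>a j. (Q $$ (a,j))\<^sup>2", OF _ cols bessel_rows[OF Q QQ] opt' that]) auto
  hence Q0: "Q $$ (a,j) = 0" if "a < d" "j < p" "a \<noteq> j" for a j using that by simp
  \<comment> \<open>The signs of the first p columns; the remaining frame vectors stay
    unchanged.\<close>
  define \<sigma> where "\<sigma> a = (if a < p then Q $$ (a,a) else 1)" for a
  have \<sigma>: "\<sigma> a * \<sigma> a = 1" if "a < d" for a
  proof (cases "a < p")
    case True
    have "1 = (\<Sum>k<d. (Q $$ (k,a))\<^sup>2)" using cols[OF True] by simp
    also have "\<dots> = (\<Sum>k<d. if k = a then (Q $$ (a,a))\<^sup>2 else 0)"
      using Q0 True by (intro sum.cong) auto
    finally show ?thesis using that True by (simp add: \<sigma>_def power2_eq_square)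
  qed (simp add: \<sigma>_def)
  define D where "D = mat_diag d \<sigma>"
  have D: "D \<in> carrier_mat d d" "D\<^sup>T = D" by (auto simp: D_def mat_diag_def intro!: eq_matI)
  have [simp]: "dim_row D = d" "dim_col D = d" using D by auto
  show thesis
  proof (rule that[of "V\<^sub>0 * D"])
    show "V\<^sub>0 * D \<in> carrier_mat d d" using V0(1) D(1) by simp
    have "(V\<^sub>0 * D)\<^sup>T * B * (V\<^sub>0 * D) = D * (V\<^sub>0\<^sup>T * B * V\<^sub>0) * D"
      by (simp add: mat_transpose_mult D(2) mat_mult_assoc)
    also have "\<dots> = mat_diag d (\<lambda>i. \<sigma> i * \<sigma> i)" unfolding V0(2) right_mult_one_mat[OF D(1)] by (simp add: D_def)
    also have "\<dots> = 1\<^sub>m d" using \<sigma> by (intro eq_matI) (auto simp: mat_diag_def)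
    finally show "(V\<^sub>0 * D)\<^sup>T * B * (V\<^sub>0 * D) = 1\<^sub>m d" .
    have "(V\<^sub>0 * D)\<^sup>T * A * (V\<^sub>0 * D) = D * (V\<^sub>0\<^sup>T * A * V\<^sub>0) * D"
      by (simp add: mat_transpose_mult D(2) mat_mult_assoc)
    also have "\<dots> = mat_diag d (\<lambda>i. \<sigma> i * r i * \<sigma> i)" unfolding V0(3) by (simp add: D_def)
    also have "\<dots> = mat_diag d r"
    proof (intro eq_matI)
      fix i j assume "i < dim_row (mat_diag d r)" "j < dim_col (mat_diag d r)"
      thus "mat_diag d (\<lambda>i. \<sigma> i * r i * \<sigma> i) $$ (i,j) = mat_diag d r $$ (i,j)"
        using \<sigma>[of j] by (auto simp: mat_diag_def mult.assoc mult.left_commute[of _ "r j"])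
    qed (auto simp: mat_diag_def)
    finally show "(V\<^sub>0 * D)\<^sup>T * A * (V\<^sub>0 * D) = mat_diag d r" .
    have "D * E = Q" unfolding D_def mat_diag_mult_left[OF E_carrier]
      by (intro eq_matI) (use Q0 p_less in \<open>auto simp: E_def \<sigma>_def\<close>)
    hence "V\<^sub>0 * (D * E) = W" by (simp add: VQ)
    thus "W = V\<^sub>0 * D * E" using E_carrier by (simp add: mat_mult_assoc)
  qed
qed

locale fda_frame = fda_weights p d r \<mu> for p d r \<mu> +
  fixes A B V :: "real mat"
  assumes B: "sym_pos_def_mat d B" and A: "A \<in> carrier_mat d d" "A\<^sup>T = A" and V: "V \<in> carrier_mat d d"
    and VBV: "V\<^sup>T * B * V = 1\<^sub>m d" and VAV: "V\<^sup>T * A * V = mat_diag d r"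
begin

lemmas b = spdD[OF B]

lemma dims [simp]: "dim_row A = d" "dim_col A = d" "dim_row B = d" "dim_col B = d" "dim_row V = d" "dim_col V = d"
   "dim_row E = d" "dim_col E = p" "dim_row (mat_diag d r) = d" "dim_col (mat_diag d r) = d"
  using A b V E_carrier by (auto simp: mat_diag_def)

lemma BVV: "B * (V * V\<^sup>T) = 1\<^sub>m d"
proof -
  have "B * V * V\<^sup>T = 1\<^sub>m d"
    by (rule mat_mult_left_right_inverse) (use VBV V b(1) in \<open>auto simp: mat_mult_assoc\<close>)
  thus ?thesis by (simp add: mat_mult_assoc)
qed

lemma VVB: "V * (V\<^sup>T * B) = 1\<^sub>m d"
  using arg_cong[OF BVV, of transpose_mat] b(2) by (simp add: mat_transpose_mult mat_mult_assoc)

lemma AV: "A * V = B * (V * mat_diag d r)"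
proof -
  have "B * (V * mat_diag d r) = (B * (V * V\<^sup>T)) * (A * V)"
    unfolding VAV[symmetric] by (simp add: mat_mult_assoc)
  also have "\<dots> = A * V" unfolding BVV using A(1) V by simp
  finally show ?thesis ..
qed

definition W :: "real mat" where "W = V * E"

text \<open>The Lagrange multiplier of the constraint: column j of \<open>W\<close> is an
  eigenvector of the pencil with value r_j, and \<open>N\<close> scales it by \<mu>_j.\<close>

definition S :: "real mat" where "S = mat_diag p (\<lambda>j. r j * \<mu> j)"

definition N :: "real mat" where "N = mat_diag p \<mu>"

lemma NS: "N \<in> carrier_mat p p" "N\<^sup>T = N" "S \<in> carrier_mat p p" "S\<^sup>T = S"
  "dim_row N = p" "dim_col N = p" "dim_row S = p" "dim_col S = p"
  by (auto simp: N_def S_def mat_diag_def intro!: eq_matI)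

lemma W_stiefel: "W \<in> gen_stiefel p d B"
proof -
  have "W\<^sup>T * B * W = E\<^sup>T * ((V\<^sup>T * B * V) * E)"
    by (simp add: W_def mat_transpose_mult mat_mult_assoc)
  also have "\<dots> = 1\<^sub>m p" unfolding VBV using E_carrier E_orthonormal by simp
  finally show ?thesis using V E_carrier by (simp add: gen_stiefel_def W_def)
qed

lemma critical: "A * W * N = B * W * S"
proof -
  have "A * W * N = (A * V) * (E * N)" using NS by (simp add: W_def mat_mult_assoc)
  also have "\<dots> = B * (V * (mat_diag d r * E * N))" unfolding AV using NS by (simp add: mat_mult_assoc)
  also have "mat_diag d r * E * N = E * S"
    unfolding N_def S_def mat_diag_mult_both[OF E_carrier] mat_diag_mult_right[OF E_carrier]
    by (rule eq_matI) (auto simp: E_def)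
  also have "B * (V * (E * S)) = B * W * S" using NS by (simp add: W_def mat_mult_assoc)
  finally show ?thesis .
qed

definition mat_of :: "(nat \<Rightarrow> nat \<Rightarrow> real) \<Rightarrow> real mat" where "mat_of X = mat d p (\<lambda>(i,j). X i j)"

lemma mat_of: "mat_of X \<in> carrier_mat d p" "dim_row (mat_of X) = d" "dim_col (mat_of X) = p"
  "i < d \<Longrightarrow> j < p \<Longrightarrow> mat_of X $$ (i,j) = X i j"
  by (auto simp: mat_of_def)

text \<open>As V^T B V = I, tangency becomes X^T E + E^T X = 0, and E picks out the top p by p block
  of X.\<close>

lemma tangent_iff: "V * mat_of X \<in> tangent_space p d B W \<longleftrightarrow> skew_top X"
proof -
  note [simp] = mat_of
  define L where "L = (mat_of X)\<^sup>T * E + E\<^sup>T * mat_of X"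
  have "(V * mat_of X)\<^sup>T * B * W = (mat_of X)\<^sup>T * ((V\<^sup>T * B * V) * E)"
    by (simp add: W_def mat_transpose_mult mat_mult_assoc)
  hence 1: "(V * mat_of X)\<^sup>T * B * W = (mat_of X)\<^sup>T * E" using E_carrier by (simp add: VBV)
  have "W\<^sup>T * B * (V * mat_of X) = E\<^sup>T * ((V\<^sup>T * B * V) * mat_of X)"
    by (simp add: W_def mat_transpose_mult mat_mult_assoc)
  hence 2: "W\<^sup>T * B * (V * mat_of X) = E\<^sup>T * mat_of X" using mat_of(1)[of X] by (simp add: VBV)
  have Lij: "L $$ (i,j) = X j i + X i j" if ij: "i < p" "j < p" for i j
  proof -
    have "((mat_of X)\<^sup>T * E) $$ (i,j) = (\<Sum>k<d. X k i * (if k = j then 1 else 0))"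
      using ij by (simp add: E_def scalar_prod_def lessThan_atLeast0)
    moreover have "(E\<^sup>T * mat_of X) $$ (i,j) = (\<Sum>k<d. (if k = i then 1 else 0) * X k j)"
      using ij by (simp add: E_def scalar_prod_def lessThan_atLeast0)
    ultimately show ?thesis using ij p_less
      by (simp add: L_def if_distrib[of "\<lambda>z. z * _"] if_distrib[of "\<lambda>z. _ * z"] cong: if_cong)
  qed
  have L: "L \<in> carrier_mat p p" by (intro carrier_matI) (simp_all add: L_def)
  have "V * mat_of X \<in> tangent_space p d B W \<longleftrightarrow> L = 0\<^sub>m p p"
    unfolding tangent_space_def mem_Collect_eq 1 2 L_def[symmetric] using mult_carrier_mat[OF V mat_of(1)] by blast
  also have "\<dots> \<longleftrightarrow> (\<forall>i<p. \<forall>j<p. X j i + X i j = 0)"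
    using L Lij by (auto simp: mat_eq_iff)
  also have "\<dots> \<longleftrightarrow> skew_top X" unfolding skew_top_def by (metis add.commute add_eq_0_iff)
  finally show ?thesis .
qed

text \<open>Since V has inverse V^T B, the coordinate matrix is V^T B \<xi>.\<close>

lemma tangent_coords:
  assumes "\<xi> \<in> tangent_space p d B W"
  obtains X where "\<xi> = V * mat_of X" "skew_top X"
proof -
  have x: "\<xi> \<in> carrier_mat d p" using assms by (simp add: tangent_space_def)
  define X where "X i j = (V\<^sup>T * B * \<xi>) $$ (i,j)" for i j
  have m: "mat_of X = V\<^sup>T * B * \<xi>" using x by (intro eq_matI) (auto simp: mat_of_def X_def)
  have "V * mat_of X = (V * (V\<^sup>T * B)) * \<xi>" unfolding m using x by (simp add: mat_mult_assoc)
  hence "\<xi> = V * mat_of X" using x by (simp add: VVB)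
  thus thesis using that assms tangent_iff[of X] by simp
qed

lemma tangent_image: "tangent_space p d B W = (\<lambda>X. V * mat_of X) ` {X. skew_top X}"
  using tangent_iff by (auto elim: tangent_coords)

lemma frame_zero: "V * mat_of X = 0\<^sub>m d p \<longleftrightarrow> \<not> (\<exists>a<d. \<exists>j<p. X a j \<noteq> 0)"
proof
  assume z: "V * mat_of X = 0\<^sub>m d p"
  have "mat_of X = (V\<^sup>T * B * V) * mat_of X" unfolding VBV using mat_of(1)[of X] by simp
  also have "\<dots> = V\<^sup>T * B * (V * mat_of X)" by (simp add: mat_mult_assoc mat_of)
  also have "\<dots> = 0\<^sub>m d p" unfolding z using V b(1) by simp
  finally have "mat_of X $$ (a,j) = 0" if "a < d" "j < p" for a j using that by simp
  thus "\<not> (\<exists>a<d. \<exists>j<p. X a j \<noteq> 0)" by (auto simp: mat_of)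
next
  assume "\<not> (\<exists>a<d. \<exists>j<p. X a j \<noteq> 0)"
  hence "mat_of X = 0\<^sub>m d p" by (intro eq_matI) (auto simp: mat_of_def)
  thus "V * mat_of X = 0\<^sub>m d p" using V by simp
qed

text \<open>Pulling B V out with A V = B V diag(r) leaves X S - diag(r) X N, whose (a,j) entry is
  (r_j - r_a) \<mu>_j X_aj, and V^T B V = I removes the frame from the pairing.\<close>

lemma hess_form: "mat_trace ((V * mat_of Y)\<^sup>T * (B * (V * mat_of X) * S - A * (V * mat_of X) * N)) = hform Y X"
proof -
  note [simp] = mat_of NS(5-8)
  have c: "mat_diag d r * mat_of X \<in> carrier_mat d p" using mat_diag_dim mat_of(1) by (rule mult_carrier_mat)
  have "A * (V * mat_of X) * N = (A * V) * (mat_of X * N)" by (simp add: mat_mult_assoc)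
  also have "\<dots> = B * V * (mat_diag d r * mat_of X * N)" unfolding AV by (simp add: mat_mult_assoc)
  finally have 1: "A * (V * mat_of X) * N = B * V * (mat_diag d r * mat_of X * N)" .
  have 2: "B * (V * mat_of X) * S = B * V * (mat_of X * S)" by (simp add: mat_mult_assoc)
  define L where "L = mat_of X * S - mat_diag d r * mat_of X * N"
  have L: "L \<in> carrier_mat d p" by (intro carrier_matI) (simp_all add: L_def)
  have Lij: "L $$ (a,j) = (r j - r a) * \<mu> j * X a j" if "a < d" "j < p" for a j
    unfolding L_def N_def S_def mat_diag_mult_both[OF mat_of(1)] mat_diag_mult_right[OF mat_of(1)]
    using that by (simp add: algebra_simps)
  have 3: "B * (V * mat_of X) * S - A * (V * mat_of X) * N = B * V * L"
    unfolding 1 2 L_def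
    by (rule mult_minus_distrib_mat[symmetric, OF mult_carrier_mat[OF b(1) V] mult_carrier_mat[OF mat_of(1) NS(3)]
        mult_carrier_mat[OF c NS(1)]])
  have "(V * mat_of Y)\<^sup>T * (B * V * L) = (mat_of Y)\<^sup>T * ((V\<^sup>T * B * V) * L)"
    using L by (simp add: mat_transpose_mult mat_mult_assoc)
  also have "\<dots> = (mat_of Y)\<^sup>T * L" unfolding VBV using L by simp
  finally have "mat_trace ((V * mat_of Y)\<^sup>T * (B * V * L)) = (\<Sum>a<d. \<Sum>j<p. Y a j * ((r j - r a) * \<mu> j * X a j))"
    using mat_trace_transpose_mult[OF mat_of(1) L] Lij by simp
  thus ?thesis unfolding 3 hform_def by (simp add: mult_ac)
qed

lemma metric_form:
  assumes M: "M \<in> carrier_mat d d"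
  shows "metric_g M (V * mat_of Y) (V * mat_of X) = gform (\<lambda>a b. (V\<^sup>T * M * V) $$ (a,b)) Y X"
proof -
  note [simp] = mat_of
  define G where "G = V\<^sup>T * M * V"
  have G: "G \<in> carrier_mat d d" using V M by (simp add: G_def)
  have "(V * mat_of Y)\<^sup>T * M * (V * mat_of X) = (mat_of Y)\<^sup>T * (G * mat_of X)"
    using M by (simp add: G_def mat_transpose_mult mat_mult_assoc)
  hence "metric_g M (V * mat_of Y) (V * mat_of X) = (\<Sum>a<d. \<Sum>j<p. Y a j * (G * mat_of X) $$ (a,j))"
    unfolding metric_g_def using mat_trace_transpose_mult[OF mat_of(1) mult_carrier_mat[OF G mat_of(1)]] by simp
  also have "\<dots> = gform (\<lambda>a b. G $$ (a,b)) Y X"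
    unfolding gform_def using G
    by (intro sum.cong refl arg_cong2[where f = "(*)"]) (auto simp: scalar_prod_def lessThan_atLeast0)
  finally show ?thesis by (simp add: G_def)
qed

lemma sqnorm_metric: "sqnorm X = metric_g B (V * mat_of X) (V * mat_of X)"
proof -
  have "metric_g B (V * mat_of X) (V * mat_of X) = gform (\<lambda>a b. if a = b then 1 else 0) X X"
    unfolding metric_form[OF b(1)] VBV gform_def by (intro sum.cong refl arg_cong2[where f = "(*)"]) auto
  thus ?thesis by (simp add: gform_identity sqnorm_def)
qed

text \<open>The substitution \<xi> = V X maps the skew coordinates onto the tangent space and turns
  the two sides of the weak eigenvalue equation into \<open>hform\<close> and a multiple of
  \<open>gform\<close>.\<close>

lemma hess_eigenvalues_frame:
  assumes M: "sym_pos_def_mat d M"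
  shows "hess_eigenvalues p d B M (f_FDA A N) W = form_eigenvalues (\<lambda>a b. (V\<^sup>T * M * V) $$ (a,b))"
proof -
  obtain J c where J: "J \<in> carrier_mat d d" "J\<^sup>T = J" "J * M = 1\<^sub>m d" "c > 0"
    "\<And>z. z \<in> carrier_vec d \<Longrightarrow> c * (z \<bullet> (B *\<^sub>v z)) \<le> (B *\<^sub>v z) \<bullet> (J *\<^sub>v (B *\<^sub>v z))"
    using spd_inverse_bound[OF B M] p_less by (metis gr_zeroI not_less_zero)
  interpret G: stiefel_geometry p d B M J c by unfold_locales (fact B M J)+
  have "hess_eigenvalues p d B M (f_FDA A N) W = {t. \<exists>\<xi>\<in>tangent_space p d B W. \<xi> \<noteq> 0\<^sub>m d p \<and>
    (\<forall>\<eta>\<in>tangent_space p d B W. mat_trace (\<eta>\<^sup>T * (B * \<xi> * S - A * \<xi> * N)) = t * metric_g M \<eta> \<xi>)}"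
    by (rule G.hess_eigenvalues_critical[OF W_stiefel A NS(1-4) critical])
  also have "\<dots> = {t. \<exists>X. skew_top X \<and> V * mat_of X \<noteq> 0\<^sub>m d p \<and> (\<forall>Y. skew_top Y \<longrightarrow>
    mat_trace ((V * mat_of Y)\<^sup>T * (B * (V * mat_of X) * S - A * (V * mat_of X) * N)) = t * metric_g M (V * mat_of Y) (V * mat_of X))}"
    unfolding tangent_image by auto
  finally show ?thesis
    unfolding hess_form metric_form[OF spdD(1)[OF M]] frame_zero not_not form_eigenvalues_def .
qed

lemma metric_pos:
  assumes M: "sym_pos_def_mat d M" and "\<exists>a<d. \<exists>j<p. X a j \<noteq> 0"
  shows "0 < gform (\<lambda>a b. (V\<^sup>T * M * V) $$ (a,b)) X X"
  unfolding metric_form[OF spdD(1)[OF M], symmetric]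
  by (rule metric_g_pos(2)[OF M]) (use V mat_of(1) frame_zero[of X] assms(2) in auto)

lemma hess_finite_nonempty:
  assumes M: "sym_pos_def_mat d M"
  shows "finite (hess_eigenvalues p d B M (f_FDA A N) W)" "hess_eigenvalues p d B M (f_FDA A N) W \<noteq> {}"
proof -
  define G where "G = V\<^sup>T * M * V"
  note m = spdD[OF M]
  have G: "G \<in> carrier_mat d d" "G\<^sup>T = G" using V m by (auto simp: G_def mat_transpose_mult mat_mult_assoc)
  have sym: "G $$ (a,b) = G $$ (b,a)" if "a < d" "b < d" for a b
    using G that by (metis carrier_matD index_transpose_mat(1))
  show "finite (hess_eigenvalues p d B M (f_FDA A N) W)" "hess_eigenvalues p d B M (f_FDA A N) W \<noteq> {}"
    unfolding hess_eigenvalues_frame[OF M] using form_eigenvalues_finite_nonempty[of "\<lambda>a b. G $$ (a,b)"] sym metric_pos[OF M]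
    unfolding G_def by auto
qed

lemma hess_eigenvalue_bounds:
  assumes M: "sym_pos_def_mat d M" and t: "t \<in> hess_eigenvalues p d B M (f_FDA A N) W" and ka: "0 < ka"
    and bnd: "\<And>X. X \<in> carrier_mat d p \<Longrightarrow> ka * metric_g M X X \<le> metric_g B X X \<and> metric_g B X X \<le> kb * metric_g M X X"
  shows "\<omega>min * ka \<le> t" "t \<le> \<omega>max * kb"
proof -
  have VX: "V * mat_of X \<in> carrier_mat d p" for X using V mat_of(1) by simp
  note e = form_eigenvalues_bounds[OF t[unfolded hess_eigenvalues_frame[OF M]] metric_pos[OF M] ka, of kb]
  show "\<omega>min * ka \<le> t" "t \<le> \<omega>max * kb"
    by (rule e; use bnd[OF VX] in \<open>simp add: sqnorm_metric metric_form[OF spdD(1)[OF M], symmetric]\<close>)+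
qed

text \<open>All Hessian eigenvalues lie between the positive number \<omega>min ka and \<omega>max
  kb, so absolute values change nothing and the quotient of the extremes is at most that of the
  endpoints.\<close>

lemma kappa_hess_le:
  assumes M: "sym_pos_def_mat d M"
  shows "kappa_hess p d B M (f_FDA A N) W \<le> \<omega>max / \<omega>min * kappa_pencil d B M"
proof -
  obtain ka kb where k: "0 < ka" "ka \<le> kb" "kappa_pencil d B M = kb / ka"
    "\<And>X. X \<in> carrier_mat d p \<Longrightarrow> ka * metric_g M X X \<le> metric_g B X X \<and> metric_g B X X \<le> kb * metric_g M X X"
    using kappa_pencil_bounds[OF B M] p_less by (metis gr_zeroI not_less_zero)
  define H where "H = (\<lambda>t. \<bar>t\<bar>) ` hess_eigenvalues p d B M (f_FDA A N) W"
  have H: "finite H" "H \<noteq> {}" using hess_finite_nonempty[OF M] by (auto simp: H_def)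
  have lo: "0 < \<omega>min * ka" using \<omega>min_pos k by simp
  have bnd: "\<omega>min * ka \<le> h \<and> h \<le> \<omega>max * kb" if "h \<in> H" for h
    using that hess_eigenvalue_bounds[OF M _ k(1,4)] lo unfolding H_def by fastforce
  have "Max H / Min H \<le> (\<omega>max * kb) / (\<omega>min * ka)"
  proof (rule frac_le)
    \<comment> \<open>The spectrum contains some eigenvalue, and it is positive, which makes the
      upper endpoint nonnegative.\<close>
    show "0 \<le> \<omega>max * kb" using H(2) bnd lo by (meson all_not_in_conv less_imp_le order_trans)
    show "Max H \<le> \<omega>max * kb" "\<omega>min * ka \<le> Min H" using H bnd by auto
  qed (rule lo)
  thus ?thesis unfolding kappa_hess_def H_def[symmetric] k(3) by simp
qed

text \<open>For M = B the Gram matrix V^T M V is the identity, both comparison constants are 1, and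
  the extreme weights are themselves eigenvalues, so the bounds are attained.\<close>

lemma kappa_hess_eq:
  "kappa_hess p d B B (f_FDA A N) W = \<omega>max / \<omega>min"
proof -
  \<comment> \<open>Inside this proof \<open>E\<close> names the set of eigenvalues and shadows the
    truncated identity.\<close>
  define E where "E = hess_eigenvalues p d B B (f_FDA A N) W"
  have E: "E = form_eigenvalues (\<lambda>a b. if a = b then 1 else 0)"
  proof -
    have "gform (\<lambda>a b. (1\<^sub>m d) $$ (a,b)) Y X = gform (\<lambda>a b. if a = b then 1 else 0) Y X" for X Y
      unfolding gform_def by (intro sum.cong refl arg_cong2[where f = "(*)"]) auto
    thus ?thesis unfolding E_def hess_eigenvalues_frame[OF B] VBV form_eigenvalues_def by simp
  qed
  have bnd: "\<omega>min \<le> t \<and> t \<le> \<omega>max" if "t \<in> E" for t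
    using hess_eigenvalue_bounds[OF B that[unfolded E_def], of 1 1] by simp
  have fin: "finite E" using hess_finite_nonempty[OF B] by (simp add: E_def)
  have "\<omega>max \<in> E" "\<omega>min \<in> E" using \<omega>max_attained \<omega>min_attained \<omega>_eig unfolding E by metis+
  moreover have "(\<lambda>t. \<bar>t\<bar>) ` E = E"
  proof -
    have "(\<lambda>t. \<bar>t\<bar>) ` E = id ` E" by (intro image_cong refl) (use bnd \<omega>min_pos in force)
    thus ?thesis by simp
  qed
  ultimately have "Max ((\<lambda>t. \<bar>t\<bar>) ` E) = \<omega>max" "Min ((\<lambda>t. \<bar>t\<bar>) ` E) = \<omega>min"
    using fin bnd by (auto intro!: Max_eqI Min_eqI)
  thus ?thesis by (simp add: kappa_hess_def E_def)
qed

end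

theorem theorem5p3:
  fixes d p l n :: nat and x :: "nat \<Rightarrow> real vec" and y :: "nat \<Rightarrow> nat"
    and lam :: real and \<mu> \<rho> :: "nat \<Rightarrow> real" and M Wstar :: "real mat"
  defines "SB \<equiv> scatter_B d l x y n"
      and "B \<equiv> scatter_w d x y n + lam \<cdot>\<^sub>m 1\<^sub>m d"
      and "f \<equiv> f_FDA (scatter_B d l x y n) (diag_N p \<mu>)"
  assumes samples: "\<forall>i<n. x i \<in> carrier_vec d"
      and labels: "\<forall>i<n. y i < l"
      and l_le_d: "l \<le> d"
      and lam: "lam \<ge> 0"
      and B_spd: "sym_pos_def_mat d B"
      and p_pos: "1 \<le> p" and p_lt_d: "p + 1 \<le> d"
      and mu_dec: "\<forall>j. 1 \<le> j \<and> j < p \<longrightarrow> \<mu> j > \<mu> (j + 1)" and mu_pos: "\<mu> p > 0"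
      and M_spd: "sym_pos_def_mat d M"
      and rho_gen_eig: "\<forall>t::real. det (t \<cdot>\<^sub>m B - SB) = det B * (\<Prod>k = 1..d. (t - \<rho> k))"
      and rho_sorted: "\<forall>k. 1 \<le> k \<and> k < d \<longrightarrow> \<rho> k \<ge> \<rho> (k + 1)"
      and rho_strict: "\<forall>j. 1 \<le> j \<and> j \<le> p \<longrightarrow> \<rho> j > \<rho> (j + 1)"
      and rho_nonneg: "\<rho> (p + 1) \<ge> 0"
      and Wstar_min: "Wstar \<in> gen_stiefel p d B" "\<forall>W \<in> gen_stiefel p d B. f Wstar \<le> f W"
  shows "kappa_hess p d B M f Wstar \<le> kappa_star_FDA p d \<mu> \<rho> * kappa_pencil d B M
       \<and> (M = B \<longrightarrow> kappa_hess p d B M f Wstar = kappa_star_FDA p d \<mu> \<rho>)"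
proof -
  \<comment> \<open>The shift to indices starting at 0: the last weight becomes
    \<open>m (p - 1)\<close> and the first eigenvalue left out by the minimizer becomes
    \<open>r p\<close>.\<close>
  define r where "r k = \<rho> (k + 1)" for k
  define m where "m k = \<mu> (k + 1)" for k
  have r_anti: "r b \<le> r a" if "a \<le> b" "b < d" for a b
    using that
  proof (induction b rule: dec_induct)
    case (step k)
    have "r (Suc k) \<le> r k" using rho_sorted step by (simp add: r_def)
    thus ?case using step by force
  qed simp
  have r_strict: "r a < r j" if "j < p" "j < a" "a < d" for j a
  proof -
    have "r (Suc j) < r j" using rho_strict that by (simp add: r_def)
    thus ?thesis using r_anti[of "Suc j" a] that by simp
  qed
  have m_strict: "m k < m j" if "j < k" "k < p" for j k
    using that
  proof (induction k)
    case (Suc k)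
    have "m (Suc k) < m k" using mu_dec Suc.prems by (simp add: m_def)
    thus ?case using Suc by (cases "j = k") auto
  qed simp
  have m_pos: "0 < m j" if "j < p" for j
  proof -
    have "0 < m (p - 1)" using mu_pos p_pos by (simp add: m_def)
    moreover have "j = p - 1 \<or> j < p - 1" using that by linarith
    ultimately show ?thesis using m_strict[of j "p - 1"] that by auto
  qed
  interpret w: fda_weights p d r m
    using p_pos p_lt_d r_anti r_strict m_strict m_pos by unfold_locales auto
  have SB: "SB \<in> carrier_mat d d" "SB\<^sup>T = SB"
    by (auto simp: SB_def scatter_B_def mult_ac intro!: eq_matI)
  have N: "diag_N p \<mu> = mat_diag p m" by (rule eq_matI) (auto simp: diag_N_def mat_diag_def m_def)
  have "(\<Prod>k = 1..d. t - \<rho> k) = (\<Prod>k<d. t - r k)" for t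
    unfolding r_def by (rule prod.reindex_bij_witness[of _ Suc "\<lambda>k. k - 1"]) auto
  hence "det (t \<cdot>\<^sub>m B - SB) = det B * (\<Prod>k<d. t - r k)" for t using rho_gen_eig by simp
  from pencil_diagonalize[OF B_spd SB this] obtain V0 where
    V0: "V0 \<in> carrier_mat d d" "V0\<^sup>T * B * V0 = 1\<^sub>m d" "V0\<^sup>T * SB * V0 = mat_diag d r" by blast
  have f: "f = f_FDA SB (mat_diag p m)" by (simp add: f_def SB_def N)
  obtain V where V: "V \<in> carrier_mat d d" "V\<^sup>T * B * V = 1\<^sub>m d" "V\<^sup>T * SB * V = mat_diag d r" "Wstar = V * w.E"
    using w.minimizer_structure[OF B_spd SB(1) V0 Wstar_min(1)] Wstar_min(2) unfolding f by blast
  interpret F: fda_frame p d r m SB B V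
    using B_spd SB V by unfold_locales auto
  have W: "Wstar = F.W" by (simp add: F.W_def V(4))
  have fN: "f = f_FDA SB F.N" by (simp add: f F.N_def)
  have ks: "kappa_star_FDA p d \<mu> \<rho> = w.\<omega>max / w.\<omega>min"
  proof -
    have "{(1/2) * (\<mu> j - \<mu> (j + 1)) * (\<rho> j - \<rho> (j + 1)) | j. 1 \<le> j \<and> j < p}
      = {(1/2) * (m j - m (j + 1)) * (r j - r (j + 1)) | j. j + 1 < p}" (is "?L = ?R")
    proof (intro equalityI subsetI)
      fix z assume "z \<in> ?L"
      then obtain j where "1 \<le> j" "j < p" "z = (1/2) * (\<mu> j - \<mu> (j + 1)) * (\<rho> j - \<rho> (j + 1))" by blast
      thus "z \<in> ?R" by (intro CollectI exI[of _ "j - 1"]) (simp add: m_def r_def)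
    next
      fix z assume "z \<in> ?R"
      then obtain j where "j + 1 < p" "z = (1/2) * (m j - m (j + 1)) * (r j - r (j + 1))" by blast
      thus "z \<in> ?L" by (intro CollectI exI[of _ "j + 1"]) (simp add: m_def r_def)
    qed
    thus ?thesis unfolding kappa_star_FDA_def w.\<omega>max_def w.\<omega>min_def
      using p_pos p_lt_d by (simp add: m_def r_def)
  qed
  show ?thesis unfolding W fN ks using F.kappa_hess_le[OF M_spd] F.kappa_hess_eq by blast
qed

end
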